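(* (1) There are infinitely many $j\in\mathbb{Q}$ such that there exists an elliptic curve $E/\mathbb{Q}$ with $j(E)=j$ that satisfies $E(\mathbb{Q})_{\mathrm{tors}}=\{\mathcal{O}\}$ and $E(\mathbb{Q}_{\infty,3})_{\mathrm{tors}}\simeq\mathbb{Z}/7\mathbb{Z}$. (2) There are infinitely many $j\in\mathbb{Q}$ such that there exists an elliptic curve $E/\mathbb{Q}$ with $j(E)=j$ that satisfies $E(\mathbb{Q})_{\mathrm{tors}}\simeq\mathbb{Z}/3\mathbb{Z}$ and $E(\mathbb{Q}_{\infty,3})_{\mathrm{tors}}\simeq\mathbb{Z}/9\mathbb{Z}$.
   Context: $\mathbb{Q}_{\infty,3}$ denotes the $\mathbb{Z}_3$-extension of $\mathbb{Q}$, i.e. the unique Galois extension of $\mathbb{Q}$ (inside $\overline{\mathbb{Q}}$) with Galois group isomorphic to the additive group $\mathbb{Z}_3$ of $3$-adic integers; it is the fixed field in $\mathbb{Q}(\zeta_{3^\infty})$ of the order-2 subgroup of $\mathrm{Gal}(\mathbb{Q}(\zeta_{3^\infty})/\mathbb{Q})\simeq\mathbb{Z}_3^\times$. For a field $K$, $E(K)_{\mathrm{tors}}$ is the torsion subgroup of $E(K)$, and $\mathcal{O}$ is the identity of $E$. *)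

theory Defs
  imports Complex_Main "HOL-Algebra.Algebra" "HOL-Algebra.Algebraic_Closure_Type"
begin

section \<open>Elliptic curves in Weierstrass form\<close>

text \<open>
  \<^term>\<open>Weierstrass a\<^sub>1 a\<^sub>2 a\<^sub>3 a\<^sub>4 a\<^sub>6\<close> stands for the projective plane cubic with affine equation
  \<open>y\<^sup>2 + a\<^sub>1xy + a\<^sub>3y = x\<^sup>3 + a\<^sub>2x\<^sup>2 + a\<^sub>4x + a\<^sub>6\<close>; its only point at infinity is the
  identity \<open>\<O>\<close> of the group law.
\<close>

datatype 'a weierstrass =
  Weierstrass (coeff_a1: 'a) (coeff_a2: 'a) (coeff_a3: 'a) (coeff_a4: 'a) (coeff_a6: 'a)

datatype 'a ec_point = Origin | Affine 'a 'a

definition b2 :: "'a::field weierstrass \<Rightarrow> 'a" where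
  "b2 E = coeff_a1 E ^ 2 + 4 * coeff_a2 E"

definition b4 :: "'a::field weierstrass \<Rightarrow> 'a" where
  "b4 E = 2 * coeff_a4 E + coeff_a1 E * coeff_a3 E"

definition b6 :: "'a::field weierstrass \<Rightarrow> 'a" where
  "b6 E = coeff_a3 E ^ 2 + 4 * coeff_a6 E"

definition b8 :: "'a::field weierstrass \<Rightarrow> 'a" where
  "b8 E = coeff_a1 E ^ 2 * coeff_a6 E + 4 * coeff_a2 E * coeff_a6 E
        - coeff_a1 E * coeff_a3 E * coeff_a4 E + coeff_a2 E * coeff_a3 E ^ 2 - coeff_a4 E ^ 2"

definition c4 :: "'a::field weierstrass \<Rightarrow> 'a" where
  "c4 E = b2 E ^ 2 - 24 * b4 E"

definition discriminant :: "'a::field weierstrass \<Rightarrow> 'a" where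
  "discriminant E = - (b2 E ^ 2 * b8 E) - 8 * b4 E ^ 3 - 27 * b6 E ^ 2 + 9 * b2 E * b4 E * b6 E"

definition elliptic_curve :: "'a::field weierstrass \<Rightarrow> bool" where
  "elliptic_curve E \<longleftrightarrow> discriminant E \<noteq> 0"

definition j_invariant :: "'a::field weierstrass \<Rightarrow> 'a" where
  "j_invariant E = c4 E ^ 3 / discriminant E"

definition on_curve :: "'a::field weierstrass \<Rightarrow> 'a \<Rightarrow> 'a \<Rightarrow> bool" where
  "on_curve E x y \<longleftrightarrow>
     y ^ 2 + coeff_a1 E * x * y + coeff_a3 E * y
       = x ^ 3 + coeff_a2 E * x ^ 2 + coeff_a4 E * x + coeff_a6 E"

text \<open>
  The chord-and-tangent law.  The inverse of \<open>(x, y)\<close> is \<open>(x, -y - a\<^sub>1x - a\<^sub>3)\<close>, so the first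
  test below says that the two points are mutually inverse; for points of the curve with equal
  abscissa that fail it, the points coincide and \<open>l\<close> is the slope of the tangent there.
\<close>

fun ec_add :: "'a::field weierstrass \<Rightarrow> 'a ec_point \<Rightarrow> 'a ec_point \<Rightarrow> 'a ec_point" where
  "ec_add E Origin Q = Q"
| "ec_add E (Affine x1 y1) Origin = Affine x1 y1"
| "ec_add E (Affine x1 y1) (Affine x2 y2) =
     (if x1 = x2 \<and> y1 + y2 + coeff_a1 E * x2 + coeff_a3 E = 0 then Origin
      else
        let l = (if x1 = x2
                 then (3 * x1 ^ 2 + 2 * coeff_a2 E * x1 + coeff_a4 E - coeff_a1 E * y1)
                        / (2 * y1 + coeff_a1 E * x1 + coeff_a3 E)
                 else (y2 - y1) / (x2 - x1));
            n = y1 - l * x1;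
            x3 = l ^ 2 + coeff_a1 E * l - coeff_a2 E - x1 - x2
        in Affine x3 (- ((l + coeff_a1 E) * x3) - n - coeff_a3 E))"

text \<open>\<open>E(K)\<close>, for a subfield \<open>K\<close> of the ground type over which \<open>E\<close> is defined.\<close>

definition rational_points :: "'a::field weierstrass \<Rightarrow> 'a set \<Rightarrow> 'a ec_point monoid" where
  "rational_points E K =
     \<lparr>carrier = insert Origin {Affine x y | x y. x \<in> K \<and> y \<in> K \<and> on_curve E x y},
      monoid.mult = ec_add E,
      one = Origin\<rparr>"

definition torsion_subgroup :: "('a, 'b) monoid_scheme \<Rightarrow> ('a, 'b) monoid_scheme" where
  "torsion_subgroup G =
     G\<lparr>carrier := {x \<in> carrier G. \<exists>n::nat. n > 0 \<and> x [^]\<^bsub>G\<^esub> n = \<one>\<^bsub>G\<^esub>}\<rparr>"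

text \<open>\<open>E(K)\<close>\<open>\<^sub>t\<^sub>o\<^sub>r\<^sub>s\<close> for a curve \<open>E\<close> over \<open>\<rat>\<close> and a subfield \<open>K\<close> of \<open>\<complex>\<close>.\<close>

definition torsion_points :: "rat weierstrass \<Rightarrow> complex set \<Rightarrow> complex ec_point monoid" where
  "torsion_points E K = torsion_subgroup (rational_points (map_weierstrass of_rat E) K)"


section \<open>The \<open>\<int>\<^sub>3\<close>-extension of \<open>\<rat>\<close>\<close>

text \<open>All number fields, finite or infinite, are taken inside \<open>\<complex>\<close>.\<close>

abbreviation complex_field :: "complex ring" where
  "complex_field \<equiv> ring_of_type_algebra"

definition galois_group :: "complex set \<Rightarrow> complex set \<Rightarrow> (complex \<Rightarrow> complex) monoid" where
  "galois_group L F =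
     BijGroup L \<lparr>carrier :=
       {\<sigma> \<in> Bij L. \<sigma> \<in> ring_hom (complex_field\<lparr>carrier := L\<rparr>) (complex_field\<lparr>carrier := L\<rparr>)
                  \<and> (\<forall>x \<in> F. \<sigma> x = x)}\<rparr>"

definition fixed_field :: "complex set \<Rightarrow> (complex \<Rightarrow> complex) set \<Rightarrow> complex set" where
  "fixed_field L H = {x \<in> L. \<forall>\<sigma> \<in> H. \<sigma> x = x}"

text \<open>\<open>\<rat>(\<zeta>)\<close> with \<open>\<zeta>\<close> running over all roots of unity of \<open>3\<close>-power order.\<close>

definition cyclotomic_3_infinity :: "complex set" where
  "cyclotomic_3_infinity = generate_field complex_field {z. \<exists>n::nat. z ^ (3 ^ n) = 1}"

text \<open>
  The Galois group of the above field over \<open>\<rat>\<close> is \<open>\<int>\<^sub>3\<close>\<open>\<^sup>\<times>\<close>; it has exactly one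
  subgroup of order \<open>2\<close>, see \<open>galois_subgroup_order2\<close> below.
\<close>

definition Q_infinity_3 :: "complex set" where
  "Q_infinity_3 =
     fixed_field cyclotomic_3_infinity
       (THE H. subgroup H (galois_group cyclotomic_3_infinity \<rat>) \<and> card H = 2)"


subsection \<open>The subgroup of order two\<close>

lemma cf_simps:
  "carrier complex_field = UNIV" "x \<otimes>\<^bsub>complex_field\<^esub> y = x * y" "x \<oplus>\<^bsub>complex_field\<^esub> y = x + y"
  "\<one>\<^bsub>complex_field\<^esub> = 1" "\<zero>\<^bsub>complex_field\<^esub> = 0"
  by (simp_all add: ring_of_type_algebra_def)

lemma cf_field: "field complex_field"
  by (rule field_from_type_algebra)

lemma cf_uminus: "\<ominus>\<^bsub>complex_field\<^esub> x = - x"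
proof -
  interpret field complex_field by (rule cf_field)
  have "\<ominus>\<^bsub>complex_field\<^esub> x \<oplus>\<^bsub>complex_field\<^esub> x = \<zero>\<^bsub>complex_field\<^esub>"
    by (rule l_neg) (simp add: cf_simps)
  thus ?thesis by (simp add: cf_simps add_eq_0_iff2)
qed

lemma cf_inv: "x \<noteq> 0 \<Longrightarrow> inv\<^bsub>complex_field\<^esub> x = inverse x"
proof -
  assume x: "x \<noteq> 0"
  interpret field complex_field by (rule cf_field)
  have "x \<in> Units complex_field" using x by (simp add: field_Units cf_simps)
  hence "inv\<^bsub>complex_field\<^esub> x \<otimes>\<^bsub>complex_field\<^esub> x = \<one>\<^bsub>complex_field\<^esub>" by (rule Units_l_inv)
  thus ?thesis using x by (simp add: cf_simps field_simps)
qed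

abbreviation (input) "K3 \<equiv> cyclotomic_3_infinity"
abbreviation (input) "G3 \<equiv> galois_group cyclotomic_3_infinity \<rat>"

lemma K3_closed:
  "1 \<in> K3" "z ^ (3^n) = 1 \<Longrightarrow> z \<in> K3" "x \<in> K3 \<Longrightarrow> - x \<in> K3"
  "x \<in> K3 \<Longrightarrow> x \<noteq> 0 \<Longrightarrow> inverse x \<in> K3"
  "x \<in> K3 \<Longrightarrow> y \<in> K3 \<Longrightarrow> x + y \<in> K3"  "x \<in> K3 \<Longrightarrow> y \<in> K3 \<Longrightarrow> x * y \<in> K3"
  unfolding cyclotomic_3_infinity_def
  using generate_field.intros[where R=complex_field and H="{z. \<exists>n::nat. z ^ (3 ^ n) = 1}", unfolded cf_simps cf_uminus] cf_inv
  by auto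

lemma K3_induct [consumes 1, case_names one root uminus inverse add mult]:
  assumes "x \<in> K3" "P 1" "\<And>z n. z ^ (3^n) = 1 \<Longrightarrow> P z" "\<And>x. x \<in> K3 \<Longrightarrow> P x \<Longrightarrow> P (- x)"
   "\<And>x. x \<in> K3 \<Longrightarrow> P x \<Longrightarrow> x \<noteq> 0 \<Longrightarrow> P (inverse x)"
   "\<And>x y. x \<in> K3 \<Longrightarrow> y \<in> K3 \<Longrightarrow> P x \<Longrightarrow> P y \<Longrightarrow> P (x + y)"
   "\<And>x y. x \<in> K3 \<Longrightarrow> y \<in> K3 \<Longrightarrow> P x \<Longrightarrow> P y \<Longrightarrow> P (x * y)"
  shows "P x"
proof -
  have "x \<in> generate_field complex_field {z. \<exists>n::nat. z ^ (3 ^ n) = 1}"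
    using assms(1) by (simp add: cyclotomic_3_infinity_def)
  thus ?thesis
  proof (induction rule: generate_field.induct)
    case (a_inv h) thus ?case using assms(4) by (simp add: cf_uminus cyclotomic_3_infinity_def)
  next
    case (m_inv h) thus ?case using assms(5) by (simp add: cf_inv cf_simps cyclotomic_3_infinity_def)
  qed (use assms(2,3,6,7) in \<open>auto simp: cf_simps cyclotomic_3_infinity_def\<close>)
qed

lemma K3_cnj: "x \<in> K3 \<Longrightarrow> cnj x \<in> K3"
proof (induction rule: K3_induct)
  case (root z n)
  have "cnj z ^ (3^n) = 1" using root by (metis complex_cnj_power complex_cnj_one)
  thus ?case by (rule K3_closed)
next
  case (inverse x) thus ?case by (simp add: K3_closed(4))
qed (auto simp: K3_closed)

lemma G3_iff: "s \<in> carrier G3 \<longleftrightarrow> s \<in> Bij K3 \<and> (\<forall>x\<in>K3. \<forall>y\<in>K3. s (x+y) = s x + s y)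
  \<and> (\<forall>x\<in>K3. \<forall>y\<in>K3. s (x*y) = s x * s y) \<and> s 1 = 1 \<and> (\<forall>x\<in>\<rat>. s x = x)"
  unfolding galois_group_def ring_hom_def using Bij_imp_funcset by (auto simp: cf_simps)

lemma G3_mult: "s \<in> Bij K3 \<Longrightarrow> t \<in> Bij K3 \<Longrightarrow> s \<otimes>\<^bsub>G3\<^esub> t = compose K3 s t"
  and G3_one: "\<one>\<^bsub>G3\<^esub> = (\<lambda>x\<in>K3. x)"
  by (simp_all add: galois_group_def BijGroup_def)

lemma K3_rat: "x \<in> \<rat> \<Longrightarrow> x \<in> K3"
proof (erule Rats_cases')
  fix a b assume x: "b > 0" "x = of_int a / (of_int b :: complex)"
  have 0: "0 \<in> K3" using K3_closed(5)[OF K3_closed(1) K3_closed(3)[OF K3_closed(1)]] by simp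
  have n: "of_nat n \<in> K3" for n by (induction n) (auto simp: 0 K3_closed)
  have i: "of_int a \<in> K3" for a by (cases a) (use n K3_closed(3) in \<open>auto simp del: of_nat_Suc\<close>)
  show ?thesis using x K3_closed(6)[OF i[of a] K3_closed(4)[OF i[of b]]] by (simp add: divide_inverse)
qed

lemma cnj_rat: "x \<in> \<rat> \<Longrightarrow> cnj x = x"
  by (erule Rats_cases') simp

lemma G3_order2:
  assumes s: "s \<in> carrier G3" and ss: "s \<otimes>\<^bsub>G3\<^esub> s = \<one>\<^bsub>G3\<^esub>" and ne: "s \<noteq> \<one>\<^bsub>G3\<^esub>"
  shows "s = (\<lambda>x\<in>K3. cnj x)"
proof -
  note S = s[unfolded G3_iff]
  have ssx: "s (s x) = x" if "x \<in> K3" for x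
  proof -
    have "compose K3 s s x = (\<lambda>x\<in>K3. x) x" using ss S G3_mult G3_one by auto
    thus ?thesis using that by (simp add: compose_def)
  qed
  have pw: "s (x ^ n) = s x ^ n \<and> x ^ n \<in> K3" if "x \<in> K3" for x n
    using that S by (induction n) (auto simp: K3_closed)
  have u: "s (- x) = - s x" if "x \<in> K3" for x
  proof -
    have 0: "0 \<in> K3" by (rule K3_rat) simp
    have "s (x + - x) = s x + s (- x)" using S that K3_closed(3) by blast
    moreover have "s 0 = 0" using S by (metis Rats_0)
    ultimately show ?thesis by (simp add: eq_neg_iff_add_eq_0 add.commute)
  qed
  have iv: "s (inverse x) = inverse (s x)" if "x \<in> K3" "x \<noteq> 0" for x
  proof -
    have "s (x * inverse x) = s x * s (inverse x)" using S that K3_closed(4) by blast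
    hence "s x * s (inverse x) = 1" using S that by simp
    thus ?thesis by (metis inverse_unique)
  qed
  define z where "z n = cis (2 * pi / 3 ^ n)" for n :: nat
  have zn: "z n ^ (3^n) = 1" for n by (simp add: z_def Complex.DeMoivre cis_2pi)
  have zK: "z n \<in> K3" for n using zn K3_closed(2) by blast
  have all: "\<exists>k. w = z n ^ k" if "w ^ (3^n) = 1" for w n
  proof -
    have "bij_betw (\<lambda>k. cis (2 * pi * real k / real (3^n))) {..<3^n} {z. z ^ (3^n) = 1}"
      by (rule Complex.bij_betw_roots_unity) simp
    hence "w \<in> (\<lambda>k. cis (2 * pi * real k / real (3^n))) ` {..<3^n}" using that by (simp only: bij_betw_def mem_Collect_eq)
    then obtain k where "w = cis (2 * pi * real k / real (3^n))" by blast
    hence "w = z n ^ k" by (simp add: z_def Complex.DeMoivre field_simps)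
    thus ?thesis ..
  qed
  have inj: "z n ^ k = 1 \<longleftrightarrow> 3 ^ n dvd k" for n k
  proof
    assume "3 ^ n dvd k" thus "z n ^ k = 1" by (metis dvd_def power_mult power_one zn)
  next
    assume "z n ^ k = 1"
    hence "cis (real k * (2 * pi / 3 ^ n)) = 1" by (simp add: z_def Complex.DeMoivre)
    hence "cos (real k * (2 * pi / 3 ^ n)) = 1" by (metis cis.sel(1) one_complex.sel(1))
    then obtain m :: int where "real k * (2 * pi / 3 ^ n) = real_of_int m * 2 * pi"
      using cos_one_2pi_int by auto
    hence "real k = real_of_int m * 3 ^ n" by (simp add: field_simps)
    hence "real_of_int (int k) = real_of_int (m * 3 ^ n)" by simp
    hence "int k = m * 3 ^ n" using of_int_eq_iff by blast
    hence "int (3 ^ n) dvd int k" by simp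
    thus "3 ^ n dvd k" by (metis of_nat_dvd_iff)
  qed
  have zc: "cnj (z n) * z n = 1" for n by (simp add: z_def cis_mult cis_cnj)
  have dich: "s (z n) = z n \<or> s (z n) = cnj (z n)" for n
  proof -
    have "s (z n) ^ (3^n) = 1" using pw[OF zK, of n "3^n"] zn S by simp
    then obtain k where k: "s (z n) = z n ^ k" using all by blast
    have "z n = s (z n ^ k)" using ssx[OF zK] k by metis
    also have "\<dots> = z n ^ (k * k)" using pw[OF zK] k by (simp add: power_mult)
    finally have e: "z n ^ (k*k) = z n" ..
    show ?thesis
    proof (cases "k = 0")
      case True thus ?thesis using e k by simp
    next
      case False
      then obtain l where l: "k = Suc l" using not0_implies_Suc by auto
      have kk: "k * k = Suc (l * (k + 1))" by (simp add: l)
      have "z n * z n ^ (l * (k + 1)) = z n * 1"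
        using e kk by (simp only: power_Suc mult_1_right)
      hence "z n ^ (l * (k+1)) = 1" using zc[of n] by (metis mult_cancel_left mult_zero_right zero_neq_one)
      hence d: "3 ^ n dvd l * (l + 2)" using inj l by simp
      have "3 ^ n dvd l \<or> 3 ^ n dvd (l + 2)"
      proof (cases "3 dvd l")
        case True
        hence "\<not> 3 dvd l + 2" by presburger
        hence "coprime (3^n) (l+2)" by (simp add: prime_imp_coprime)
        thus ?thesis using d coprime_dvd_mult_left_iff by blast
      next
        case False
        hence "coprime (3^n) l" by (simp add: prime_imp_coprime)
        thus ?thesis using d coprime_dvd_mult_right_iff by blast
      qed
      thus ?thesis
      proof
        assume "3 ^ n dvd l"
        thus ?thesis using inj l k by simp
      next
        assume "3 ^ n dvd l + 2"
        hence "z n ^ k * z n = 1" using inj[of n "l+2"] l by (simp add: mult.commute)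
        hence "z n ^ k = cnj (z n)" using zc[of n]
          by (metis mult_cancel_right mult_zero_right zero_neq_one)
        thus ?thesis using k by simp
      qed
    qed
  qed
  have z1: "z 1 \<noteq> cnj (z 1)"
  proof
    assume "z 1 = cnj (z 1)"
    hence "z 1 ^ 2 = 1" using zc[of 1] by (simp add: power2_eq_square)
    thus False using inj[of 1 2] by simp
  qed
  have red: "z 1 = z (Suc n) ^ (3^n)" for n by (simp add: z_def Complex.DeMoivre field_simps)
  have ext: "\<forall>x\<in>K3. s x = f x" if f: "\<And>n. s (z n) = f (z n)" and
    fh: "f 1 = 1" "\<And>x y. f (x+y) = f x + f y" "\<And>x y. f (x * y) = f x * f y" "\<And>x. f (- x) = - f x"
     "\<And>x. f (inverse x) = inverse (f x)" for f
  proof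
    fix x assume "x \<in> K3" thus "s x = f x"
    proof (induction rule: K3_induct)
      case (root w n)
      then obtain k where k: "w = z n ^ k" using all by blast
      have "f (z n ^ k) = f (z n) ^ k" by (induction k) (auto simp: fh)
      thus ?case using pw[OF zK, of n k] f k by simp
    qed (use S fh u iv in auto)
  qed
  show ?thesis
  proof (cases "s (z 1) = z 1")
    case True
    have "s (z n) = id (z n)" for n
    proof (cases n)
      case 0 thus ?thesis using S by (simp add: z_def cis_2pi)
    next
      case (Suc m)
      show ?thesis
      proof (rule ccontr)
        assume "s (z n) \<noteq> id (z n)"
        hence "s (z n) = cnj (z n)" using dich by auto
        hence "s (z 1) = cnj (z 1)" using pw[OF zK, of n "3^m"] red[of m] Suc by simp
        thus False using True z1 by simp
      qed
    qed
    hence "\<forall>x\<in>K3. s x = id x" by (intro ext) auto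
    hence "s = \<one>\<^bsub>G3\<^esub>" unfolding G3_one
      by (intro extensionalityI[of _ K3]) (use S Bij_imp_extensional in auto)
    thus ?thesis using ne by simp
  next
    case False
    have "s (z n) = cnj (z n)" for n
    proof (cases n)
      case 0 thus ?thesis using S by (simp add: z_def cis_2pi)
    next
      case (Suc m)
      show ?thesis
      proof (rule ccontr)
        assume "s (z n) \<noteq> cnj (z n)"
        hence "s (z n) = z n" using dich by auto
        hence "s (z 1) = z 1" using pw[OF zK, of n "3^m"] red[of m] Suc by simp
        thus False using False by simp
      qed
    qed
    hence "\<forall>x\<in>K3. s x = cnj x" by (intro ext) auto
    thus ?thesis
      by (intro extensionalityI[of _ K3]) (use S Bij_imp_extensional in auto)
  qed
qed

lemma galois_subgroup_order2: "subgroup H G3 \<and> card H = 2 \<longleftrightarrow> H = {\<lambda>x\<in>K3. x, \<lambda>x\<in>K3. cnj x}"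
proof -
  let ?i = "\<lambda>x\<in>K3. x" and ?c = "\<lambda>x\<in>K3. cnj x"
  have cB: "?c \<in> Bij K3" unfolding Bij_def
  proof (intro IntI CollectI)
    show "bij_betw ?c K3 K3"
      by (rule bij_betw_byWitness[of _ ?c]) (auto simp: K3_cnj)
  qed auto
  have iB: "?i \<in> Bij K3" by (rule id_Bij)
  have c: "?c \<in> carrier G3" unfolding G3_iff using cB
    by (auto simp: K3_closed K3_rat cnj_rat)
  have i: "?i \<in> carrier G3" unfolding G3_iff using iB
    by (auto simp: K3_closed K3_rat)
  have cc: "?c \<otimes>\<^bsub>G3\<^esub> ?c = ?i" "?i \<otimes>\<^bsub>G3\<^esub> ?c = ?c" "?c \<otimes>\<^bsub>G3\<^esub> ?i = ?c" "?i \<otimes>\<^bsub>G3\<^esub> ?i = ?i"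
    using cB iB by (auto simp: G3_mult compose_def K3_cnj fun_eq_iff)
  have sq: "a = ?i" if "a \<in> carrier G3" "a \<otimes>\<^bsub>G3\<^esub> a = a" for a
  proof -
    have B: "a \<in> Bij K3" using that G3_iff by blast
    have e: "compose K3 a a = a" using that(2) G3_mult[OF B B] by simp
    have "a x = x" if "x \<in> K3" for x
    proof -
      have "a (a x) = a x" using fun_cong[OF e, of x] that by (simp add: compose_def)
      moreover have "inj_on a K3" "a x \<in> K3" using B that by (auto simp: Bij_def bij_betw_def)
      ultimately show ?thesis using that by (metis inj_onD)
    qed
    thus ?thesis by (intro extensionalityI[of _ K3]) (use B Bij_imp_extensional in auto)
  qed
  have ne: "?i \<noteq> ?c"
  proof
    assume e: "?i = ?c"
    define w where "w = cis (2 * pi / 3)"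
    have "w ^ (3^1) = 1" by (simp add: w_def Complex.DeMoivre cis_2pi)
    hence wK: "w \<in> K3" by (rule K3_closed(2))
    from fun_cong[OF e, of w] have "w = cnj w" using wK by simp
    hence "Im w = 0" by (metis Reals_cnj_iff complex_is_Real_iff)
    hence "sin (2 * pi / 3) = 0" by (simp add: w_def)
    moreover have "sin (2 * pi / 3) > 0" by (rule sin_gt_zero) auto
    ultimately show False by simp
  qed
  show ?thesis
  proof
    assume H: "subgroup H G3 \<and> card H = 2"
    then obtain a b where ab: "H = {a, b}" "a \<noteq> b" by (auto simp: card_2_iff)
    have i1: "?i \<in> H" using H subgroup.one_closed[of H G3] by (simp add: G3_one)
    then obtain s where s: "H = {?i, s}" "s \<noteq> ?i" using ab by auto
    have sc: "s \<in> carrier G3" using H s subgroup.subset by blast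
    have "s \<otimes>\<^bsub>G3\<^esub> s \<in> H" using H s subgroup.m_closed by (metis insertI1 insertI2)
    hence "s \<otimes>\<^bsub>G3\<^esub> s = ?i" using sq[OF sc] s by auto
    hence "s = ?c" using G3_order2[OF sc] s by (simp add: G3_one)
    thus "H = {?i, ?c}" using s by simp
  next
    assume H: "H = {?i, ?c}"
    have gr: "group (BijGroup K3)" by (rule group_BijGroup)
    have inv: "inv\<^bsub>G3\<^esub> ?i \<in> H" "inv\<^bsub>G3\<^esub> ?c \<in> H"
    proof -
      have un: "m_inv G3 y = y" if y: "y \<in> carrier G3" "y \<otimes>\<^bsub>G3\<^esub> y = ?i" for y
        unfolding m_inv_def
      proof (rule the_equality)
        show "y \<in> carrier G3 \<and> y \<otimes>\<^bsub>G3\<^esub> y = \<one>\<^bsub>G3\<^esub> \<and> y \<otimes>\<^bsub>G3\<^esub> y = \<one>\<^bsub>G3\<^esub>"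
          using y by (simp add: G3_one)
        fix t assume t: "t \<in> carrier G3 \<and> y \<otimes>\<^bsub>G3\<^esub> t = \<one>\<^bsub>G3\<^esub> \<and> t \<otimes>\<^bsub>G3\<^esub> y = \<one>\<^bsub>G3\<^esub>"
        have B: "y \<in> Bij K3" "t \<in> Bij K3" using y t by (auto simp: G3_iff)
        have e: "compose K3 y y = compose K3 y t" using y t B by (simp add: G3_mult G3_one)
        have "t x = y x" if "x \<in> K3" for x
        proof -
          have "y (y x) = y (t x)" using fun_cong[OF e, of x] that by (simp add: compose_def)
          moreover have "inj_on y K3" "y x \<in> K3" "t x \<in> K3" using B that by (auto simp: Bij_def bij_betw_def)
          ultimately show ?thesis by (metis inj_onD)
        qed
        thus "t = y" by (intro extensionalityI[of _ K3]) (use B Bij_imp_extensional in auto)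
      qed
      show "inv\<^bsub>G3\<^esub> ?i \<in> H" "inv\<^bsub>G3\<^esub> ?c \<in> H" using un[OF i] un[OF c] cc H by auto
    qed
    have "subgroup H G3"
    proof
      show "H \<subseteq> carrier G3" using H i c by auto
      show "\<And>x y. x \<in> H \<Longrightarrow> y \<in> H \<Longrightarrow> x \<otimes>\<^bsub>G3\<^esub> y \<in> H" using H cc by auto
      show "\<one>\<^bsub>G3\<^esub> \<in> H" using H by (simp add: G3_one)
      show "\<And>x. x \<in> H \<Longrightarrow> inv\<^bsub>G3\<^esub> x \<in> H" using inv H by auto
    qed
    moreover have "card H = 2" using ne H by simp
    ultimately show "subgroup H G3 \<and> card H = 2" ..
  qed
qed

lemma Q_infinity_3_eq: "Q_infinity_3 = cyclotomic_3_infinity \<inter> \<real>"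
proof -
  have "(THE H. subgroup H G3 \<and> card H = 2) = {\<lambda>x\<in>K3. x, \<lambda>x\<in>K3. cnj x}"
    by (simp add: galois_subgroup_order2)
  thus ?thesis unfolding Q_infinity_3_def fixed_field_def
    by (auto simp: Reals_cnj_iff)
qed

end

theory Submission
  imports Defs "Jordan_Normal_Form.Char_Poly" "HOL-Number_Theory.Residues"
begin

text \<open>
  A rational point of order \<open>7\<close> or \<open>9\<close> puts an elliptic curve in Tate normal form.  When the
  parameter is a quotient of two of three conjugate elements \<open>u\<close>, \<open>v\<close>, \<open>w\<close> of trace zero in the real
  cubic subfield of \<open>\<rat>(\<zeta>\<^sub>9)\<close>, the cyclic permutation of \<open>u\<close>, \<open>v\<close>, \<open>w\<close> multiplies the point of
  order \<open>7\<close> by an integer, respectively translates the point of order \<open>9\<close> by a rational point of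
  order \<open>3\<close>.  The coefficients are therefore rational while the point is defined over the cubic
  field.  It remains to bound the torsion over \<open>\<rat>\<^sub>\<infinity>\<^sub>,\<^sub>3\<close>.

  The prime \<open>3\<close> is totally ramified with residue field of three elements.  Near the origin
  tripling strictly decreases the \<open>3\<close>-adic valuation of \<open>y\<^sup>2\<close>, so the torsion there has
  \<open>3\<close>-power order.  For the first family every point reduces to a multiple of the known point of
  order \<open>7\<close>, and points of order \<open>3\<close> are excluded at the prime \<open>7\<close>, which is unramified.
  For the second family either a point or its double lies in the region where tripling is
  contracting, except for points of order two, and these are excluded at \<open>2\<close>.  Complex conjugation
  leaves only one subgroup of order \<open>3\<close>, and a point of order \<open>27\<close> would make \<open>e = u v w\<close> a cube,
  although \<open>37\<close> divides it exactly once and is unramified.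
\<close>

section \<open>The group law\<close>

text \<open>For \<open>N = 7\<close> and \<open>N = 9\<close> the curve \<open>X_1(N)\<close> has
  genus zero and its diamond operators form a cyclic group of order 3, acting on a parameter by a
  Moebius map. In \<open>r = u / v\<close> with \<open>u + v + w = 0\<close> that map is
  \<open>r -> -1 / (1 + r)\<close>, induced by \<open>u -> v -> w -> u\<close>; this is why the
  trace must vanish. Galois acts on the conjugates by the same permutation, so the homogeneous
  invariants of the curve become integers. The base field has infinite degree, so estimates must be
  uniform in the level of the tower. Valuations are therefore normalized by \<open>v3 3 = 1\<close>,
  and the generators are irrational because \<open>u - v\<close> has the non-integral valuation
  \<open>2 / 3\<close>. The value \<open>n = 3\<close> gives \<open>e = -37\<close>,
  \<open>e2 = -21\<close>, \<open>dl = -9\<close> and \<open>27 e + dl = -7 * 144\<close>; the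
  congruence on \<open>n\<close> preserves what these say at 3, 7 and 37 and leaves infinitely many
  \<open>n\<close>. As rational functions of \<open>n\<close> both \<open>j\<close>-invariants have
  a pole at a root of \<open>e\<close>, so they are not constant.\<close>

abbreviation cubic_model :: "'a \<Rightarrow> 'a \<Rightarrow> 'a \<Rightarrow> 'a::field weierstrass" where
  "cubic_model a b c \<equiv> Weierstrass 0 a 0 b c"

declare ec_add.simps(3) [simp del]

fun ec_neg :: "'a::field ec_point \<Rightarrow> 'a ec_point" where
  "ec_neg Origin = Origin"
| "ec_neg (Affine x y) = Affine x (- y)"

locale nonsingular_cubic =
  fixes a b c :: "'a::field_char_0"
  assumes nonsingular: "x ^ 3 + a * x ^ 2 + b * x + c = 0 \<Longrightarrow> 3 * x ^ 2 + 2 * a * x + b \<noteq> 0"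
begin

abbreviation add (infixl "\<boxplus>" 65) where "P \<boxplus> Q \<equiv> ec_add (cubic_model a b c) P Q"

fun on :: "'a ec_point \<Rightarrow> bool" where
  "on Origin \<longleftrightarrow> True"
| "on (Affine x y) \<longleftrightarrow> y ^ 2 = x ^ 3 + a * x ^ 2 + b * x + c"

text \<open>Either equation determines the slope of the chord or tangent whenever its left-hand
  factor is non-zero; imposing both treats chords and tangents uniformly.\<close>

definition slope :: "'a \<Rightarrow> 'a \<Rightarrow> 'a \<Rightarrow> 'a \<Rightarrow> 'a \<Rightarrow> bool" where
  "slope x1 y1 x2 y2 l \<longleftrightarrow> l * (x2 - x1) = y2 - y1 \<and>
     l * (y1 + y2) = x1 ^ 2 + x1 * x2 + x2 ^ 2 + a * (x1 + x2) + b"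

lemma slope_commute: "slope x1 y1 x2 y2 l \<longleftrightarrow> slope x2 y2 x1 y1 l"
  unfolding slope_def by (auto simp: algebra_simps eq_diff_eq diff_eq_eq)

lemma eq_or_opposite:
  assumes "on (Affine x y1)" "on (Affine x y2)" "y1 + y2 \<noteq> 0"
  shows "y1 = y2"
proof -
  have "(y1 - y2) * (y1 + y2) = 0" using assms by (simp add: power2_eq_square algebra_simps)
  thus ?thesis using assms(3) by simp
qed

lemma slope_exists:
  assumes "on (Affine x1 y1)" "on (Affine x2 y2)" "\<not> (x1 = x2 \<and> y1 + y2 = 0)"
  shows "\<exists>l. slope x1 y1 x2 y2 l"
proof (cases "x1 = x2")
  case True
  with assms eq_or_opposite have "y1 = y2" by blast
  hence "y1 + y1 \<noteq> 0" using True assms(3) by auto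
  hence "(3 * x1^2 + 2 * a * x1 + b) / (y1 + y1) * (y1 + y1) = 3 * x1^2 + 2 * a * x1 + b" by simp
  thus ?thesis using True \<open>y1 = y2\<close>
    by (intro exI[of _ "(3 * x1^2 + 2 * a * x1 + b) / (y1 + y1)"])
       (simp only: slope_def, simp add: power2_eq_square algebra_simps del: times_divide_eq_left)
next
  case False
  let ?l = "(y2 - y1) / (x2 - x1)"
  have "(x2 - x1) * (?l * (y1 + y2)) = (y2 - y1) * (y1 + y2)" using False by simp
  also have "\<dots> = y2^2 - y1^2" by (simp add: power2_eq_square algebra_simps)
  also have "\<dots> = (x2 - x1) * (x1^2 + x1*x2 + x2^2 + a * (x1 + x2) + b)"
    using assms(1,2) by (simp add: power2_eq_square power3_eq_cube algebra_simps)
  finally have "?l * (y1 + y2) = x1^2 + x1*x2 + x2^2 + a * (x1 + x2) + b"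
    using False by (metis mult_cancel_left right_minus_eq)
  thus ?thesis using False by (intro exI[of _ ?l]) (simp add: slope_def)
qed

lemma add_slope:
  assumes "on (Affine x1 y1)" "on (Affine x2 y2)" "\<not> (x1 = x2 \<and> y1 + y2 = 0)"
    "slope x1 y1 x2 y2 l"
  shows "Affine x1 y1 \<boxplus> Affine x2 y2 =
    Affine (l^2 - a - x1 - x2) (- (l * (l^2 - a - x1 - x2) + (y1 - l * x1)))"
proof (cases "x1 = x2")
  case True
  with assms eq_or_opposite have y: "y1 = y2" by blast
  have "l * (2 * y1) = 3 * x1^2 + 2 * a * x1 + b"
    using assms(4) y True by (simp add: slope_def power2_eq_square algebra_simps)
  hence "l = (3 * x1^2 + 2 * a * x1 + b) / (2 * y1)" using assms(3) y True
    by (simp add: field_simps)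
  thus ?thesis using assms(3) True y by (simp add: ec_add.simps(3) Let_def)
next
  case False
  hence "l = (y2 - y1) / (x2 - x1)" using assms(4) by (simp add: slope_def field_simps)
  thus ?thesis using False by (simp add: ec_add.simps(3) Let_def)
qed

lemma add_opposite [simp]: "y1 + y2 = 0 \<Longrightarrow> Affine x y1 \<boxplus> Affine x y2 = Origin"
  by (simp add: ec_add.simps(3))

lemma add_Origin [simp]: "P \<boxplus> Origin = P"
  by (cases P) auto

text \<open>The line of slope \<open>l\<close> through two points meets the curve in the points with abscissae
  \<open>x1\<close>, \<open>x2\<close> and \<open>l\<^sup>2 - a - x1 - x2\<close>: compare coefficients.\<close>

lemma line_coeffs:
  assumes "on (Affine x1 y1)" "slope x1 y1 x2 y2 l"
  defines "x3 \<equiv> l^2 - a - x1 - x2" and "n \<equiv> y1 - l * x1"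
  shows "a = l^2 - x1 - x2 - x3" "y1 = l * x1 + n" "y2 = l * x2 + n"
    "b = 2 * l * n + x1*x2 + x1*x3 + x2*x3" "c = n^2 - x1*x2*x3"
proof -
  show 1: "a = l^2 - x1 - x2 - x3" "y1 = l * x1 + n" by (simp_all add: x3_def n_def)
  show 2: "y2 = l * x2 + n" using assms(2) by (simp add: n_def slope_def algebra_simps eq_diff_eq)
  have "l * (l * x1 + n + (l * x2 + n)) = x1^2 + x1*x2 + x2^2 + (l^2 - x1 - x2 - x3) * (x1 + x2) + b"
    using assms(2) unfolding slope_def by (metis 1 2)
  thus 3: "b = 2 * l * n + x1*x2 + x1*x3 + x2*x3"
    by (simp add: power2_eq_square algebra_simps)
  have "(l * x1 + n)^2 = x1^3 + (l^2 - x1 - x2 - x3) * x1^2 + (2 * l * n + x1*x2 + x1*x3 + x2*x3) * x1 + c"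
    using assms(1) unfolding on.simps by (metis 1 3)
  thus "c = n^2 - x1*x2*x3"
    by (simp add: power2_eq_square power3_eq_cube algebra_simps)
qed

lemma line_third_on:
  assumes "on (Affine x1 y1)" "slope x1 y1 x2 y2 l"
  shows "on (Affine (l^2 - a - x1 - x2) (- (l * (l^2 - a - x1 - x2) + (y1 - l * x1))))"
proof -
  define x3 n where "x3 = l^2 - a - x1 - x2" and "n = y1 - l * x1"
  note lc = line_coeffs[OF assms, folded x3_def n_def]
  have "(l * x3 + n)^2 = x3^3 + (l^2 - x1 - x2 - x3) * x3^2
      + (2 * l * n + x1*x2 + x1*x3 + x2*x3) * x3 + (n^2 - x1*x2*x3)"
    by (simp add: power2_eq_square power3_eq_cube algebra_simps)
  hence "(l * x3 + n)^2 = x3^3 + a * x3^2 + b * x3 + c" by (metis lc(1,4,5))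
  hence "on (Affine x3 (- (l * x3 + n)))" by (simp del: minus_add_distrib)
  thus ?thesis by (simp only: x3_def n_def)
qed

lemma add_on:
  assumes "on P" "on Q" shows "on (P \<boxplus> Q)"
proof (cases P; cases Q)
  fix x1 y1 x2 y2 assume PQ: "P = Affine x1 y1" "Q = Affine x2 y2"
  show ?thesis
  proof (cases "x1 = x2 \<and> y1 + y2 = 0")
    case True thus ?thesis using PQ by simp
  next
    case False
    then obtain l where l: "slope x1 y1 x2 y2 l" using slope_exists assms PQ by blast
    thus ?thesis using add_slope[OF _ _ False l] line_third_on[OF _ l] assms PQ by metis
  qed
qed (use assms in auto)

lemma add_commute:
  assumes "on P" "on Q" shows "P \<boxplus> Q = Q \<boxplus> P"
proof (cases P; cases Q)
  fix x1 y1 x2 y2 assume PQ: "P = Affine x1 y1" "Q = Affine x2 y2"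
  show ?thesis
  proof (cases "x1 = x2 \<and> y1 + y2 = 0")
    case True thus ?thesis using PQ by (simp add: add.commute)
  next
    case False
    then obtain l where l: "slope x1 y1 x2 y2 l" using slope_exists assms PQ by blast
    hence l': "slope x2 y2 x1 y1 l" by (simp add: slope_commute)
    have e: "y1 - l * x1 = y2 - l * x2" using l by (simp add: slope_def algebra_simps)
    have x: "l^2 - a - x2 - x1 = l^2 - a - x1 - x2" by simp
    have F': "\<not> (x2 = x1 \<and> y2 + y1 = 0)" using False by (auto simp: add.commute)
    note on = assms[unfolded PQ]
    show ?thesis unfolding PQ add_slope[OF on False l] add_slope[OF on(2,1) F' l'] x e ..
  qed
qed (use assms in auto)

lemma neg_on [simp]: "on (ec_neg P) = on P" by (cases P) auto

lemma neg_neg [simp]: "ec_neg (ec_neg P) = P" by (cases P) auto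

lemma add_neg [simp]: "P \<boxplus> ec_neg P = Origin" by (cases P) auto

lemma add_eq_Origin: "P \<boxplus> Q = Origin \<longleftrightarrow> Q = ec_neg P"
  by (cases P; cases Q) (auto simp: ec_add.simps(3) Let_def add_eq_0_iff)

text \<open>The line through \<open>P + Q\<close> and \<open>- Q\<close> mirrors the one through
  \<open>P\<close> and \<open>Q\<close>: it has slope \<open>- l\<close> and meets the curve again
  in \<open>- P\<close>. This special case settles the degenerate cases of associativity.\<close>

lemma add_cancel:
  assumes "on P" "on Q" shows "(P \<boxplus> Q) \<boxplus> ec_neg Q = P"
proof (cases P; cases Q)
  fix x1 y1 x2 y2 assume PQ: "P = Affine x1 y1" "Q = Affine x2 y2"
  show ?thesis
  proof (cases "x1 = x2 \<and> y1 + y2 = 0")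
    case True thus ?thesis using PQ by (auto simp: minus_equation_iff add_eq_0_iff2)
  next
    case False
    then obtain l where l: "slope x1 y1 x2 y2 l" using slope_exists assms PQ by blast
    define x3 n where "x3 = l^2 - a - x1 - x2" and "n = y1 - l * x1"
    note lc = line_coeffs[OF assms(1)[unfolded PQ(1)] l, folded x3_def n_def]
    have D: "P \<boxplus> Q = Affine x3 (- (l * x3 + n))"
      unfolding PQ x3_def n_def by (rule add_slope[OF assms[unfolded PQ] False l])
    have onD: "on (Affine x3 (- (l * x3 + n)))" using D add_on assms by metis
    have s: "slope x3 (- (l * x3 + n)) x2 (- y2) (- l)"
      unfolding slope_def by (subst lc(1), subst lc(3), subst lc(3), subst lc(4))
        (simp add: power2_eq_square algebra_simps)
    have ne: "\<not> (x3 = x2 \<and> - (l * x3 + n) + - y2 = 0)"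
    proof
      assume *: "x3 = x2 \<and> - (l * x3 + n) + - y2 = 0"
      hence "(l * x2 + n) + (l * x2 + n) = 0" using lc(3) by (metis minus_add_distrib neg_equal_0_iff_equal)
      hence "2 * (l * x2 + n) = 0" by (simp only: mult_2)
      hence y: "l * x2 + n = 0" by (simp del: distrib_left_numeral)
      have "x2^3 + a * x2^2 + b * x2 + c = 0" using assms(2) PQ lc(3) y by simp
      \<comment> \<open>The cubic minus \<open>(l X + n)^2\<close> is
        \<open>(X - x1) (X - x2) (X - x3)\<close>; its derivative vanishes at the double root
        \<open>x2 = x3\<close>.\<close>
      moreover have "3 * x2^2 + 2 * a * x2 + b = 2 * l * (l * x2 + n)"
        by (subst lc(1), subst lc(4)) (use * in \<open>simp add: power2_eq_square algebra_simps\<close>)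
      ultimately show False using nonsingular y by fastforce
    qed
    have x: "(- l)^2 - a - x3 - x2 = x1" by (simp add: x3_def)
    have "(P \<boxplus> Q) \<boxplus> ec_neg Q = Affine x3 (- (l * x3 + n)) \<boxplus> Affine x2 (- y2)"
      unfolding D by (simp add: PQ(2))
    also have "\<dots> = Affine x1 (- ((- l) * x1 + (- (l * x3 + n) - (- l) * x3)))"
      using add_slope[OF onD _ ne s] assms(2) PQ(2) unfolding x by simp
    also have "\<dots> = P" using PQ lc(2) by (simp add: algebra_simps)
    finally show ?thesis .
  qed
qed (use assms in auto)

text \<open>The unique function \<open>x\<^sup>2 - s y + \<beta> x + \<gamma>\<close> vanishing at \<open>P\<close>, \<open>Q\<close>, \<open>R\<close> has its fourth zero at
  \<open>-(P + Q + R)\<close>.  Both ways of adding produce such a function, with \<open>s = l + k\<close> the sum of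
  the two slopes used; the next lemma expresses \<open>s\<close> through the second divided difference of \<open>y\<close>
  at \<open>P\<close>, \<open>Q\<close>, \<open>R\<close>, which is symmetric.\<close>

lemma slope_sum:
  assumes P: "on (Affine x1 y1)" and Q: "on (Affine x2 y2)" and R: "on (Affine x3 y3)"
    and l: "slope x1 y1 x2 y2 l" and m: "slope x2 y2 x3 y3 m"
  defines "d \<equiv> l^2 - a - x1 - x2" and "e \<equiv> - (l * (l^2 - a - x1 - x2) + (y1 - l * x1))"
  assumes k: "slope d e x3 y3 k"
    and ne: "\<not> (x2 = x3 \<and> y2 + y3 = 0)" "\<not> (d = x3 \<and> e + y3 = 0)" "\<not> (x3 = x2 \<and> x3 = d)"
  shows "(l + k) * (m - l) = x3 - x1"
proof -
  define n where "n = y1 - l * x1"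
  note lc = line_coeffs[OF P l, folded n_def d_def]
  have e: "e = - (l * d + n)" by (simp add: e_def d_def n_def)
  have m1: "y3 - (l * x3 + n) = (m - l) * (x3 - x2)"
    using m lc(3) by (simp add: slope_def algebra_simps)
  \<comment> \<open>The cubic minus the square of the line through \<open>P\<close> and
    \<open>Q\<close> has the roots \<open>x1\<close>, \<open>x2\<close>, \<open>d\<close>. It is
    evaluated at \<open>x3\<close> or, when \<open>x3\<close> is the root \<open>d\<close> itself,
    differentiated there.\<close>
  have star: "(l + k) * (y3 - (l * x3 + n)) = (x3 - x1) * (x3 - x2)"
  proof (cases "d = x3")
    case False
    have "(l + k) * (x3 - d) = y3 + (l * x3 + n)"
      using k e by (simp add: slope_def algebra_simps)
    hence "(x3 - d) * ((l + k) * (y3 - (l * x3 + n))) = y3^2 - (l * x3 + n)^2"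
      by (simp only: mult.left_commute[of "x3 - d" "l + k"] mult.assoc[symmetric] mult.commute[of "x3 - d"])
        (simp add: power2_eq_square algebra_simps)
    also have "\<dots> = x3^3 + (l^2 - x1 - x2 - d) * x3^2 + (2 * l * n + x1*x2 + x1*d + x2*d) * x3
        + (n^2 - x1*x2*d) - (l * x3 + n)^2"
      using R unfolding on.simps by (metis lc(1,4,5))
    also have "\<dots> = (x3 - d) * ((x3 - x1) * (x3 - x2))"
      by (simp add: power2_eq_square power3_eq_cube algebra_simps)
    finally show ?thesis using False by simp
  next
    case True
    have "on (Affine d e)" unfolding d_def e_def by (rule line_third_on[OF P l])
    hence y: "y3 = e" using eq_or_opposite[of d e y3] R True ne(2) by auto
    have "(l + k) * (y3 - (l * x3 + n)) = 2 * (l * e) + k * (e + e)"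
      unfolding y True[symmetric] by (simp add: e algebra_simps)
    also have "k * (e + e) = d^2 + d * d + d^2 + a * (d + d) + b"
      using k y True by (simp add: slope_def)
    also have "2 * (l * e) + (d^2 + d * d + d^2 + a * (d + d) + b) = (x3 - x1) * (x3 - x2)"
      unfolding e True[symmetric] by (subst lc(1), subst lc(4)) (simp add: power2_eq_square algebra_simps)
    finally show ?thesis .
  qed
  show ?thesis
  proof (cases "x3 = x2")
    case False
    have "((l + k) * (m - l)) * (x3 - x2) = (x3 - x1) * (x3 - x2)"
      using star by (simp only: m1 mult.assoc)
    thus ?thesis using False by simp
  next
    case True
    have y: "y2 = y3" using eq_or_opposite[of x2 y2 y3] Q R True ne(1) by auto
    have xd: "x3 \<noteq> d" using ne(3) True by auto
    have 1: "m * (y2 + y2) = x2^2 + x2 * x2 + x2^2 + a * (x2 + x2) + b"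
      using m y True by (simp add: slope_def)
    \<comment> \<open>Here \<open>R = Q\<close> and \<open>m\<close> is the tangent slope, so the
      derivative at the root \<open>x2\<close> replaces the division of \<open>star\<close> by
      \<open>x3 - x2\<close>.\<close>
    have "(m - l) * (y2 + y2) = x2^2 + x2 * x2 + x2^2 + a * (x2 + x2) + b - 2 * l * y2"
      using 1 by (simp add: algebra_simps)
    also have "\<dots> = (x2 - x1) * (x2 - d)"
      by (subst lc(1), subst lc(4), subst lc(3)) (simp add: power2_eq_square algebra_simps)
    finally have 2: "(m - l) * (y2 + y2) = (x2 - x1) * (x2 - d)" .
    have 3: "(l + k) * (x2 - d) = y2 + y2"
      using k e y True lc(3) by (simp add: slope_def algebra_simps)
    have "((l + k) * (m - l)) * (x2 - d) = (x2 - x1) * (x2 - d)"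
      using 2 3 by (metis mult.assoc mult.commute)
    thus ?thesis using xd True by simp
  qed
qed

lemma neg_add:
  assumes "on P" "on Q" shows "ec_neg (P \<boxplus> Q) = ec_neg P \<boxplus> ec_neg Q"
proof (cases P; cases Q)
  fix x1 y1 x2 y2 assume PQ: "P = Affine x1 y1" "Q = Affine x2 y2"
  show ?thesis
  proof (cases "x1 = x2 \<and> y1 + y2 = 0")
    case True thus ?thesis using PQ by (auto simp: add_eq_0_iff)
  next
    case False
    then obtain l where l: "slope x1 y1 x2 y2 l" using slope_exists assms PQ by blast
    have l': "slope x1 (- y1) x2 (- y2) (- l)" using l by (auto simp: slope_def algebra_simps)
    have ne: "\<not> (x1 = x2 \<and> - y1 + - y2 = 0)" using False by (auto simp: add_eq_0_iff)
    show ?thesis using add_slope[OF _ _ False l] add_slope[OF _ _ ne l'] assms PQ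
      by (simp add: algebra_simps)
  qed
qed (use assms in auto)

text \<open>In the generic case \<open>slope_sum\<close> for \<open>P, Q, R\<close> and for
  \<open>R, Q, P\<close> gives the same \<open>s = l + k = m + k'\<close>, and the two final points
  agree once expressed through \<open>s\<close>. If \<open>l = m\<close>, the formula forces
  \<open>R = P\<close> and commutativity finishes.\<close>

lemma add_assoc:
  assumes "on P" "on Q" "on R" shows "(P \<boxplus> Q) \<boxplus> R = P \<boxplus> (Q \<boxplus> R)"
proof -
  consider "P = Origin \<or> Q = Origin \<or> R = Origin" | "Q = ec_neg P" | "R = ec_neg Q"
    | "R = ec_neg (P \<boxplus> Q)" | "P = ec_neg (Q \<boxplus> R)"
    | x1 y1 x2 y2 x3 y3 where "P = Affine x1 y1" "Q = Affine x2 y2" "R = Affine x3 y3"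
      "P \<boxplus> Q \<noteq> Origin" "Q \<boxplus> R \<noteq> Origin" "(P \<boxplus> Q) \<boxplus> R \<noteq> Origin" "(Q \<boxplus> R) \<boxplus> P \<noteq> Origin"
    by (metis add_eq_Origin neg_neg ec_point.exhaust)
  thus ?thesis
  proof cases
    case 1 thus ?thesis by auto
  next
    case 2
    have "P \<boxplus> (ec_neg P \<boxplus> R) = (R \<boxplus> ec_neg P) \<boxplus> ec_neg (ec_neg P)"
      using add_commute[of "ec_neg P" R] add_commute[of P "R \<boxplus> ec_neg P"] assms add_on by auto
    hence "P \<boxplus> (ec_neg P \<boxplus> R) = R" using add_cancel[of R "ec_neg P"] assms by simp
    thus ?thesis using 2 by simp
  next
    case 3 thus ?thesis using add_cancel[of P Q] assms by simp
  next
    case 4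
    have "Q \<boxplus> R = (ec_neg P \<boxplus> ec_neg Q) \<boxplus> ec_neg (ec_neg Q)"
      using 4 assms neg_add add_commute[of Q R] add_on by auto
    hence "Q \<boxplus> R = ec_neg P" using add_cancel[of "ec_neg P" "ec_neg Q"] assms by simp
    thus ?thesis using 4 by simp
  next
    case 5
    have "P \<boxplus> Q = (ec_neg R \<boxplus> ec_neg Q) \<boxplus> ec_neg (ec_neg Q)"
      using 5 assms neg_add[of Q R] add_commute[of "ec_neg Q" "ec_neg R"] by auto
    hence PQ: "P \<boxplus> Q = ec_neg R" using add_cancel[of "ec_neg R" "ec_neg Q"] assms by simp
    have "ec_neg R \<boxplus> R = Origin" "P \<boxplus> (Q \<boxplus> R) = Origin"
      using add_neg[of "ec_neg R"] add_neg[of "ec_neg (Q \<boxplus> R)"] 5 by auto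
    thus ?thesis using PQ by simp
  next
    case 6
    note on = assms[unfolded 6(1,2,3)]
    have ne: "\<not> (x1 = x2 \<and> y1 + y2 = 0)" "\<not> (x2 = x3 \<and> y2 + y3 = 0)"
      using 6 by auto
    obtain l where l: "slope x1 y1 x2 y2 l" using slope_exists on ne by blast
    obtain m where m: "slope x2 y2 x3 y3 m" using slope_exists on ne by blast
    define d e where "d = l^2 - a - x1 - x2" and "e = - (l * (l^2 - a - x1 - x2) + (y1 - l * x1))"
    define d' e' where "d' = m^2 - a - x3 - x2" and "e' = - (m * (m^2 - a - x3 - x2) + (y3 - m * x3))"
    have D: "P \<boxplus> Q = Affine d e" unfolding d_def e_def 6 by (rule add_slope) (use on ne l in auto)
    have ne': "\<not> (x3 = x2 \<and> y3 + y2 = 0)" using ne by (auto simp: add.commute)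
    have m': "slope x3 y3 x2 y2 m" and l': "slope x2 y2 x1 y1 l" using m l slope_commute by auto
    have D': "R \<boxplus> Q = Affine d' e'" unfolding d'_def e'_def 6 by (rule add_slope) (use on ne' m' in auto)
    have ne2: "\<not> (d = x3 \<and> e + y3 = 0)" using 6(6) unfolding D 6(3) by auto
    have ne2': "\<not> (d' = x1 \<and> e' + y1 = 0)" using 6(7) D' add_commute[OF assms(2,3)] unfolding 6(1) by auto
    have onD: "on (Affine d e)" "on (Affine d' e')" using add_on assms D D' by metis+
    obtain k where k: "slope d e x3 y3 k" using slope_exists on onD ne2 by blast
    obtain k' where k': "slope d' e' x1 y1 k'" using slope_exists on onD ne2' by blast
    have tr: "\<not> (x3 = x2 \<and> x3 = d)"
    proof
      assume *: "x3 = x2 \<and> x3 = d"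
      hence "y3 = e" "y3 = y2" using eq_or_opposite[of x3 y3] on onD ne ne2 by (auto simp: add.commute)
      hence "P \<boxplus> Q = Q" using * D 6(2) by metis
      hence "P = Origin" using add_cancel[of P Q] assms by simp
      thus False using 6 by simp
    qed
    have tr': "\<not> (x1 = x2 \<and> x1 = d')"
    proof
      assume *: "x1 = x2 \<and> x1 = d'"
      hence "y1 = e'" "y1 = y2" using eq_or_opposite[of x1 y1] on onD ne ne2' by (auto simp: add.commute)
      hence "R \<boxplus> Q = Q" using * D' 6(2) by metis
      hence "R = Origin" using add_cancel[of R Q] assms by simp
      thus False using 6 by simp
    qed
    have s1: "(l + k) * (m - l) = x3 - x1"
      using slope_sum[OF on l m k[unfolded d_def e_def] ne(2)] ne2 tr unfolding d_def e_def by blast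
    have s2: "(m + k') * (l - m) = x1 - x3"
      using slope_sum[OF on(3,2,1) m' l' k'[unfolded d'_def e'_def]] ne ne2' tr' unfolding d'_def e'_def
      by (metis add.commute)
    have QR: "Q \<boxplus> R = Affine d' e'" using D' add_commute assms by simp
    show ?thesis
    proof (cases "l = m")
      case True
      hence "x3 = x1" using s1 by simp
      moreover have "y3 = y1" using True l m calculation by (simp add: slope_def algebra_simps)
      ultimately have "R = P" using 6 by simp
      thus ?thesis using add_commute assms add_on by metis
    next
      case False
      define s where "s = l + k"
      have "(m + k') * (m - l) = s * (m - l)" using s1 s2 unfolding s_def
        by (metis minus_diff_eq mult_minus_right)
      hence "m + k' = s" using False by simp
      hence kk: "k = s - l" "k' = s - m" by (auto simp: s_def algebra_simps)
      have s: "x3 = x1 + s * (m - l)" using s1 by (simp add: s_def)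
      have x: "k^2 - a - d - x3 = k'^2 - a - d' - x1"
        unfolding kk d_def d'_def s by (simp add: power2_eq_square algebra_simps)
      have y1: "y1 = y2 - l * (x2 - x1)" and y3: "y3 = y2 + m * (x3 - x2)"
        using l m by (auto simp: slope_def algebra_simps)
      have "k * (k^2 - a - d - x3) + (e - k * d) = k' * (k'^2 - a - d' - x1) + (e' - k' * d')"
        unfolding kk d_def d'_def e_def e'_def y1 y3 s by (simp add: power2_eq_square algebra_simps)
      thus ?thesis unfolding QR D
        using add_slope[OF onD(1) on(3) ne2 k] add_slope[OF onD(2) on(1) ne2' k'] x
          add_commute[OF onD(2) on(1)] 6 by simp
    qed
  qed
qed

end

locale cubic_over_subfield = nonsingular_cubic a b c
  for a b c :: "'a::field_char_0" +
  fixes K :: "'a set"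
  assumes coeffs_mem: "a \<in> K" "b \<in> K" "c \<in> K"
    and one_mem: "1 \<in> K"
    and uminus_mem: "x \<in> K \<Longrightarrow> - x \<in> K"
    and plus_mem: "x \<in> K \<Longrightarrow> y \<in> K \<Longrightarrow> x + y \<in> K"
    and times_mem: "x \<in> K \<Longrightarrow> y \<in> K \<Longrightarrow> x * y \<in> K"
    and inverse_mem': "x \<in> K \<Longrightarrow> x \<noteq> 0 \<Longrightarrow> inverse x \<in> K"
begin

lemma zero_mem: "0 \<in> K"
  using plus_mem[OF one_mem uminus_mem[OF one_mem]] by simp

lemma inverse_mem: "x \<in> K \<Longrightarrow> inverse x \<in> K"
  using inverse_mem' zero_mem by (cases "x = 0") auto

lemma minus_mem: "x \<in> K \<Longrightarrow> y \<in> K \<Longrightarrow> x - y \<in> K"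
  using plus_mem[of x "- y"] uminus_mem by simp

lemma divide_mem: "x \<in> K \<Longrightarrow> y \<in> K \<Longrightarrow> x / y \<in> K"
  using times_mem[of x "inverse y"] inverse_mem by (simp add: divide_inverse)

lemma power_mem: "x \<in> K \<Longrightarrow> x ^ n \<in> K"
  by (induction n) (auto simp: one_mem times_mem)

lemma of_nat_mem: "of_nat n \<in> K"
  by (induction n) (auto simp: zero_mem one_mem plus_mem)

lemma numeral_mem: "numeral n \<in> K"
  using of_nat_mem[of "numeral n"] by simp

lemmas mem_intros = coeffs_mem zero_mem one_mem uminus_mem plus_mem times_mem inverse_mem minus_mem
  divide_mem power_mem numeral_mem

abbreviation points ("\<E>") where "\<E> \<equiv> rational_points (cubic_model a b c) K"

lemma carrier_Affine: "Affine x y \<in> carrier \<E> \<longleftrightarrow> x \<in> K \<and> y \<in> K \<and> on (Affine x y)"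
  by (auto simp: rational_points_def on_curve_def)

lemma carrier_Origin: "Origin \<in> carrier \<E>"
  by (simp add: rational_points_def)

lemma carrier_on: "P \<in> carrier \<E> \<Longrightarrow> on P"
  by (cases P) (auto simp: carrier_Affine)

lemma mult_points: "P \<otimes>\<^bsub>\<E>\<^esub> Q = P \<boxplus> Q" and one_points: "\<one>\<^bsub>\<E>\<^esub> = Origin"
  by (simp_all add: rational_points_def)

lemma add_mem:
  assumes "P \<in> carrier \<E>" "Q \<in> carrier \<E>" shows "P \<boxplus> Q \<in> carrier \<E>"
proof (cases P; cases Q)
  fix x1 y1 x2 y2 assume PQ: "P = Affine x1 y1" "Q = Affine x2 y2"
  note m = assms[unfolded PQ carrier_Affine]
  show ?thesis
  proof (cases "x1 = x2 \<and> y1 + y2 = 0")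
    case True thus ?thesis using PQ by (auto simp: carrier_Origin)
  next
    case False
    define l where "l = (if x1 = x2 then (3 * x1 ^ 2 + 2 * a * x1 + b) / (2 * y1) else (y2 - y1) / (x2 - x1))"
    have "l \<in> K" using m by (auto simp: l_def intro!: mem_intros)
    moreover have "P \<boxplus> Q = Affine (l^2 - a - x1 - x2) (- (l * (l^2 - a - x1 - x2) + (y1 - l * x1)))"
      using False PQ by (auto simp: ec_add.simps(3) Let_def l_def)
    ultimately have "\<exists>x\<in>K. \<exists>y\<in>K. P \<boxplus> Q = Affine x y"
      using m by (blast intro: mem_intros)
    thus ?thesis using add_on[of P Q] assms carrier_on carrier_Affine by auto
  qed
qed (use assms in auto)

lemma neg_mem: "P \<in> carrier \<E> \<Longrightarrow> ec_neg P \<in> carrier \<E>"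
  by (cases P) (auto simp: carrier_Affine carrier_Origin uminus_mem)

sublocale points: comm_group "\<E>"
proof (rule comm_groupI, goal_cases)
  case (3 x y z)
  thus ?case by (simp add: mult_points add_assoc carrier_on)
next
  case (4 x y)
  thus ?case by (simp add: mult_points add_commute carrier_on)
next
  case (6 x)
  have "ec_neg x \<boxplus> x = Origin"
    using add_commute[of "ec_neg x" x] carrier_on[OF 6] by simp
  thus ?case using neg_mem[OF 6] by (auto simp: mult_points one_points)
qed (auto simp: mult_points one_points add_mem carrier_Origin)

end

text \<open>Neither \<open>ec_add\<close> nor \<open>Origin\<close> depends on the subfield; this
  moves torsion points between the rationals and \<open>Q_infinity_3\<close>.\<close>

lemma ec_pow_cong: "P [^]\<^bsub>rational_points E K\<^esub> (n::nat) = P [^]\<^bsub>rational_points E L\<^esub> n"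
  by (simp add: nat_pow_def rational_points_def)

section \<open>The integers of the 3-power cyclotomic fields\<close>

definition zeta :: "nat \<Rightarrow> complex" where "zeta n = cis (2 * pi / 3 ^ n)"

text \<open>This is the ring \<open>Z[zeta n]\<close>, presented as sums of signed roots of unity so
  that inductions treat only roots and sums; closure under products is
  \<open>cyc_times\<close>.\<close>

inductive_set cyc :: "nat \<Rightarrow> complex set" for n where
  root: "z ^ (3 ^ n) = 1 \<Longrightarrow> z \<in> cyc n"
| neg_root: "z ^ (3 ^ n) = 1 \<Longrightarrow> - z \<in> cyc n"
| plus: "x \<in> cyc n \<Longrightarrow> y \<in> cyc n \<Longrightarrow> x + y \<in> cyc n"

lemma zeta_power: "zeta n ^ (3 ^ n) = 1"
  by (simp add: zeta_def Complex.DeMoivre cis_2pi)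

lemma zeta_Suc: "zeta (Suc n) ^ 3 = zeta n"
  by (simp add: zeta_def Complex.DeMoivre)

lemma root_eq_zeta_power:
  assumes "z ^ (3 ^ n) = 1"
  shows "\<exists>k < 3 ^ n. z = zeta n ^ k"
proof -
  have "bij_betw (\<lambda>k. cis (2 * pi * real k / real (3^n))) {..<3^n} {z. z ^ (3^n) = 1}"
    by (rule Complex.bij_betw_roots_unity) simp
  hence "z \<in> (\<lambda>k. cis (2 * pi * real k / real (3^n))) ` {..<3^n}"
    using assms by (simp only: bij_betw_def mem_Collect_eq)
  then obtain k where "k < 3^n" "z = cis (2 * pi * real k / real (3^n))" by blast
  thus ?thesis by (intro exI[of _ k]) (simp add: zeta_def Complex.DeMoivre field_simps)
qed

lemma cyc_uminus: "x \<in> cyc n \<Longrightarrow> - x \<in> cyc n"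
proof (induction rule: cyc.induct)
  case (plus x y) thus ?case using cyc.plus[of "- x" n "- y"] by simp
qed (auto intro: cyc.intros)

lemma cyc_1: "1 \<in> cyc n" by (rule cyc.root) simp

lemma cyc_0: "0 \<in> cyc n"
  using cyc.plus[OF cyc_1 cyc_uminus[OF cyc_1]] by simp

lemma cyc_minus: "x \<in> cyc n \<Longrightarrow> y \<in> cyc n \<Longrightarrow> x - y \<in> cyc n"
  using cyc.plus[of x n "- y"] cyc_uminus by simp

lemma cyc_times: "x \<in> cyc n \<Longrightarrow> y \<in> cyc n \<Longrightarrow> x * y \<in> cyc n"
proof (induction rule: cyc.induct)
  case (root z)
  from root(2) show ?case
  proof (induction rule: cyc.induct)
    case (root w) thus ?case using \<open>z ^ 3 ^ n = 1\<close> by (intro cyc.root) (simp add: power_mult_distrib)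
  next
    case (neg_root w) thus ?case using \<open>z ^ 3 ^ n = 1\<close> cyc.neg_root[of "z * w" n] by (simp add: power_mult_distrib)
  qed (auto simp: distrib_left intro: cyc.plus)
next
  case (neg_root z)
  from neg_root(2) show ?case
  proof (induction rule: cyc.induct)
    case (root w) thus ?case using \<open>z ^ 3 ^ n = 1\<close> cyc.neg_root[of "z * w" n] by (simp add: power_mult_distrib)
  next
    case (neg_root w) thus ?case using \<open>z ^ 3 ^ n = 1\<close> cyc.root[of "z * w" n] by (simp add: power_mult_distrib)
  next
    case (plus x y) thus ?case using cyc.plus[of "- z * x" n "- z * y"] by (simp add: algebra_simps)
  qed
qed (auto simp: distrib_right intro: cyc.plus)

lemma cyc_power: "x \<in> cyc n \<Longrightarrow> x ^ k \<in> cyc n"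
  by (induction k) (auto simp: cyc_1 cyc_times)

lemma cyc_of_nat: "of_nat k \<in> cyc n"
  by (induction k) (auto simp: cyc_0 cyc_1 intro: cyc.plus)

lemma cyc_of_int: "of_int k \<in> cyc n"
  by (cases k) (auto simp del: of_nat_Suc intro: cyc_uminus cyc_of_nat)

lemma cyc_numeral: "numeral k \<in> cyc n"
  using cyc_of_nat[of "numeral k"] by simp

lemma cyc_sum: "(\<And>i. i \<in> A \<Longrightarrow> f i \<in> cyc n) \<Longrightarrow> sum f A \<in> cyc n"
  by (induction A rule: infinite_finite_induct) (auto simp: cyc_0 intro: cyc.plus)

lemmas cyc_intros = cyc_0 cyc_1 cyc_uminus cyc.plus cyc_minus cyc_times cyc_power cyc_of_nat
  cyc_of_int cyc_numeral cyc_sum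

lemma cyc_mono: assumes "m \<le> n" shows "cyc m \<subseteq> cyc n"
proof
  fix x assume "x \<in> cyc m" thus "x \<in> cyc n"
  proof (induction rule: cyc.induct)
    case (root z)
    have "z ^ (3 ^ n) = (z ^ (3 ^ m)) ^ (3 ^ (n - m))"
      using assms by (simp add: power_mult[symmetric] power_add[symmetric])
    thus ?case using root by (intro cyc.root) simp
  next
    case (neg_root z)
    have "z ^ (3 ^ n) = (z ^ (3 ^ m)) ^ (3 ^ (n - m))"
      using assms by (simp add: power_mult[symmetric] power_add[symmetric])
    thus ?case using neg_root by (intro cyc.neg_root) simp
  qed (rule cyc.plus)
qed

lemma zeta_mem: "zeta n \<in> cyc n" using zeta_power by (rule cyc.root)

lemma cyc_coeffs: "x \<in> cyc n \<Longrightarrow> \<exists>a :: nat \<Rightarrow> int. x = (\<Sum>i<3^n. of_int (a i) * zeta n ^ i)"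
proof (induction rule: cyc.induct)
  case (root z)
  then obtain k where k: "k < 3^n" "z = zeta n ^ k" using root_eq_zeta_power by blast
  thus ?case by (intro exI[of _ "\<lambda>i. if i = k then 1 else 0"])
      (simp add: if_distrib[of of_int] if_distrib[of "\<lambda>x. x * _"] cong: if_cong)
next
  case (neg_root z)
  then obtain k where k: "k < 3^n" "z = zeta n ^ k" using root_eq_zeta_power by blast
  thus ?case by (intro exI[of _ "\<lambda>i. if i = k then -1 else 0"])
      (simp add: if_distrib[of of_int] if_distrib[of "\<lambda>x. x * _"] cong: if_cong)
next
  case (plus x y)
  then obtain a b :: "nat \<Rightarrow> int" where "x = (\<Sum>i<3^n. of_int (a i) * zeta n ^ i)" "y = (\<Sum>i<3^n. of_int (b i) * zeta n ^ i)"
    by blast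
  thus ?case by (intro exI[of _ "\<lambda>i. a i + b i"]) (simp add: sum.distrib distrib_right)
qed

text \<open>An element of \<open>cyc n\<close> acts on the module spanned by the powers of \<open>zeta n\<close> through an
  integer matrix, whose characteristic polynomial it annihilates.\<close>

lemma cyc_monic_poly:
  assumes "x \<in> cyc n"
  shows "\<exists>p :: int poly. lead_coeff p = 1 \<and> poly (map_poly of_int p) x = 0"
proof -
  define N :: nat where "N = 3 ^ n"
  have N: "N > 0" by (simp add: N_def)
  have "\<exists>a :: nat \<Rightarrow> int. x * zeta n ^ j = (\<Sum>i<N. of_int (a i) * zeta n ^ i)" for j
    unfolding N_def by (rule cyc_coeffs) (intro cyc_intros assms zeta_mem)
  then obtain a :: "nat \<Rightarrow> nat \<Rightarrow> int" where
    a: "x * zeta n ^ j = (\<Sum>i<N. of_int (a j i) * zeta n ^ i)" for j by metis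
  define M where "M = mat N N (\<lambda>(j, i). a j i)"
  define v where "v = vec N (\<lambda>i. zeta n ^ i)"
  have M: "M \<in> carrier_mat N N" by (simp add: M_def)
  have v: "v \<in> carrier_vec N" by (simp add: v_def)
  have "v $ 0 \<noteq> 0\<^sub>v N $ 0" using N by (simp add: v_def)
  hence v0: "v \<noteq> 0\<^sub>v N" by auto
  have "map_mat of_int M *\<^sub>v v = x \<cdot>\<^sub>v v"
  proof (rule eq_vecI)
    fix j assume "j < dim_vec (x \<cdot>\<^sub>v v)"
    hence j: "j < N" by (simp add: v_def)
    show "(map_mat of_int M *\<^sub>v v) $ j = (x \<cdot>\<^sub>v v) $ j"
      using j a[of j] by (simp add: M_def v_def scalar_prod_def atLeast0LessThan)
  qed (simp add: M_def v_def)
  hence "eigenvalue (map_mat of_int M) x"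
    unfolding eigenvalue_def eigenvector_def using v v0 M by auto
  hence "poly (char_poly (map_mat of_int M)) x = 0"
    using eigenvalue_root_char_poly[of "map_mat of_int M :: complex mat" N] M by simp
  moreover have "char_poly (map_mat of_int M :: complex mat) = map_poly of_int (char_poly M)"
    using of_int_hom.char_poly_hom[OF M] by simp
  moreover have "lead_coeff (char_poly M) = 1" using degree_monic_char_poly[OF M] by simp
  ultimately show ?thesis by metis
qed

lemma cyc_Rats: assumes "x \<in> cyc n" "x \<in> \<rat>" shows "x \<in> \<int>"
proof -
  obtain p :: "int poly" where p: "lead_coeff p = 1" "poly (map_poly of_int p) x = 0"
    using cyc_monic_poly[OF assms(1)] by blast
  hence "algebraic_int x"
    unfolding algebraic_int_altdef_ipoly by (intro exI[of _ p]) auto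
  thus ?thesis using assms(2) by (rule rational_algebraic_int_is_int)
qed

text \<open>Stripping factors \<open>X\<close> from the monic polynomial of \<open>x\<close> leaves
  a non-zero constant term, which \<open>x\<close> divides. This takes the place of the
  norm.\<close>

lemma cyc_dvd_int:
  assumes "x \<in> cyc n" "x \<noteq> 0"
  shows "\<exists>k :: int. \<exists>y \<in> cyc n. k \<noteq> 0 \<and> x * y = of_int k"
proof -
  obtain p :: "int poly" where p: "lead_coeff p = 1" "poly (map_poly of_int p) x = 0"
    using cyc_monic_poly[OF assms(1)] by blast
  from p show ?thesis
  proof (induction p)
    case 0 thus ?case by simp
  next
    case (pCons c p)
    have s: "of_int c + x * poly (map_poly of_int p) x = 0" using pCons by (simp add: map_poly_pCons)
    have mem: "poly (map_poly of_int q) x \<in> cyc n" for q :: "int poly"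
      by (induction q) (auto simp: map_poly_pCons intro: cyc_intros assms(1))
    show ?case
    proof (cases "c = 0")
      case True
      hence "poly (map_poly of_int p) x = 0" "p \<noteq> 0" using s assms pCons by auto
      thus ?thesis using pCons by auto
    next
      case False
      have "x * (- poly (map_poly of_int p) x) = of_int c"
        using eq_neg_iff_add_eq_0[THEN iffD2, OF s] by simp
      thus ?thesis using False mem[of p] cyc_uminus by blast
    qed
  qed
qed

section \<open>Congruences modulo a rational prime and the Frobenius map\<close>

definition cyc_cong :: "nat \<Rightarrow> nat \<Rightarrow> complex \<Rightarrow> complex \<Rightarrow> bool" where
  "cyc_cong n p x y \<longleftrightarrow> (\<exists>w\<in>cyc n. x - y = of_nat p * w)"

lemma cyc_cong_refl: "cyc_cong n p x x"
  unfolding cyc_cong_def by (intro bexI[of _ 0]) (auto intro: cyc_0)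

lemma cyc_cong_trans: "cyc_cong n p x y \<Longrightarrow> cyc_cong n p y z \<Longrightarrow> cyc_cong n p x z"
  unfolding cyc_cong_def
proof safe
  fix w w' assume w: "w \<in> cyc n" "w' \<in> cyc n" "x - y = of_nat p * w" "y - z = of_nat p * w'"
  thus "\<exists>w\<in>cyc n. x - z = of_nat p * w"
    by (intro bexI[of _ "w + w'"]) (auto simp: algebra_simps intro: cyc.plus)
qed

lemma cyc_cong_add: "cyc_cong n p x y \<Longrightarrow> cyc_cong n p z t \<Longrightarrow> cyc_cong n p (x + z) (y + t)"
  unfolding cyc_cong_def
proof safe
  fix w w' assume w: "w \<in> cyc n" "w' \<in> cyc n" "x - y = of_nat p * w" "z - t = of_nat p * w'"
  thus "\<exists>w\<in>cyc n. x + z - (y + t) = of_nat p * w"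
    by (intro bexI[of _ "w + w'"]) (auto simp: algebra_simps intro: cyc.plus)
qed

lemma cyc_cong_mult:
  assumes "cyc_cong n p x y" "cyc_cong n p z t" "x \<in> cyc n" "t \<in> cyc n"
  shows "cyc_cong n p (x * z) (y * t)"
proof -
  obtain w w' where w: "w \<in> cyc n" "w' \<in> cyc n" "x - y = of_nat p * w" "z - t = of_nat p * w'"
    using assms by (auto simp: cyc_cong_def)
  have "x * z - y * t = x * (z - t) + (x - y) * t" by (simp add: algebra_simps)
  also have "\<dots> = of_nat p * (x * w' + w * t)" using w by (simp add: algebra_simps)
  finally show ?thesis unfolding cyc_cong_def using w assms by (blast intro: cyc_intros)
qed

lemma cyc_cong_power:
  assumes "cyc_cong n p x y" "x \<in> cyc n" "y \<in> cyc n"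
  shows "cyc_cong n p (x ^ k) (y ^ k)"
  by (induction k) (auto intro!: cyc_cong_refl cyc_cong_mult cyc_intros assms)

lemma cyc_frobenius_prime:
  assumes p: "Factorial_Ring.prime p" and x: "x \<in> cyc n" and y: "y \<in> cyc n"
  shows "cyc_cong n p ((x + y) ^ p) (x ^ p + y ^ p)"
proof -
  define w where "w = (\<Sum>k\<in>{0<..<p}. of_nat ((p choose k) div p) * x ^ k * y ^ (p - k))"
  have p0: "p > 0" using p prime_gt_0_nat by blast
  have split: "{..p} = insert 0 (insert p {0<..<p})" using p0 by auto
  have "(x + y) ^ p = (\<Sum>k\<le>p. of_nat (p choose k) * x ^ k * y ^ (p - k))"
    by (rule binomial_ring)
  also have "\<dots> = y ^ p + x ^ p + (\<Sum>k\<in>{0<..<p}. of_nat (p choose k) * x ^ k * y ^ (p - k))"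
    unfolding split using p0 by simp
  also have "(\<Sum>k\<in>{0<..<p}. of_nat (p choose k) * x ^ k * y ^ (p - k)) = of_nat p * w"
    unfolding w_def sum_distrib_left
  proof (rule sum.cong)
    fix k assume k: "k \<in> {0<..<p}"
    hence "p dvd (p choose k)" using p by (intro dvd_choose_prime) auto
    hence "of_nat (p choose k) = (of_nat p * of_nat ((p choose k) div p) :: complex)"
      by (metis dvd_mult_div_cancel of_nat_mult)
    thus "of_nat (p choose k) * x ^ k * y ^ (p - k)
        = of_nat p * (of_nat ((p choose k) div p) * x ^ k * y ^ (p - k))"
      by (simp add: mult.assoc)
  qed simp
  finally have "(x + y) ^ p - (x ^ p + y ^ p) = of_nat p * w" by simp
  moreover have "w \<in> cyc n" unfolding w_def by (intro cyc_intros x y)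
  ultimately show ?thesis unfolding cyc_cong_def by blast
qed

lemma cyc_frobenius:
  assumes p: "Factorial_Ring.prime p" and x: "x \<in> cyc n" and y: "y \<in> cyc n"
  shows "cyc_cong n p ((x + y) ^ (p ^ f)) (x ^ (p ^ f) + y ^ (p ^ f))"
proof (induction f)
  case 0 thus ?case by (simp add: cyc_cong_refl)
next
  case (Suc f)
  have "cyc_cong n p (((x + y) ^ (p ^ f)) ^ p) ((x ^ (p ^ f) + y ^ (p ^ f)) ^ p)"
    by (rule cyc_cong_power[OF Suc]) (intro cyc_intros x y)+
  also have "cyc_cong n p ((x ^ (p ^ f) + y ^ (p ^ f)) ^ p) ((x ^ (p ^ f)) ^ p + (y ^ (p ^ f)) ^ p)"
    by (rule cyc_frobenius_prime[OF p]) (intro cyc_intros x y)+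
  finally (cyc_cong_trans) show ?case by (simp add: power_mult[symmetric] mult.commute)
qed

subsection \<open>Primes other than three are unramified\<close>

text \<open>The exponent is 1 modulo \<open>3 ^ n\<close>, so the power map fixes every root of
  unity, and modulo \<open>p\<close> it is additive.\<close>

lemma cyc_frobenius_fixed:
  assumes p: "Factorial_Ring.prime p" and f: "[p ^ f = 1] (mod 3 ^ n)" and x: "x \<in> cyc n"
  shows "cyc_cong n p (x ^ (p ^ f)) x"
proof -
  have z: "z ^ (p ^ f) = z" if "z ^ (3 ^ n) = 1" for z :: complex
  proof -
    have 1: "p ^ f \<ge> 1" using prime_gt_0_nat[OF p] by simp
    hence "3 ^ n dvd p ^ f - 1" using f cong_altdef_nat by blast
    then obtain m where "p ^ f = 1 + 3 ^ n * m" using 1 by (metis dvdE le_add_diff_inverse)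
    thus ?thesis using that by (simp add: power_add power_mult)
  qed
  show ?thesis using x
  proof (induction rule: cyc.induct)
    case (root w)
    thus ?case using z by (simp add: cyc_cong_refl)
  next
    case (neg_root w)
    show ?case
    proof (cases "even (p ^ f)")
      case True
      \<comment> \<open>The even power loses the sign, but \<open>w\<close> and \<open>- w\<close>
        agree modulo 2.\<close>
      hence "p = 2" using p by (metis even_power primes_dvd_imp_eq two_is_prime_nat)
      thus ?thesis unfolding cyc_cong_def using z True neg_root
        by (intro bexI[of _ w]) (auto simp: power_minus_even intro: cyc.root)
    next
      case False
      thus ?thesis using z neg_root by (simp add: power_minus_odd cyc_cong_refl)
    qed
  next
    case (plus x y)
    thus ?case using cyc_cong_trans[OF cyc_frobenius[OF p] cyc_cong_add] by blast
  qed
qed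

text \<open>The ring modulo \<open>p\<close> is reduced because a power of Frobenius is the identity
  on it: \<open>x ^ (p ^ f)\<close> is congruent to \<open>x\<close>, and divisible by
  \<open>p\<close> once \<open>k <= p ^ f\<close>. The totient in \<open>f\<close> fixes the roots
  of unity, the factor \<open>k\<close> secures the bound.\<close>

lemma cyc_unramified:
  assumes p: "Factorial_Ring.prime p" "p \<noteq> 3" and x: "x \<in> cyc n" and w: "w \<in> cyc n" and k: "k > 0"
    and eq: "x ^ k = of_nat p * w"
  shows "\<exists>w\<in>cyc n. x = of_nat p * w"
proof -
  define f where "f = totient (3 ^ n) * k"
  have "coprime p 3" using p primes_coprime[of p 3] by simp
  hence "[p ^ totient (3 ^ n) = 1] (mod 3 ^ n)" by (intro euler_theorem) simp
  hence f: "[p ^ f = 1] (mod 3 ^ n)" unfolding f_def power_mult by (metis cong_pow power_one)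
  have "totient (3 ^ n) \<ge> 1" by (simp add: Suc_le_eq)
  hence "k \<le> f" by (simp add: f_def)
  also have "f < p ^ f" using prime_gt_1_nat[OF p(1)] by (intro power_gt_expt) simp
  finally have "k \<le> p ^ f" by simp
  hence "x ^ (p ^ f) = of_nat p * (w * x ^ (p ^ f - k))"
    using eq by (metis le_add_diff_inverse mult.assoc power_add)
  moreover obtain t where "t \<in> cyc n" "x ^ (p ^ f) - x = of_nat p * t"
    using cyc_frobenius_fixed[OF p(1) f x] by (auto simp: cyc_cong_def)
  ultimately have "x = of_nat p * (w * x ^ (p ^ f - k) - t)" by (simp add: algebra_simps)
  thus ?thesis using w x \<open>t \<in> cyc n\<close> by (blast intro: cyc_intros)
qed

section \<open>Fractions, localization at a rational prime and integral closure\<close>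

lemma K3_fraction: "x \<in> cyclotomic_3_infinity \<Longrightarrow> \<exists>n. \<exists>r\<in>cyc n. \<exists>k::int. k \<noteq> 0 \<and> x = r / of_int k"
proof (induction rule: K3_induct)
  case one thus ?case by (intro exI[of _ 0] bexI[of _ 1] exI[of _ 1]) (auto intro: cyc_1)
next
  case (root z n) thus ?case by (intro exI[of _ n] bexI[of _ z] exI[of _ 1]) (auto intro: cyc.root)
next
  case (uminus x) thus ?case by (metis cyc_uminus minus_divide_left)
next
  case (inverse x)
  then obtain n r and k :: int where r: "r \<in> cyc n" "k \<noteq> 0" "x = r / of_int k" by blast
  hence "r \<noteq> 0" using inverse by auto
  then obtain l :: int and y where l: "y \<in> cyc n" "l \<noteq> 0" "r * y = of_int l" using cyc_dvd_int r by blast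
  hence "inverse x = (of_int k * y) / of_int l" using r \<open>r \<noteq> 0\<close> by (auto simp: field_simps)
  thus ?case using l r by (metis cyc_times cyc_of_int)
next
  case (add x y)
  then obtain n r and k :: int and m s and l :: int where
    *: "r \<in> cyc n" "k \<noteq> 0" "x = r / of_int k" "s \<in> cyc m" "l \<noteq> 0" "y = s / of_int l" by metis
  have "r \<in> cyc (max n m)" "s \<in> cyc (max n m)" using * cyc_mono by (meson max.cobounded1 max.cobounded2 subsetD)+
  hence "r * of_int l + s * of_int k \<in> cyc (max n m)" by (intro cyc_intros)
  moreover have "x + y = (r * of_int l + s * of_int k) / of_int (k * l)" using * by (simp add: field_simps)
  ultimately show ?case using * by (metis mult_eq_0_iff)
next
  case (mult x y)
  then obtain n r and k :: int and m s and l :: int where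
    *: "r \<in> cyc n" "k \<noteq> 0" "x = r / of_int k" "s \<in> cyc m" "l \<noteq> 0" "y = s / of_int l" by metis
  have "r \<in> cyc (max n m)" "s \<in> cyc (max n m)" using * cyc_mono by (meson max.cobounded1 max.cobounded2 subsetD)+
  hence "r * s \<in> cyc (max n m)" by (intro cyc_intros)
  moreover have "x * y = (r * s) / of_int (k * l)" using * by simp
  ultimately show ?case using * by (metis mult_eq_0_iff)
qed

definition localized :: "nat \<Rightarrow> complex set" where
  "localized p = {x. \<exists>n. \<exists>r\<in>cyc n. \<exists>k::int. \<not> int p dvd k \<and> x = r / of_int k}"

context
  fixes p :: nat
  assumes p: "Factorial_Ring.prime p"
begin

lemma localized_cyc: "x \<in> cyc n \<Longrightarrow> x \<in> localized p"
  unfolding localized_def using p by (intro CollectI exI[of _ n] bexI[of _ x] exI[of _ 1]) auto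

lemma localized_add:
  assumes "x \<in> localized p" "y \<in> localized p" shows "x + y \<in> localized p"
proof -
  obtain n r and k :: int and m s and l :: int where
    *: "r \<in> cyc n" "\<not> int p dvd k" "x = r / of_int k" "s \<in> cyc m" "\<not> int p dvd l" "y = s / of_int l"
    using assms by (auto simp: localized_def)
  have "r \<in> cyc (max n m)" "s \<in> cyc (max n m)" using * cyc_mono by (meson max.cobounded1 max.cobounded2 subsetD)+
  hence "r * of_int l + s * of_int k \<in> cyc (max n m)" by (intro cyc_intros)
  moreover have "k \<noteq> 0" "l \<noteq> 0" using * by auto
  hence "x + y = (r * of_int l + s * of_int k) / of_int (k * l)" using * by (simp add: field_simps)
  moreover have "\<not> int p dvd k * l" using * p by (simp add: prime_dvd_mult_iff)
  ultimately show ?thesis unfolding localized_def by blast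
qed

lemma localized_mult:
  assumes "x \<in> localized p" "y \<in> localized p" shows "x * y \<in> localized p"
proof -
  obtain n r and k :: int and m s and l :: int where
    *: "r \<in> cyc n" "\<not> int p dvd k" "x = r / of_int k" "s \<in> cyc m" "\<not> int p dvd l" "y = s / of_int l"
    using assms by (auto simp: localized_def)
  have "r \<in> cyc (max n m)" "s \<in> cyc (max n m)" using * cyc_mono by (meson max.cobounded1 max.cobounded2 subsetD)+
  hence "r * s \<in> cyc (max n m)" by (intro cyc_intros)
  moreover have "x * y = (r * s) / of_int (k * l)" using * by simp
  moreover have "\<not> int p dvd k * l" using * p by (simp add: prime_dvd_mult_iff)
  ultimately show ?thesis unfolding localized_def by blast
qed

lemma localized_of_int: "of_int k \<in> localized p"
  by (rule localized_cyc[of _ 0]) (rule cyc_of_int)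

lemma localized_uminus: "x \<in> localized p \<Longrightarrow> - x \<in> localized p"
  using localized_mult[OF localized_of_int[of "-1"]] by simp

lemma localized_inverse_int: "\<not> int p dvd k \<Longrightarrow> 1 / of_int k \<in> localized p"
  unfolding localized_def by (intro CollectI exI[of _ 0] bexI[of _ 1] exI[of _ k]) (auto intro: cyc_1)

lemma localized_power: "x \<in> localized p \<Longrightarrow> x ^ k \<in> localized p"
  by (induction k) (use localized_of_int[of 1] localized_mult in auto)

lemma localized_sum: "(\<And>i. i \<in> A \<Longrightarrow> f i \<in> localized p) \<Longrightarrow> sum f A \<in> localized p"
  by (induction A rule: infinite_finite_induct) (use localized_of_int[of 0] localized_add in auto)

lemma localized_of_nat: "of_nat k \<in> localized p"
  using localized_of_int[of "int k"] by simp

lemma localized_numeral: "numeral k \<in> localized p"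
  using localized_of_int[of "numeral k"] by simp

lemma localized_minus: "x \<in> localized p \<Longrightarrow> y \<in> localized p \<Longrightarrow> x - y \<in> localized p"
  using localized_add[of x "- y"] localized_uminus by simp

lemmas localized_intros = localized_add localized_mult localized_of_int localized_uminus
  localized_power localized_of_nat localized_numeral localized_minus

text \<open>By \<open>cyc_Rats\<close> the multiples of \<open>p\<close> in the local ring meet the
  integers only in multiples of \<open>p\<close>. The contradictions at 2, 7 and \<open>ell\<close>
  all end here.\<close>

lemma localized_int_dvd:
  assumes "of_int k = of_nat p * w" "w \<in> localized p" shows "int p dvd k"
proof -
  obtain n r and l :: int where *: "r \<in> cyc n" "\<not> int p dvd l" "w = r / of_int l"
    using assms by (auto simp: localized_def)
  have l: "l \<noteq> 0" and p0: "p \<noteq> 0" using * p by (auto intro: ccontr)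
  hence r: "r = of_int (k * l) / of_nat p" using assms * by (simp add: field_simps)
  hence "r \<in> \<rat>" by (metis Rats_divide Rats_of_int Rats_of_nat)
  hence "r \<in> \<int>" using cyc_Rats * by blast
  then obtain m where "r = of_int m" by (auto elim: Ints_cases)
  hence "of_int (k * l) = (of_int (int p * m) :: complex)" using r p0 by (simp add: field_simps)
  hence "k * l = int p * m" using of_int_eq_iff by blast
  hence "int p dvd k * l" by simp
  thus ?thesis using * p by (simp add: prime_dvd_mult_iff)
qed

lemma localized_unramified:
  assumes p3: "p \<noteq> 3" and x: "x \<in> localized p" and w: "w \<in> localized p" and k: "k > 0"
    and eq: "x ^ k = of_nat p * w"
  shows "\<exists>w\<in>localized p. x = of_nat p * w"
proof -
  obtain n r and c :: int and m s and d :: int where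
    *: "r \<in> cyc n" "\<not> int p dvd c" "x = r / of_int c" "s \<in> cyc m" "\<not> int p dvd d" "w = s / of_int d"
    using x w by (auto simp: localized_def)
  have cd: "c \<noteq> 0" "d \<noteq> 0" using * by auto
  have rs: "r \<in> cyc (max n m)" "s \<in> cyc (max n m)"
    using * cyc_mono by (meson max.cobounded1 max.cobounded2 subsetD)+
  obtain l where l: "k = Suc l" using k gr0_implies_Suc by blast
  have "r ^ k * of_int d = of_nat p * s * of_int c ^ k"
    using eq * cd by (simp add: field_simps)
  hence "(r * of_int d) ^ k = of_nat p * (s * of_int c ^ k * of_int d ^ l)"
    unfolding l by (simp add: power_mult_distrib mult_ac)
  moreover have "r * of_int d \<in> cyc (max n m)" "s * of_int c ^ k * of_int d ^ l \<in> cyc (max n m)"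
    by (intro cyc_times cyc_power cyc_of_int rs)+
  ultimately obtain t where t: "t \<in> cyc (max n m)" "r * of_int d = of_nat p * t"
    using cyc_unramified[OF p p3 _ _ k] by blast
  have "x * (of_int c * of_int d) = of_nat p * t"
    using t(2) *(3) cd by (simp add: mult.assoc[symmetric])
  hence "x = of_nat p * (t / of_int (c * d))" using cd by (simp add: eq_divide_eq)
  moreover have "\<not> int p dvd c * d" using * p by (simp add: prime_dvd_mult_iff)
  ultimately show ?thesis using t unfolding localized_def by blast
qed

text \<open>Take \<open>j\<close> minimal with \<open>p ^ j * x\<close> in the local ring. If
  \<open>j > 0\<close>, the equation makes a power of \<open>p ^ j * x\<close> divisible by
  \<open>p\<close>, and unramifiedness removes one factor \<open>p\<close>, against minimality. This
  makes coordinates of torsion points integral away from 3.\<close>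

lemma localized_integrally_closed:
  assumes p3: "p \<noteq> 3" and x: "x \<in> cyclotomic_3_infinity" and d: "d > 0"
    and a: "\<And>i. i < d \<Longrightarrow> a i \<in> localized p" and eq: "x ^ d = (\<Sum>i<d. a i * x ^ i)"
  shows "x \<in> localized p"
proof -
  have "\<exists>j. of_nat p ^ j * x \<in> localized p"
  proof -
    obtain n r and k :: int where r: "r \<in> cyc n" "k \<noteq> 0" "x = r / of_int k" using K3_fraction x by blast
    have "\<not> is_unit (int p)" using p by (auto simp: not_prime_1)
    then obtain j l where l: "k = int p ^ j * l" "\<not> int p dvd l"
      using multiplicity_decompose'[of k "int p"] r by metis
    have "of_nat p ^ j * x = r / of_int l" using r l by (auto simp: field_simps)
    thus ?thesis using r l unfolding localized_def by blast
  qed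
  define j where "j = (LEAST j. of_nat p ^ j * x \<in> localized p)"
  have j: "of_nat p ^ j * x \<in> localized p"
    unfolding j_def by (rule LeastI_ex) fact
  show ?thesis
  proof (cases j)
    case 0 thus ?thesis using j by simp
  next
    case (Suc i)
    define y where "y = of_nat p ^ j * x"
    \<comment> \<open>One factor \<open>p\<close> is taken out of \<open>p ^ (j * (d - m))\<close>;
      the subtraction of 1 is exact because \<open>j > 0\<close> and \<open>m < d\<close>.\<close>
    define w where "w = (\<Sum>m<d. a m * (of_nat p ^ (j * (d - m) - 1) * y ^ m))"
    have "y ^ d = of_nat p ^ (j * d) * (\<Sum>m<d. a m * x ^ m)"
      by (simp add: y_def power_mult_distrib power_mult eq)
    also have "\<dots> = of_nat p * w" unfolding w_def sum_distrib_left
    proof (rule sum.cong)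
      fix m assume m: "m \<in> {..<d}"
      hence "j * (d - m) \<noteq> 0" using Suc by simp
      hence "j * d = Suc (j * (d - m) - 1) + j * m" using m
        by (simp add: add_mult_distrib2[symmetric])
      hence "of_nat p ^ (j * d) = (of_nat p * of_nat p ^ (j * (d - m) - 1) * of_nat p ^ (j * m) :: complex)"
        by (simp only: power_add power_Suc)
      thus "of_nat p ^ (j * d) * (a m * x ^ m) = of_nat p * (a m * (of_nat p ^ (j * (d - m) - 1) * y ^ m))"
        by (simp add: y_def power_mult_distrib power_mult mult_ac)
    qed simp
    finally have "y ^ d = of_nat p * w" .
    moreover have "w \<in> localized p" unfolding w_def
    proof (rule localized_sum)
      fix m assume "m \<in> {..<d}"
      hence "a m \<in> localized p" using a by simp
      moreover have "y \<in> localized p" using j by (simp add: y_def)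
      ultimately show "a m * (of_nat p ^ (j * (d - m) - 1) * y ^ m) \<in> localized p"
        by (rule localized_mult[OF _ localized_mult[OF localized_power[OF localized_of_nat] localized_power]])
    qed
    ultimately obtain t where "t \<in> localized p" "y = of_nat p * t"
      using localized_unramified[OF p3 _ _ d, of y w] j y_def by blast
    moreover have "of_nat p \<noteq> (0 :: complex)" using p by auto
    ultimately have "of_nat p ^ i * x \<in> localized p" by (auto simp: y_def Suc mult.assoc)
    hence "j \<le> i" unfolding j_def by (rule Least_le)
    thus ?thesis using Suc by simp
  qed
qed

end

section \<open>All levels together and the prime above three\<close>

definition cycs :: "complex set" where "cycs = (\<Union>n. cyc n)"

lemma cycs_cyc: "x \<in> cyc n \<Longrightarrow> x \<in> cycs" by (auto simp: cycs_def)

lemma cycs_common: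
  assumes "x \<in> cycs" "y \<in> cycs" obtains n where "n \<ge> 1" "x \<in> cyc n" "y \<in> cyc n"
proof -
  obtain n m where "x \<in> cyc n" "y \<in> cyc m" using assms by (auto simp: cycs_def)
  hence "x \<in> cyc (max 1 (max n m))" "y \<in> cyc (max 1 (max n m))"
    using cyc_mono[of n "max 1 (max n m)"] cyc_mono[of m "max 1 (max n m)"]
    by (simp_all add: subset_iff le_max_iff_disj)
  thus ?thesis using that[of "max 1 (max n m)"] by simp
qed

lemma cycs_add: "x \<in> cycs \<Longrightarrow> y \<in> cycs \<Longrightarrow> x + y \<in> cycs"
  by (erule (1) cycs_common) (auto intro: cycs_cyc cyc.plus)

lemma cycs_mult: "x \<in> cycs \<Longrightarrow> y \<in> cycs \<Longrightarrow> x * y \<in> cycs"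
  by (erule (1) cycs_common) (auto intro: cycs_cyc cyc_times)

lemma cycs_uminus: "x \<in> cycs \<Longrightarrow> - x \<in> cycs"
  by (auto simp: cycs_def intro: cyc_uminus)

lemma cycs_minus: "x \<in> cycs \<Longrightarrow> y \<in> cycs \<Longrightarrow> x - y \<in> cycs"
  using cycs_add[of x "- y"] cycs_uminus by simp

lemma cycs_of_int: "of_int k \<in> cycs"
  using cyc_of_int by (rule cycs_cyc)

lemma cycs_1: "1 \<in> cycs" using cyc_1 by (rule cycs_cyc)

lemma cycs_power: "x \<in> cycs \<Longrightarrow> x ^ k \<in> cycs"
  by (induction k) (auto simp: cycs_1 cycs_mult)

lemma cycs_Rats: "x \<in> cycs \<Longrightarrow> x \<in> \<rat> \<Longrightarrow> x \<in> \<int>"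
  using cyc_Rats by (auto simp: cycs_def)

text \<open>The only prime of \<open>cycs\<close> above \<open>3\<close> is the radical of \<open>3\<close>.\<close>

definition max3 :: "complex set" where
  "max3 = {x \<in> cycs. \<exists>k. \<exists>w\<in>cycs. x ^ k = 3 * w}"

lemma max3_cycs: "x \<in> max3 \<Longrightarrow> x \<in> cycs" by (simp add: max3_def)

lemma max3_mult: "x \<in> max3 \<Longrightarrow> y \<in> cycs \<Longrightarrow> x * y \<in> max3"
proof -
  assume x: "x \<in> max3" and y: "y \<in> cycs"
  then obtain k w where "w \<in> cycs" "x ^ k = 3 * w" by (auto simp: max3_def)
  hence "(x * y) ^ k = 3 * (w * y ^ k)" "w * y ^ k \<in> cycs"
    using y by (auto simp: power_mult_distrib intro: cycs_mult cycs_power)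
  thus ?thesis using x y unfolding max3_def by (blast intro: cycs_mult)
qed

lemma max3_mult': "y \<in> cycs \<Longrightarrow> x \<in> max3 \<Longrightarrow> y * x \<in> max3"
  using max3_mult by (simp add: mult.commute)

text \<open>A common exponent \<open>3 ^ j\<close> exceeding both \<open>k\<close> and
  \<open>l\<close> makes both powers divisible by 3, and Frobenius modulo 3 splits the power of the
  sum.\<close>

lemma max3_add:
  assumes "x \<in> max3" "y \<in> max3" shows "x + y \<in> max3"
proof -
  obtain k w l t where *: "w \<in> cycs" "x ^ k = 3 * w" "t \<in> cycs" "y ^ l = 3 * t"
    using assms by (auto simp: max3_def)
  define j where "j = k + l"
  have j: "j < 3 ^ j" by (rule power_gt_expt) simp
  have "x ^ (3 ^ j) = 3 * (w * x ^ (3 ^ j - k))"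
    using * j by (simp add: j_def mult.assoc[symmetric] power_add[symmetric] flip: *(2))
  moreover have "y ^ (3 ^ j) = 3 * (t * y ^ (3 ^ j - l))"
    using * j by (simp add: j_def mult.assoc[symmetric] power_add[symmetric] flip: *(4))
  moreover obtain n where n: "x \<in> cyc n" "y \<in> cyc n"
    using cycs_common assms max3_cycs by metis
  then obtain s where "s \<in> cyc n" "(x + y) ^ (3 ^ j) - (x ^ (3 ^ j) + y ^ (3 ^ j)) = 3 * s"
    using cyc_frobenius[of 3 x n y j] by (auto simp: cyc_cong_def)
  ultimately have "(x + y) ^ (3 ^ j) = 3 * (s + w * x ^ (3 ^ j - k) + t * y ^ (3 ^ j - l))"
    by (simp add: algebra_simps)
  moreover have "s + w * x ^ (3 ^ j - k) + t * y ^ (3 ^ j - l) \<in> cycs"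
    using * \<open>s \<in> cyc n\<close> assms max3_cycs by (intro cycs_add cycs_mult cycs_power) (auto intro: cycs_cyc)
  ultimately show ?thesis using assms unfolding max3_def by (blast intro: cycs_add)
qed

lemma max3_uminus: "x \<in> max3 \<Longrightarrow> - x \<in> max3"
  using max3_mult[of x "-1"] cycs_of_int[of "-1"] by simp

lemma max3_minus: "x \<in> max3 \<Longrightarrow> y \<in> max3 \<Longrightarrow> x - y \<in> max3"
  using max3_add[of x "- y"] max3_uminus by simp

lemma max3_of_int: "of_int k \<in> max3 \<longleftrightarrow> 3 dvd k"
proof
  assume "of_int k \<in> max3"
  then obtain l w where w: "w \<in> cycs" "of_int k ^ l = 3 * w" by (auto simp: max3_def)
  have "w = of_int (k ^ l) / 3" using w(2) by simp
  hence "w \<in> \<rat>" by (metis Rats_divide Rats_number_of Rats_of_int)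
  then obtain m where "w = of_int m" using cycs_Rats w by (auto elim: Ints_cases)
  hence "of_int (k ^ l) = (of_int (3 * m) :: complex)" using w(2) by simp
  hence "k ^ l = 3 * m" by (simp only: of_int_eq_iff)
  hence "3 dvd k ^ l" by simp
  thus "3 dvd k" by (rule prime_dvd_power_int[rotated]) simp
next
  assume "3 dvd k"
  then obtain m where "k = 3 * m" by auto
  thus "of_int k \<in> max3" unfolding max3_def using cycs_of_int[of k] cycs_of_int[of m]
    by (intro CollectI conjI exI[of _ 1] bexI[of _ "of_int m"]) auto
qed

text \<open>Frobenius turns \<open>(1 - z) ^ (3 ^ n)\<close> into \<open>1 - z ^ (3 ^ n) = 0\<close>
  modulo 3.\<close>

lemma zeta_power_minus_one: "z ^ (3 ^ n) = 1 \<Longrightarrow> 1 - z \<in> max3"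
proof -
  assume z: "z ^ (3 ^ n) = 1"
  hence mem: "z \<in> cyc n" by (rule cyc.root)
  obtain s where "s \<in> cyc n" "(1 + - z) ^ (3 ^ n) - (1 ^ (3 ^ n) + (- z) ^ (3 ^ n)) = 3 * s"
    using cyc_frobenius[of 3 1 n "- z" n] mem by (auto simp: cyc_cong_def intro: cyc_1 cyc_uminus)
  hence "(1 - z) ^ (3 ^ n) = 3 * s" using z by (simp add: power_minus_odd)
  thus ?thesis unfolding max3_def using \<open>s \<in> cyc n\<close> mem
    by (blast intro: cycs_cyc cyc_minus cyc_1)
qed

text \<open>All roots of unity are congruent to 1, so a sum of signed roots reduces to an integer:
  the residue field stays that of three elements at every level.\<close>

lemma max3_residue: assumes "x \<in> cycs" shows "\<exists>c\<in>{0,1,-1}. x - of_int c \<in> max3"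
proof -
  obtain n where "x \<in> cyc n" using assms by (auto simp: cycs_def)
  hence "\<exists>c::int. x - of_int c \<in> max3"
  proof (induction rule: cyc.induct)
    case (root z)
    show ?case using max3_uminus[OF zeta_power_minus_one[OF root]] by (intro exI[of _ 1]) simp
  next
    case (neg_root z)
    show ?case using zeta_power_minus_one[OF neg_root] by (intro exI[of _ "-1"]) simp
  next
    case (plus x y)
    then obtain c d where "x - of_int c \<in> max3" "y - of_int d \<in> max3" by blast
    from max3_add[OF this] show ?case by (intro exI[of _ "c + d"]) (simp add: algebra_simps)
  qed
  then obtain c where c: "x - of_int c \<in> max3" by blast
  have "\<exists>d\<in>{0,1,-1}. 3 dvd c - d" by simp presburger
  then obtain d where d: "d \<in> {0,1,-1}" "3 dvd c - d" by blast
  have "x - of_int d = (x - of_int c) + of_int (c - d)" by simp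
  hence "x - of_int d \<in> max3" using c d max3_of_int max3_add by metis
  thus ?thesis using d by blast
qed

lemma max3_prime:
  assumes "x \<in> cycs" "y \<in> cycs" "x \<notin> max3" "y \<notin> max3" shows "x * y \<notin> max3"
proof
  assume xy: "x * y \<in> max3"
  obtain c d where c: "c \<in> {0,1,-1}" "x - of_int c \<in> max3" and d: "d \<in> {0,1,-1}" "y - of_int d \<in> max3"
    using max3_residue assms by meson
  have cd: "c \<noteq> 0" "d \<noteq> 0" using c d assms by auto
  have "of_int (c * d) = x * y - (x * (y - of_int d) + (x - of_int c) * of_int d)"
    by (simp add: algebra_simps)
  also have "\<dots> \<in> max3"
    by (intro max3_minus max3_add xy max3_mult' max3_mult assms c d cycs_of_int)
  finally have "3 dvd c * d" by (simp only: max3_of_int)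
  thus False using c d cd by auto
qed

definition units3 :: "complex set" where
  "units3 = {a / b | a b. a \<in> cycs - max3 \<and> b \<in> cycs - max3}"

lemma zero_max3: "0 \<in> max3" using max3_of_int[of 0] by simp

lemma units3_cycs: "x \<in> cycs \<Longrightarrow> x \<notin> max3 \<Longrightarrow> x \<in> units3"
  unfolding units3_def using cycs_1 max3_of_int[of 1] by (intro CollectI exI[of _ x] exI[of _ 1]) auto

lemma units3_mult: "x \<in> units3 \<Longrightarrow> y \<in> units3 \<Longrightarrow> x * y \<in> units3"
proof -
  assume "x \<in> units3" "y \<in> units3"
  then obtain a b c d where *: "a \<in> cycs - max3" "b \<in> cycs - max3" "c \<in> cycs - max3" "d \<in> cycs - max3"
    "x = a / b" "y = c / d" by (auto simp: units3_def)
  hence "x * y = (a * c) / (b * d)" "a * c \<in> cycs - max3" "b * d \<in> cycs - max3"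
    using max3_prime cycs_mult by auto
  thus ?thesis unfolding units3_def by blast
qed

lemma units3_inverse: "x \<in> units3 \<Longrightarrow> inverse x \<in> units3"
  unfolding units3_def by (clarsimp simp: inverse_eq_divide) blast

lemma units3_1: "1 \<in> units3"
  using units3_cycs[OF cycs_1] max3_of_int[of 1] by simp

lemma units3_power: "x \<in> units3 \<Longrightarrow> x ^ k \<in> units3"
  by (induction k) (auto simp: units3_1 units3_mult)

lemma units3_powi: "x \<in> units3 \<Longrightarrow> x powi k \<in> units3"
  by (auto simp: power_int_def units3_power units3_inverse)

lemma units3_nonzero: "x \<in> units3 \<Longrightarrow> x \<noteq> 0"
  using zero_max3 by (auto simp: units3_def)

subsection \<open>Total ramification at three\<close>

definition unif :: "nat \<Rightarrow> complex" where "unif n = 1 - zeta n"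

lemma unif_max3: "unif n \<in> max3" unfolding unif_def by (rule zeta_power_minus_one[OF zeta_power])

lemma zeta_1: "zeta 1 ^ 2 + zeta 1 + 1 = 0"
proof -
  have "zeta 1 \<noteq> 1"
  proof
    assume "zeta 1 = 1"
    hence "Im (zeta 1) = 0" by simp
    hence "sin (2 * pi / 3) = 0" by (simp add: zeta_def)
    moreover have "sin (2 * pi / 3) > 0" by (rule sin_gt_zero) auto
    ultimately show False by simp
  qed
  moreover have "(zeta 1 - 1) * (zeta 1 ^ 2 + zeta 1 + 1) = zeta 1 ^ 3 - 1"
    by (simp add: power2_eq_square power3_eq_cube algebra_simps)
  ultimately show ?thesis using zeta_power[of 1] by (metis mult_eq_0_iff power_one_right right_minus_eq)
qed

lemma one_minus_root: "z ^ (3 ^ n) = 1 \<Longrightarrow> \<exists>s\<in>cyc n. 1 - z = unif n * s"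
proof -
  assume "z ^ (3 ^ n) = 1"
  then obtain k where "z = zeta n ^ k" using root_eq_zeta_power by blast
  hence "1 - z = unif n * (\<Sum>i<k. zeta n ^ i)"
    by (simp add: unif_def one_diff_power_eq)
  thus ?thesis by (intro bexI[of _ "\<Sum>i<k. zeta n ^ i"] cyc_sum cyc_power zeta_mem)
qed

lemma three_unif: assumes "n \<ge> 1" shows "\<exists>s\<in>cyc n. 3 = unif n * s"
proof -
  have "zeta 1 ^ (3 ^ n) = 1" using zeta_power[of 1] assms
    by (metis One_nat_def Suc_le_D power_Suc power_mult power_one power_one_right)
  then obtain s where s: "s \<in> cyc n" "1 - zeta 1 = unif n * s" using one_minus_root by blast
  have "zeta 1 ^ 2 = - (zeta 1 + 1)"
    by (rule eq_neg_iff_add_eq_0[THEN iffD2]) (use zeta_1 in \<open>simp add: add.assoc\<close>)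
  \<comment> \<open>This is the norm of \<open>1 - zeta 1\<close>; the second factor is the
    conjugate \<open>1 - zeta 1 ^ 2\<close>.\<close>
  hence "3 = (1 - zeta 1) * (2 + zeta 1)" by (simp add: power2_eq_square algebra_simps)
  moreover have "zeta 1 \<in> cyc n" using zeta_mem cyc_mono[OF assms] by blast
  ultimately show ?thesis using s
    by (intro bexI[of _ "s * (2 + zeta 1)"]) (auto simp: mult.assoc intro: cyc_intros)
qed

text \<open>Modulo \<open>unif n\<close> every element is an integer, and an integer in
  \<open>max3\<close> is a multiple of 3, hence of \<open>unif n\<close>.\<close>

lemma max3_unif:
  assumes "n \<ge> 1" "r \<in> cyc n" "r \<in> max3" shows "\<exists>s\<in>cyc n. r = unif n * s"
proof -
  from assms(2) have "\<exists>c::int. \<exists>s\<in>cyc n. r = of_int c + unif n * s"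
  proof (induction rule: cyc.induct)
    case (root z)
    then obtain s where "s \<in> cyc n" "1 - z = unif n * s" using one_minus_root by blast
    thus ?case by (intro exI[of _ 1] bexI[of _ "- s"]) (auto simp: algebra_simps intro: cyc_uminus)
  next
    case (neg_root z)
    then obtain s where "s \<in> cyc n" "1 - z = unif n * s" using one_minus_root by blast
    thus ?case by (intro exI[of _ "-1"] bexI[of _ "s"]) (auto simp: algebra_simps)
  next
    case (plus x y)
    then obtain c d s t where "x = of_int c + unif n * s" "y = of_int d + unif n * t" "s \<in> cyc n" "t \<in> cyc n"
      by blast
    thus ?case by (intro exI[of _ "c + d"] bexI[of _ "s + t"]) (auto simp: algebra_simps intro: cyc.plus)
  qed
  then obtain c s where c: "s \<in> cyc n" "r = of_int c + unif n * s" by blast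
  have "of_int c = r - unif n * s" using c by simp
  also have "\<dots> \<in> max3" by (intro max3_minus assms max3_mult unif_max3 cycs_cyc[OF c(1)])
  finally obtain d where d: "c = 3 * d" by (auto simp: max3_of_int)
  obtain t where t: "t \<in> cyc n" "3 = unif n * t" using three_unif assms by blast
  have "r = unif n * (t * of_int d + s)" using c d t(2) by (simp add: distrib_left mult.assoc[symmetric])
  thus ?thesis using t c by (blast intro: cyc_intros)
qed

text \<open>Otherwise \<open>r\<close> is divisible by every power of \<open>unif n\<close>, in
  particular by \<open>3 ^ (j + 1)\<close>, while a multiple of \<open>r\<close> is an integer
  divisible by exactly \<open>3 ^ j\<close>.\<close>

lemma unif_factor:
  assumes n: "n \<ge> 1" and r: "r \<in> cyc n" "r \<noteq> 0"
  shows "\<exists>k. \<exists>s\<in>cyc n. s \<notin> max3 \<and> r = unif n ^ k * s"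
proof (rule ccontr)
  assume no: "\<not> ?thesis"
  have all: "\<exists>s\<in>cyc n. r = unif n ^ k * s" for k
  proof (induction k)
    case (Suc k)
    then obtain s where s: "s \<in> cyc n" "r = unif n ^ k * s" by blast
    with no have "s \<in> max3" by blast
    then obtain t where "t \<in> cyc n" "s = unif n * t" using max3_unif n s by blast
    thus ?case using s by (intro bexI[of _ t]) auto
  qed (use r in auto)
  obtain c :: int and y where c: "y \<in> cyc n" "c \<noteq> 0" "r * y = of_int c" using cyc_dvd_int r by blast
  have "\<not> is_unit (3 :: int)" by simp
  then obtain d where "c = 3 ^ multiplicity 3 c * d" "\<not> 3 dvd d"
    using multiplicity_decompose'[of c "3::int"] c by metis
  then obtain j where d: "c = 3 ^ j * d" "\<not> 3 dvd d" by blast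
  obtain m w where w: "w \<in> cycs" "unif n ^ m = 3 * w" using unif_max3[of n] by (auto simp: max3_def)
  obtain s where s: "s \<in> cyc n" "r = unif n ^ (m * (j + 1)) * s" using all by blast
  have "3 ^ j * of_int d = r * y" using c d by simp
  also have "\<dots> = 3 ^ j * (3 * (w ^ (j + 1) * s * y))"
    unfolding s power_mult w(2) by (simp add: power_mult_distrib)
  finally have "of_int d = 3 * (w ^ (j + 1) * s * y)" by simp
  moreover have "3 * (w ^ (j + 1) * s * y) \<in> max3"
    using max3_of_int[of 3] w c s by (intro max3_mult cycs_mult cycs_power) (auto intro: cycs_cyc)
  ultimately show False using d max3_of_int by metis
qed

text \<open>From \<open>(1 - z) ^ 3 = (1 - z ^ 3) - 3 * z * (1 - z)\<close> and
  \<open>unif n\<close> dividing 3, the cube of \<open>unif (Suc n)\<close> is \<open>unif n\<close>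
  times an element congruent to 1. The ramification index thus triples at each level.\<close>

lemma unif_ramified: assumes "n \<ge> 1" shows "\<exists>u\<in>units3. unif n ^ (2 * 3 ^ (n - 1)) = 3 * u"
  using assms
proof (induction n rule: dec_induct)
  case base
  have "zeta 1 ^ 2 = - (zeta 1 + 1)"
    by (rule eq_neg_iff_add_eq_0[THEN iffD2]) (use zeta_1 in \<open>simp add: add.assoc\<close>)
  moreover have "unif 1 ^ 2 = 1 - 2 * zeta 1 + zeta 1 ^ 2"
    by (simp add: unif_def power2_eq_square algebra_simps)
  ultimately have "unif 1 ^ 2 = 3 * (- zeta 1)" by simp
  moreover have "- zeta 1 \<in> units3"
  proof (rule units3_cycs)
    show "- zeta 1 \<in> cycs" using zeta_mem by (intro cycs_uminus cycs_cyc)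
    show "- zeta 1 \<notin> max3"
    proof
      assume "- zeta 1 \<in> max3"
      hence "unif 1 - (- zeta 1) \<in> max3" using unif_max3 by (rule max3_minus[rotated])
      thus False using max3_of_int[of 1] by (simp add: unif_def)
    qed
  qed
  ultimately show ?case by auto
next
  case (step n)
  define z where "z = zeta (Suc n)"
  have u: "unif n = 1 - z ^ 3" "unif (Suc n) = 1 - z" by (simp_all add: unif_def z_def zeta_Suc)
  obtain s where s: "s \<in> cyc n" "3 = unif n * s" using three_unif step by blast
  define v where "v = 1 - s * z * unif (Suc n)"
  have "unif (Suc n) ^ 3 = unif n - 3 * z * unif (Suc n)"
    unfolding u by (simp add: power3_eq_cube algebra_simps)
  also have "\<dots> = unif n * v" unfolding v_def s(2) by (simp add: algebra_simps)
  finally have eq: "unif (Suc n) ^ 3 = unif n * v" .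
  have m: "s * z * unif (Suc n) \<in> max3" unfolding z_def
    by (intro max3_mult' unif_max3 cycs_mult cycs_cyc[OF s(1)] cycs_cyc[OF zeta_mem])
  have "v \<in> units3"
  proof (rule units3_cycs)
    show "v \<in> cycs" unfolding v_def by (intro cycs_minus cycs_1 max3_cycs m)
    show "v \<notin> max3"
    proof
      assume "v \<in> max3"
      hence "v + s * z * unif (Suc n) \<in> max3" using m by (rule max3_add)
      thus False using max3_of_int[of 1] by (simp add: v_def)
    qed
  qed
  obtain w where w: "w \<in> units3" "unif n ^ (2 * 3 ^ (n - 1)) = 3 * w" using step by blast
  have "2 * 3 ^ (Suc n - 1) = 3 * (2 * 3 ^ (n - 1) :: nat)" using step by (cases n) auto
  hence "unif (Suc n) ^ (2 * 3 ^ (Suc n - 1)) = (unif (Suc n) ^ 3) ^ (2 * 3 ^ (n - 1))"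
    by (simp only: power_mult)
  also have "\<dots> = 3 * (w * v ^ (2 * 3 ^ (n - 1)))"
    unfolding eq power_mult_distrib w(2) by simp
  finally have "unif (Suc n) ^ (2 * 3 ^ (Suc n - 1)) = 3 * (w * v ^ (2 * 3 ^ (n - 1)))" .
  thus ?case using w \<open>v \<in> units3\<close> by (blast intro: units3_mult units3_power)
qed

lemma unif_nonzero: "n \<ge> 1 \<Longrightarrow> unif n \<noteq> 0"
  using unif_ramified units3_nonzero by (fastforce simp: zero_power)

text \<open>The factorization is claimed for all large levels, so that two elements can be compared
  at a common one.\<close>

lemma K3_unif:
  assumes "x \<in> cyclotomic_3_infinity" "x \<noteq> 0"
  shows "\<exists>m\<ge>1. \<forall>n\<ge>m. \<exists>k::int. \<exists>u\<in>units3. x = unif n powi k * u"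
proof -
  obtain m r and c :: int where r: "r \<in> cyc m" "c \<noteq> 0" "x = r / of_int c" using K3_fraction assms by blast
  have "\<exists>k::int. \<exists>u\<in>units3. x = unif n powi k * u" if n: "n \<ge> max 1 m" for n
  proof -
    have n': "n \<ge> 1" "r \<in> cyc n" "of_int c \<in> cyc n"
      using n cyc_mono[of m n] r cyc_of_int by auto
    have "r \<noteq> 0" "of_int c \<noteq> (0::complex)" using assms r by auto
    then obtain k s l t where *: "s \<in> cyc n" "s \<notin> max3" "r = unif n ^ k * s"
       "t \<in> cyc n" "t \<notin> max3" "of_int c = unif n ^ l * t"
      using unif_factor[OF n'(1)] n' by metis
    have "x = unif n powi (int k - int l) * (s / t)"
      unfolding r(3) * using unif_nonzero[OF n'(1)] by (simp add: power_int_diff)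
    moreover have "s / t \<in> units3" using * cycs_cyc unfolding units3_def by blast
    ultimately show ?thesis by blast
  qed
  thus ?thesis by (intro exI[of _ "max 1 m"]) auto
qed

section \<open>The normalized valuation above three\<close>

lemma three_powi_unit: "3 powi j \<in> units3 \<Longrightarrow> j = 0"
proof -
  have pos: "3 ^ Suc i \<notin> units3" for i
  proof
    assume "3 ^ Suc i \<in> units3"
    then obtain a b where *: "a \<in> cycs - max3" "b \<in> cycs - max3" "3 ^ Suc i = a / b" by (auto simp: units3_def)
    hence "a = of_int (3 ^ Suc i) * b" using zero_max3 by (auto simp: field_simps)
    moreover have "of_int (3 ^ Suc i) \<in> max3" unfolding max3_of_int by simp
    ultimately show False using * max3_mult by auto
  qed
  assume j: "3 powi j \<in> units3"
  show "j = 0"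
  proof (rule ccontr)
    assume "j \<noteq> 0"
    then consider i where "j = int (Suc i)" | i where "j = - int (Suc i)"
      by (metis int_cases3 Suc_pred)
    thus False
    proof cases
      case 1 thus ?thesis using j pos[of i] by (simp only: power_int_of_nat)
    next
      case 2
      hence "inverse (3 powi j) = (3 :: complex) ^ Suc i"
        by (simp only: power_int_minus power_int_of_nat inverse_inverse_eq)
      thus ?thesis using units3_inverse[OF j] pos[of i] by simp
    qed
  qed
qed

text \<open>The denominator is the ramification index of level \<open>n\<close>; dividing by it
  gives 3 the valuation 1 and makes the value independent of the level.\<close>

definition has_val :: "complex \<Rightarrow> real \<Rightarrow> bool" where
  "has_val x q \<longleftrightarrow> (\<exists>n\<ge>1. \<exists>k::int. \<exists>u\<in>units3. x = unif n powi k * u \<and> q = of_int k / of_nat (2 * 3 ^ (n - 1)))"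

text \<open>Raised to the product of the two ramification indices, \<open>x\<close> becomes a power
  of 3 times a unit in two ways, and no non-trivial power of 3 is a unit.\<close>

lemma has_val_unique: assumes "has_val x p" "has_val x q" shows "p = q"
proof -
  obtain n k u m l w where *: "n \<ge> 1" "u \<in> units3" "x = unif n powi k * u" "p = of_int k / of_nat (2 * 3 ^ (n - 1))"
    "m \<ge> 1" "w \<in> units3" "x = unif m powi l * w" "q = of_int l / of_nat (2 * 3 ^ (m - 1))"
    using assms unfolding has_val_def by metis
  define A B :: nat where "A = 2 * 3 ^ (n - 1)" and "B = 2 * 3 ^ (m - 1)"
  have AB: "A > 0" "B > 0" by (auto simp: A_def B_def)
  obtain s where s: "s \<in> units3" "unif n ^ A = 3 * s" using unif_ramified * A_def by blast
  obtain t where t: "t \<in> units3" "unif m ^ B = 3 * t" using unif_ramified * B_def by blast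
  have e: "(y powi j * v) ^ (C * D) = (3::complex) powi (j * int D) * (z powi (j * int D) * v ^ (C * D))"
    if "y ^ C = 3 * z" for y z v :: complex and j C D
  proof -
    have "(y powi j) ^ (C * D) = (y ^ C) powi (j * int D)"
      by (simp add: power_int_power power_int_power' mult_ac flip: power_int_of_nat power_int_mult)
    thus ?thesis using that by (simp add: power_mult_distrib power_int_mult_distrib)
  qed
  have "x ^ (A * B) = 3 powi (k * int B) * (s powi (k * int B) * u ^ (A * B))"
    unfolding *(3) by (rule e[OF s(2)])
  moreover have "x ^ (B * A) = 3 powi (l * int A) * (t powi (l * int A) * w ^ (B * A))"
    unfolding *(7) by (rule e[OF t(2)])
  ultimately have eq: "3 powi (k * int B) * (s powi (k * int B) * u ^ (A * B))
      = 3 powi (l * int A) * (t powi (l * int A) * w ^ (A * B))" by (simp add: mult.commute)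
  define a b where "a = s powi (k * int B) * u ^ (A * B)" and "b = t powi (l * int A) * w ^ (A * B)"
  have ab: "a \<in> units3" "b \<in> units3" unfolding a_def b_def
    using * s t by (auto intro: units3_mult units3_power units3_powi)
  have "3 powi (k * int B - l * int A) = b * inverse a"
    using eq ab units3_nonzero unfolding a_def[symmetric] b_def[symmetric]
    by (simp add: power_int_diff field_simps)
  hence "k * int B - l * int A = 0" using three_powi_unit units3_mult[OF ab(2) units3_inverse[OF ab(1)]] by metis
  hence "real_of_int k * real B = real_of_int l * real A" by (metis of_int_mult of_int_of_nat_eq right_minus_eq)
  moreover have "p = of_int k / of_nat A" "q = of_int l / of_nat B" using * by (simp_all add: A_def B_def)
  ultimately show ?thesis using AB by (simp add: frac_eq_eq)
qed

definition v3 :: "complex \<Rightarrow> real" where "v3 x = (THE q. has_val x q)"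

lemma v3_eqI: "has_val x q \<Longrightarrow> v3 x = q"
  unfolding v3_def using has_val_unique by blast

lemma v3_unif: "n \<ge> 1 \<Longrightarrow> u \<in> units3 \<Longrightarrow> v3 (unif n powi k * u) = of_int k / of_nat (2 * 3 ^ (n - 1))"
  by (intro v3_eqI) (auto simp: has_val_def)

lemma K3_common:
  assumes "x \<in> cyclotomic_3_infinity" "x \<noteq> 0" "y \<in> cyclotomic_3_infinity" "y \<noteq> 0"
  obtains n k l u w where "n \<ge> 1" "u \<in> units3" "w \<in> units3" "x = unif n powi k * u" "y = unif n powi l * w"
proof -
  obtain m m' where "\<forall>n\<ge>m. \<exists>k::int. \<exists>u\<in>units3. x = unif n powi k * u" "m \<ge> 1"
     "\<forall>n\<ge>m'. \<exists>k::int. \<exists>u\<in>units3. y = unif n powi k * u"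
    using K3_unif[OF assms(1,2)] K3_unif[OF assms(3,4)] by blast
  hence "\<exists>k::int. \<exists>u\<in>units3. x = unif (max m m') powi k * u" "max m m' \<ge> 1"
     "\<exists>k::int. \<exists>u\<in>units3. y = unif (max m m') powi k * u" by simp_all
  thus ?thesis using that by blast
qed

lemma v3_mult:
  assumes "x \<in> cyclotomic_3_infinity" "x \<noteq> 0" "y \<in> cyclotomic_3_infinity" "y \<noteq> 0"
  shows "v3 (x * y) = v3 x + v3 y"
proof -
  obtain n k l u w where *: "n \<ge> 1" "u \<in> units3" "w \<in> units3" "x = unif n powi k * u" "y = unif n powi l * w"
    using K3_common[OF assms] .
  have "x * y = unif n powi (k + l) * (u * w)"
    using * unif_nonzero[OF *(1)] by (simp add: power_int_add)
  hence "v3 (x * y) = of_int (k + l) / of_nat (2 * 3 ^ (n - 1))"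
    using v3_unif[OF *(1) units3_mult[OF *(2,3)]] by simp
  thus ?thesis using v3_unif[OF *(1,2), of k] v3_unif[OF *(1,3), of l] *
    by (simp only: of_int_add add_divide_distrib)
qed

lemma v3_units: "u \<in> units3 \<Longrightarrow> v3 u = 0"
  using v3_unif[of 1 u 0] by simp

text \<open>The valuation ring and its maximal ideal. Closure under addition is visible on fractions
  and gives the ultrametric inequality once \<open>v3_ring3\<close> links it with
  \<open>v3\<close>.\<close>

definition ring3 :: "complex set" where "ring3 = {a / b | a b. a \<in> cycs \<and> b \<in> cycs - max3}"
definition ideal3 :: "complex set" where "ideal3 = {a / b | a b. a \<in> max3 \<and> b \<in> cycs - max3}"

lemma ring3_add:
  assumes "x \<in> ring3" "y \<in> ring3" shows "x + y \<in> ring3"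
proof -
  obtain a b c d where *: "a \<in> cycs" "b \<in> cycs - max3" "c \<in> cycs" "d \<in> cycs - max3"
    "x = a / b" "y = c / d" using assms by (auto simp: ring3_def)
  hence "b \<noteq> 0" "d \<noteq> 0" using zero_max3 by auto
  hence "x + y = (a * d + c * b) / (b * d)" using * by (simp add: field_simps)
  moreover have "a * d + c * b \<in> cycs" "b * d \<in> cycs - max3"
    using * max3_prime by (auto intro: cycs_add cycs_mult)
  ultimately show ?thesis unfolding ring3_def by blast
qed

lemma ideal3_mult:
  assumes "x \<in> ring3" "y \<in> ideal3" shows "x * y \<in> ideal3"
proof -
  obtain a b c d where *: "a \<in> cycs" "b \<in> cycs - max3" "c \<in> max3" "d \<in> cycs - max3"
    "x = a / b" "y = c / d" using assms by (auto simp: ring3_def ideal3_def)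
  hence "x * y = (a * c) / (b * d)" by simp
  moreover have "a * c \<in> max3" "b * d \<in> cycs - max3"
    using * max3_prime by (auto intro: max3_mult' cycs_mult)
  ultimately show ?thesis unfolding ideal3_def by blast
qed

lemma one_ideal3: "1 \<notin> ideal3"
  using zero_max3 by (auto simp: ideal3_def eq_divide_eq)

lemma cyc_K3: "x \<in> cyc n \<Longrightarrow> x \<in> cyclotomic_3_infinity"
  by (induction rule: cyc.induct) (auto intro: K3_closed)

lemma K3_zero: "0 \<in> cyclotomic_3_infinity"
  using cyc_0 by (rule cyc_K3)

lemma K3_inverse: "x \<in> cyclotomic_3_infinity \<Longrightarrow> inverse x \<in> cyclotomic_3_infinity"
  using K3_closed(4) K3_zero by (cases "x = 0") auto

lemma v3_inverse:
  assumes "x \<in> cyclotomic_3_infinity" "x \<noteq> 0" shows "v3 (inverse x) = - v3 x"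
  using v3_mult[OF assms K3_inverse[OF assms(1)]] assms v3_units[OF units3_1] by simp

lemma v3_ring3_aux:
  assumes "x \<in> cyclotomic_3_infinity" "x \<noteq> 0"
  shows "v3 x \<ge> 0 \<Longrightarrow> x \<in> ring3" "v3 x > 0 \<Longrightarrow> x \<in> ideal3"
proof -
  obtain n k u where *: "n \<ge> 1" "u \<in> units3" "x = unif n powi k * u" using K3_unif[OF assms] by blast
  have v: "v3 x = of_int k / of_nat (2 * 3 ^ (n - 1))" using * v3_unif by blast
  obtain a b where u: "u = a / b" "a \<in> cycs - max3" "b \<in> cycs - max3" using *(2) by (auto simp: units3_def)
  {
    assume "v3 x \<ge> 0"
    moreover have "v3 x < 0" if "k < 0"
      unfolding v using that by (intro divide_neg_pos) simp_all
    ultimately have "k \<ge> 0" by linarith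
    hence "x = (unif n ^ nat k * a) / b" using * u by (simp add: power_int_def)
    moreover have "unif n ^ nat k * a \<in> cycs" using u by (intro cycs_mult cycs_power max3_cycs[OF unif_max3]) auto
    ultimately show "x \<in> ring3" unfolding ring3_def using u by blast
  }
  {
    assume "v3 x > 0"
    hence "real_of_int k > 0" using v
      by (metis zero_less_divide_iff not_le of_nat_0_le_iff)
    hence "k > 0" by simp
    then obtain i where i: "nat k = Suc i" using gr0_implies_Suc[of "nat k"] by auto
    hence "x = (unif n * (unif n ^ i * a)) / b" using * u \<open>k > 0\<close> by (simp add: power_int_def)
    moreover have "unif n * (unif n ^ i * a) \<in> max3" using u
      by (intro max3_mult unif_max3 cycs_mult cycs_power max3_cycs[OF unif_max3]) auto
    ultimately show "x \<in> ideal3" unfolding ideal3_def using u by blast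
  }
qed

lemma v3_ring3:
  assumes "x \<in> cyclotomic_3_infinity" "x \<noteq> 0" shows "v3 x \<ge> 0 \<longleftrightarrow> x \<in> ring3"
proof (intro iffI v3_ring3_aux[OF assms])
  assume x: "x \<in> ring3"
  show "v3 x \<ge> 0"
  proof (rule ccontr)
    assume "\<not> ?thesis"
    hence "inverse x \<in> ideal3"
      using v3_inverse[OF assms] K3_inverse assms by (intro v3_ring3_aux) auto
    hence "x * inverse x \<in> ideal3" using x by (rule ideal3_mult[rotated])
    thus False using assms one_ideal3 by simp
  qed
qed

lemma v3_ideal3:
  assumes "x \<in> cyclotomic_3_infinity" "x \<noteq> 0" shows "v3 x > 0 \<longleftrightarrow> x \<in> ideal3"
proof (intro iffI v3_ring3_aux[OF assms])
  assume x: "x \<in> ideal3"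
  show "v3 x > 0"
  proof (rule ccontr)
    assume "\<not> ?thesis"
    hence "inverse x \<in> ring3"
      using v3_inverse[OF assms] K3_inverse assms by (intro v3_ring3_aux) auto
    hence "inverse x * x \<in> ideal3" using x by (rule ideal3_mult)
    thus False using assms one_ideal3 by simp
  qed
qed

subsection \<open>The three-adic valuation\<close>

abbreviation "Kcyc \<equiv> cyclotomic_3_infinity"

text \<open>Zero has no meaningful \<open>v3\<close>; it counts as having infinite valuation, so it
  is accepted by \<open>vge\<close> and \<open>vgt\<close> and refused by
  \<open>veq\<close>.\<close>

definition veq :: "real \<Rightarrow> complex \<Rightarrow> bool" where "veq q x \<longleftrightarrow> x \<in> Kcyc \<and> x \<noteq> 0 \<and> v3 x = q"
definition vge :: "real \<Rightarrow> complex \<Rightarrow> bool" where "vge q x \<longleftrightarrow> x \<in> Kcyc \<and> (x = 0 \<or> v3 x \<ge> q)"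
definition vgt :: "real \<Rightarrow> complex \<Rightarrow> bool" where "vgt q x \<longleftrightarrow> x \<in> Kcyc \<and> (x = 0 \<or> v3 x > q)"

lemma veq_cases: "x \<in> Kcyc \<Longrightarrow> x = 0 \<or> veq (v3 x) x" by (simp add: veq_def)
lemma veq_unique: "veq p x \<Longrightarrow> veq q x \<Longrightarrow> p = q" by (simp add: veq_def)
lemma veq_nonzero: "veq q x \<Longrightarrow> x \<noteq> 0" by (simp add: veq_def)
lemma vge_Kcyc: "vge q x \<Longrightarrow> x \<in> Kcyc" by (simp add: vge_def)
lemma veq_vge: "veq q x \<Longrightarrow> p \<le> q \<Longrightarrow> vge p x" by (simp add: veq_def vge_def)
lemma veq_vgt: "veq q x \<Longrightarrow> p < q \<Longrightarrow> vgt p x" by (simp add: veq_def vgt_def)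
lemma vge_mono: "vge q x \<Longrightarrow> p \<le> q \<Longrightarrow> vge p x" by (auto simp: vge_def)
lemma vgt_mono: "vgt q x \<Longrightarrow> p \<le> q \<Longrightarrow> vgt p x" by (auto simp: vgt_def)
lemma vge_vgt: "vge q x \<Longrightarrow> p < q \<Longrightarrow> vgt p x" by (auto simp: vge_def vgt_def)
lemma vgt_vge: "vgt q x \<Longrightarrow> p \<le> q \<Longrightarrow> vge p x" by (auto simp: vge_def vgt_def)
lemma vge_veqD: "vge p x \<Longrightarrow> veq q x \<Longrightarrow> p \<le> q" by (auto simp: vge_def veq_def)
lemma vgt_veqD: "vgt p x \<Longrightarrow> veq q x \<Longrightarrow> p < q" by (auto simp: vgt_def veq_def)
lemma not_vge: "x \<in> Kcyc \<Longrightarrow> \<not> vge p x \<Longrightarrow> \<exists>q<p. veq q x" by (auto simp: vge_def veq_def)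
lemma vgt_zero: "vgt q 0" by (simp add: vgt_def K3_zero)

lemma vge_0_ring3: "vge 0 x \<longleftrightarrow> x \<in> Kcyc \<and> x \<in> ring3"
proof -
  have "0 \<in> ring3" unfolding ring3_def using cycs_of_int[of 0] units3_1 cycs_1 max3_of_int[of 1]
    by (intro CollectI exI[of _ 0] exI[of _ 1]) auto
  thus ?thesis using v3_ring3[of x] by (auto simp: vge_def)
qed

lemma vgt_0_ideal3: "vgt 0 x \<longleftrightarrow> x \<in> Kcyc \<and> x \<in> ideal3"
proof -
  have "0 \<in> ideal3" unfolding ideal3_def using zero_max3 cycs_1 max3_of_int[of 1]
    by (intro CollectI exI[of _ 0] exI[of _ 1]) auto
  thus ?thesis using v3_ideal3[of x] by (auto simp: vgt_def)
qed

lemma veq_mult: "veq p x \<Longrightarrow> veq q y \<Longrightarrow> veq (p + q) (x * y)"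
  by (simp add: veq_def v3_mult K3_closed)

lemma veq_inverse: "veq p x \<Longrightarrow> veq (- p) (inverse x)"
  by (simp add: veq_def v3_inverse K3_inverse)

lemma veq_divide: "veq p x \<Longrightarrow> veq q y \<Longrightarrow> veq (p - q) (x / y)"
  using veq_mult[OF _ veq_inverse] by (fastforce simp: divide_inverse)

lemma veq_1: "veq 0 1" by (simp add: veq_def K3_closed v3_units units3_1)

lemma veq_power: "veq p x \<Longrightarrow> veq (of_nat n * p) (x ^ n)"
proof (induction n)
  case (Suc n) thus ?case using veq_mult[of p x "of_nat n * p" "x ^ n"] by (simp add: algebra_simps)
qed (simp add: veq_1)

lemma vge_mult: "vge p x \<Longrightarrow> vge q y \<Longrightarrow> vge (p + q) (x * y)"
  by (cases "x = 0 \<or> y = 0") (auto simp: vge_def v3_mult K3_closed K3_zero)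

lemma vge_vgt_mult: "vge p x \<Longrightarrow> vgt q y \<Longrightarrow> vgt (p + q) (x * y)"
  by (cases "x = 0 \<or> y = 0") (auto simp: vge_def vgt_def v3_mult K3_closed K3_zero)

lemma vgt_vge_mult: "vgt p x \<Longrightarrow> vge q y \<Longrightarrow> vgt (p + q) (x * y)"
  by (cases "x = 0 \<or> y = 0") (auto simp: vge_def vgt_def v3_mult K3_closed K3_zero)

lemma vge_veq_divide: "vge p x \<Longrightarrow> veq q y \<Longrightarrow> vge (p - q) (x / y)"
  using vge_mult[of p x "- q" "inverse y"] veq_inverse[of q y] veq_vge by (simp add: divide_inverse)

lemma vgt_veq_divide: "vgt p x \<Longrightarrow> veq q y \<Longrightarrow> vgt (p - q) (x / y)"
  using vgt_vge_mult[of p x "- q" "inverse y"] veq_inverse[of q y] veq_vge by (simp add: divide_inverse)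

lemma v3_uminus: "x \<in> Kcyc \<Longrightarrow> v3 (- x) = v3 x"
proof (cases "x = 0")
  case False
  assume x: "x \<in> Kcyc"
  have "-1 \<in> units3" using units3_cycs[OF cycs_of_int[of "-1"]] max3_of_int[of "-1"] by simp
  thus ?thesis using v3_mult[of "-1" x] v3_units[of "-1"] x False K3_closed(1,3) by simp
qed simp

lemma veq_uminus: "veq q (- x) \<longleftrightarrow> veq q x"
proof -
  have "- x \<in> Kcyc \<longleftrightarrow> x \<in> Kcyc" using K3_closed(3) by (metis minus_minus)
  thus ?thesis using v3_uminus by (auto simp: veq_def)
qed
lemma vge_uminus: "vge q x \<Longrightarrow> vge q (- x)" by (auto simp: vge_def v3_uminus K3_closed)
lemma vgt_uminus: "vgt q x \<Longrightarrow> vgt q (- x)" by (auto simp: vgt_def v3_uminus K3_closed)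

lemma vge_add: assumes "vge q x" "vge q y" shows "vge q (x + y)"
proof -
  have aux: "vge q (x + y)" if xy: "vge q x" "vge q y" "x \<noteq> 0" "y \<noteq> 0" "v3 x \<le> v3 y" for x y
  proof -
    have x: "veq (v3 x) x" and y: "vge (v3 x) y" using xy by (auto simp: veq_def vge_def)
    have "vge 0 (y / x)" using vge_veq_divide[OF y x] by simp
    moreover have "vge 0 1" using veq_vge[OF veq_1] by simp
    ultimately have "vge 0 (1 + y / x)" using ring3_add K3_closed(5) unfolding vge_0_ring3 by blast
    hence "vge (v3 x + 0) (x * (1 + y / x))" using x by (intro vge_mult) (auto intro: veq_vge)
    thus ?thesis using xy by (auto simp: distrib_left vge_def)
  qed
  show ?thesis
  proof (cases "x = 0 \<or> y = 0")
    case False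
    thus ?thesis using aux[of x y] aux[of y x] assms by (cases "v3 x \<le> v3 y") (auto simp: add.commute)
  qed (use assms in auto)
qed

lemma vgt_vge_iff: "vgt q x \<longleftrightarrow> x \<in> Kcyc \<and> (\<exists>p>q. vge p x)"
proof
  assume "vgt q x"
  thus "x \<in> Kcyc \<and> (\<exists>p>q. vge p x)"
    by (cases "x = 0") (auto simp: vgt_def vge_def K3_zero intro: gt_ex)
qed (auto intro: vge_vgt)

lemma vgt_add: assumes "vgt q x" "vgt q y" shows "vgt q (x + y)"
proof -
  obtain a b where "a > q" "vge a x" "b > q" "vge b y" using assms vgt_vge_iff by blast
  hence "vge (min a b) (x + y)" by (intro vge_add) (auto intro: vge_mono)
  thus ?thesis using \<open>a > q\<close> \<open>b > q\<close> by (auto intro: vge_vgt)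
qed

lemma vge_minus: "vge q x \<Longrightarrow> vge q y \<Longrightarrow> vge q (x - y)"
  using vge_add[of q x "- y"] vge_uminus by simp

lemma vgt_minus: "vgt q x \<Longrightarrow> vgt q y \<Longrightarrow> vgt q (x - y)"
  using vgt_add[of q x "- y"] vgt_uminus by simp

lemma veq_add: assumes "veq q x" "vgt q y" shows "veq q (x + y)"
proof -
  have "vge q (x + y)" using assms by (intro vge_add) (auto intro: veq_vge vgt_vge)
  moreover have "\<not> vgt q (x + y)"
  proof
    assume "vgt q (x + y)"
    hence "vgt q (x + y - y)" using assms by (intro vgt_minus) auto
    thus False using assms vgt_veqD by fastforce
  qed
  ultimately show ?thesis by (auto simp: vge_def vgt_def veq_def)
qed

lemma veq_minus: "veq q x \<Longrightarrow> vgt q y \<Longrightarrow> veq q (x - y)"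
  using veq_add[of q x "- y"] vgt_uminus by simp

lemma vge_power: "vge p x \<Longrightarrow> vge (of_nat n * p) (x ^ n)"
proof (induction n)
  case (Suc n) thus ?case using vge_mult[of p x "of_nat n * p" "x ^ n"] by (simp add: algebra_simps)
qed (simp add: veq_vge[OF veq_1])

lemma vge_cycs: "x \<in> cycs \<Longrightarrow> vge 0 x"
proof -
  assume x: "x \<in> cycs"
  hence "x = x / 1 \<and> x \<in> cycs \<and> 1 \<in> cycs - max3" using cycs_1 max3_of_int[of 1] by simp
  hence "x \<in> ring3" unfolding ring3_def by blast
  moreover have "x \<in> Kcyc" using x cyc_K3 by (auto simp: cycs_def)
  ultimately show ?thesis by (simp add: vge_0_ring3)
qed

lemma vge_of_int: "vge 0 (of_int k)" using cycs_of_int by (rule vge_cycs)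

lemma veq_of_int: "\<not> 3 dvd k \<Longrightarrow> veq 0 (of_int k)"
  using v3_units[OF units3_cycs[OF cycs_of_int[of k]]] max3_of_int[of k] vge_Kcyc[OF vge_of_int]
  by (auto simp: veq_def)

lemma veq_3: "veq 1 3"
proof -
  obtain u where u: "u \<in> units3" "unif 1 ^ 2 = 3 * u" using unif_ramified[of 1] by auto
  hence "3 = unif 1 powi 2 * inverse u" using units3_nonzero by (simp add: field_simps)
  hence "v3 3 = 1" using v3_unif[of 1 "inverse u" 2] units3_inverse u by simp
  thus ?thesis using vge_Kcyc[OF vge_of_int[of 3]] by (simp add: veq_def)
qed

lemma veq_3_power: "\<not> 3 dvd k \<Longrightarrow> veq (of_nat j) (of_int (3 ^ j * k))"
  using veq_mult[OF veq_power[OF veq_3, of j] veq_of_int] by simp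

lemma vge_3_power: "vge (of_nat j) (of_int (3 ^ j * k))"
  using vge_mult[OF veq_vge[OF veq_power[OF veq_3, of j] order_refl] vge_of_int] by simp

text \<open>An element of valuation \<open>2 / 3\<close> is therefore irrational; this keeps the
  generators of order 7 and 9 out of the rational points.\<close>

lemma veq_Rats: assumes "x \<in> \<rat>" "x \<noteq> 0" shows "\<exists>k::int. veq (of_int k) x"
proof -
  have int: "\<exists>k::int. veq (of_int k) (of_int c)" if nz: "c \<noteq> 0" for c :: int
  proof -
    have "\<not> is_unit (3 :: int)" by simp
    then obtain d where "c = 3 ^ multiplicity 3 c * d" "\<not> 3 dvd d"
      by (rule multiplicity_decompose'[OF nz])
    thus ?thesis using veq_3_power[of d "multiplicity 3 c"]
      by (intro exI[of _ "int (multiplicity 3 c)"]) simp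
  qed
  obtain a b where ab: "b > 0" "x = of_int a / of_int b" using assms(1) by (rule Rats_cases')
  then obtain k l :: int where "veq (of_int k) (of_int a)" "veq (of_int l) (of_int b)"
    using int[of a] int[of b] assms by auto
  from veq_divide[OF this] show ?thesis using ab by (intro exI[of _ "k - l"]) simp
qed

text \<open>The value group is contained in the numbers \<open>k / (2 \<cdot> 3\<^sup>n)\<close>.\<close>

lemma veq_quarter: "veq (of_int m / 4) x \<Longrightarrow> even m"
proof -
  assume x: "veq (of_int m / 4) x"
  then obtain n k u where *: "n \<ge> 1" "u \<in> units3" "x = unif n powi k * u"
    using K3_unif[of x] by (auto simp: veq_def)
  hence "of_int m / 4 = (of_int k / of_nat (2 * 3 ^ (n - 1)) :: real)"
    using x v3_unif by (simp add: veq_def)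
  hence "real_of_int (m * 3 ^ (n - 1)) = real_of_int (2 * k)" by (simp add: field_simps)
  hence "m * 3 ^ (n - 1) = 2 * k" by (simp only: of_int_eq_iff)
  hence "even (m * 3 ^ (n - 1))" by simp
  thus ?thesis by simp
qed

lemma vge_residue:
  assumes "vge 0 x" shows "\<exists>c\<in>{0,1,-1}. vgt 0 (x - of_int c)"
proof -
  obtain a b where ab: "a \<in> cycs" "b \<in> cycs" "b \<notin> max3" "x = a / b"
    using assms by (auto simp: vge_0_ring3 ring3_def)
  have b0: "b \<noteq> 0" using ab zero_max3 by auto
  obtain c d where c: "c \<in> {0,1,-1}" "a - of_int c \<in> max3" and d: "d \<in> {0,1,-1}" "b - of_int d \<in> max3"
    using max3_residue ab by meson
  have d0: "d * d = 1" using d ab by auto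
  \<comment> \<open>Since \<open>d * d = 1\<close>, the quotient \<open>a / b\<close> has residue
    \<open>c * d\<close>.\<close>
  have "a - of_int (c * d) * b = (a - of_int c) - of_int (c * d) * (b - of_int d) - of_int (c * (d * d) - c)"
    by (simp add: algebra_simps)
  also have "\<dots> = (a - of_int c) - of_int (c * d) * (b - of_int d)" using d0 by simp
  also have "\<dots> \<in> max3" by (intro max3_minus c max3_mult' cycs_of_int d)
  finally have "(a - of_int (c * d) * b) / b \<in> ideal3" unfolding ideal3_def using ab by blast
  hence "x - of_int (c * d) \<in> ideal3" using b0 ab by (simp add: diff_divide_distrib)
  moreover have "x - of_int (c * d) \<in> Kcyc"
    using vge_Kcyc[OF vge_minus[OF assms vge_of_int]] .
  ultimately have "vgt 0 (x - of_int (c * d))" by (simp add: vgt_0_ideal3)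
  moreover have "c * d \<in> {0,1,-1}" using c d by auto
  ultimately show ?thesis by blast
qed

section \<open>Doubling, tripling and valuations\<close>

lemma (in group) nat_pow_mod:
  assumes "x \<in> carrier G" "x [^] n = \<one>" shows "x [^] (k mod n) = x [^] (k :: nat)"
proof -
  have "x [^] k = x [^] (n * (k div n) + k mod n)" by simp
  also have "\<dots> = (x [^] n) [^] (k div n) \<otimes> x [^] (k mod n)"
    using assms(1) by (simp only: nat_pow_mult nat_pow_pow nat_pow_closed)
  also have "\<dots> = x [^] (k mod n)" using assms by simp
  finally show ?thesis ..
qed

context nonsingular_cubic
begin

text \<open>Taylor expansion of the cubic at an abscissa, and the differences of the abscissae of
  \<open>2T\<close>, \<open>3T\<close> from that of \<open>T\<close>.\<close>

lemma taylor:
  assumes "on (Affine x y)" "on (Affine (x + d) y')"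
  shows "y'^2 = d ^ 3 + (3 * x + a) * d ^ 2 + (3 * x ^ 2 + 2 * a * x + b) * d + y ^ 2"
  using assms by (simp add: power2_eq_square power3_eq_cube algebra_simps)

lemma double_diff:
  assumes T: "on (Affine x y)" and y: "y \<noteq> 0"
  defines "l \<equiv> (3 * x ^ 2 + 2 * a * x + b) / (2 * y)"
    and "d \<equiv> (3 * x ^ 2 + 2 * a * x + b) ^ 2 / (4 * y ^ 2) - (3 * x + a)"
  shows "Affine x y \<boxplus> Affine x y = Affine (x + d) (- (y + l * d))"
proof -
  have ne: "\<not> (x = x \<and> y + y = 0)" using y by (simp flip: mult_2)
  have "l * (y + y) = 3 * x ^ 2 + 2 * a * x + b" using y by (simp add: l_def flip: mult_2)
  hence s: "slope x y x y l" by (simp add: slope_def power2_eq_square algebra_simps)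
  have d: "l ^ 2 - a - x - x = x + d" by (simp add: l_def d_def power_divide power_mult_distrib)
  show ?thesis using add_slope[OF T T ne s] unfolding d by (simp add: algebra_simps)
qed

lemma triple_diff:
  assumes T: "on (Affine x y)" and y: "y \<noteq> 0"
  defines "d \<equiv> (3 * x ^ 2 + 2 * a * x + b) ^ 2 / (4 * y ^ 2) - (3 * x + a)"
  shows "d = 0 \<Longrightarrow> Affine x y \<boxplus> (Affine x y \<boxplus> Affine x y) = Origin"
    and "d \<noteq> 0 \<Longrightarrow> \<exists>y'. Affine x y \<boxplus> (Affine x y \<boxplus> Affine x y) =
       Affine (x + (4 * y ^ 2 / d ^ 2 + 2 * (3 * x ^ 2 + 2 * a * x + b) / d)) y'"
proof -
  define l where "l = (3 * x ^ 2 + 2 * a * x + b) / (2 * y)"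
  note D = double_diff[OF T y, folded d_def l_def]
  show "Affine x y \<boxplus> (Affine x y \<boxplus> Affine x y) = Origin" if "d = 0"
    using D that by simp
  assume d: "d \<noteq> 0"
  define m where "m = - l - 2 * y / d"
  have on2: "on (Affine (x + d) (- (y + l * d)))" using D add_on[OF T T] by metis
  have ne: "\<not> (x = x + d \<and> y + - (y + l * d) = 0)" using d by simp
  obtain m' where m': "slope x y (x + d) (- (y + l * d)) m'" using slope_exists[OF T on2 ne] by blast
  hence "m' * d = m * d" using d by (simp add: slope_def m_def left_diff_distrib algebra_simps)
  hence s: "slope x y (x + d) (- (y + l * d)) m" using m' d by simp
  have ly: "2 * (l * y) = 3 * x ^ 2 + 2 * a * x + b" using y by (simp add: l_def)
  have l2: "l ^ 2 = d + 3 * x + a" by (simp add: l_def d_def power_divide power_mult_distrib)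
  have "m ^ 2 - a - x - (x + d) = x + (m ^ 2 - l ^ 2)" unfolding l2 by simp
  also have "m ^ 2 - l ^ 2 = 4 * y ^ 2 / d ^ 2 + 2 * (2 * (l * y)) / d"
    using d by (simp add: m_def power2_eq_square field_simps)
  finally have "m ^ 2 - a - x - (x + d) = x + (4 * y ^ 2 / d ^ 2 + 2 * (3 * x ^ 2 + 2 * a * x + b) / d)"
    unfolding ly .
  thus "\<exists>y'. Affine x y \<boxplus> (Affine x y \<boxplus> Affine x y) =
       Affine (x + (4 * y ^ 2 / d ^ 2 + 2 * (3 * x ^ 2 + 2 * a * x + b) / d)) y'"
    unfolding D add_slope[OF T on2 ne s] by metis
qed

end

locale cubic_over_Kcyc = cubic_over_subfield a b c K for a b c :: complex and K +
  assumes K_subset: "K \<subseteq> Kcyc"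
begin

text \<open>Scaling \<open>x\<close> by valuation \<open>q / 3\<close> around \<open>T\<close>, the
  hypotheses say that the curve reduces to the cuspidal cubic \<open>Y^2 = X^3 + c\<close> in
  characteristic 3, whose smooth part is an additive group killed by 3. So \<open>3 T\<close> moves
  towards the origin: its displacement \<open>D\<close> has valuation below \<open>q / 3\<close>,
  and \<open>D ^ 3\<close> dominates the Taylor expansion.\<close>

lemma triple_step:
  assumes T: "Affine x y \<in> carrier \<E>" and F: "veq q (y ^ 2)"
    and F1: "vgt (2 * q / 3) (3 * x ^ 2 + 2 * a * x + b)" and F2: "vgt (q / 3) (3 * x + a)"
  shows "Affine x y \<boxplus> (Affine x y \<boxplus> Affine x y) = Origin \<or>
    (\<exists>x' y' r. Affine x y \<boxplus> (Affine x y \<boxplus> Affine x y) = Affine x' y' \<and> veq r (y' ^ 2) \<and> r < q)"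
proof -
  define f1 where "f1 = 3 * x ^ 2 + 2 * a * x + b"
  define d where "d = f1 ^ 2 / (4 * y ^ 2) - (3 * x + a)"
  have y: "y \<noteq> 0" using veq_nonzero[OF F] by simp
  have on: "on (Affine x y)" using T by (rule carrier_on)
  note td = triple_diff[OF on y, folded f1_def, folded d_def]
  show ?thesis
  proof (cases "d = 0")
    case False
    have v4: "veq 0 4" "veq 0 2" using veq_of_int[of 4] veq_of_int[of 2] by auto
    have f1: "vgt (2 * q / 3) f1" using F1 by (simp add: f1_def)
    have "vgt (2 * q / 3 + 2 * q / 3) (f1 ^ 2)"
      using vgt_vge_mult[OF f1 vgt_vge[OF f1 order_refl]] by (simp add: power2_eq_square)
    hence "vgt (2 * q / 3 + 2 * q / 3 - (0 + q)) (f1 ^ 2 / (4 * y ^ 2))"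
      using vgt_veq_divide veq_mult[OF v4(1) F] by blast
    hence "vgt (q / 3) (f1 ^ 2 / (4 * y ^ 2))" by (rule vgt_mono) simp
    hence "vgt (q / 3) d" unfolding d_def using F2 by (rule vgt_minus)
    then obtain e where e: "veq e d" "q / 3 < e" using False by (auto simp: vgt_def veq_def)
    define D where "D = 4 * y ^ 2 / d ^ 2 + 2 * f1 / d"
    define r where "r = q - 2 * e"
    have r: "r < q / 3" using e by (simp add: r_def)
    have "veq (0 + q - of_nat 2 * e) (4 * y ^ 2 / d ^ 2)"
      by (intro veq_divide veq_mult v4 F veq_power e)
    hence 1: "veq r (4 * y ^ 2 / d ^ 2)" by (simp add: r_def)
    have "vgt (0 + 2 * q / 3 - e) (2 * f1 / d)"
      using vgt_veq_divide[OF vge_vgt_mult[OF veq_vge[OF v4(2) order_refl] f1] e(1)] by simp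
    hence "vgt r (2 * f1 / d)" by (rule vgt_mono) (use e in \<open>simp add: r_def\<close>)
    hence D: "veq r D" unfolding D_def by (rule veq_add[OF 1])
    obtain y' where y': "Affine x y \<boxplus> (Affine x y \<boxplus> Affine x y) = Affine (x + D) y'"
      using td(2)[OF False] by (auto simp: D_def)
    have "on (Affine (x + D) y')" using y' add_on on by metis
    hence eq: "y' ^ 2 = D ^ 3 + ((3 * x + a) * D ^ 2 + (f1 * D + y ^ 2))"
      using taylor[OF on, of D y'] by (simp add: f1_def add.assoc)
    have "veq (of_nat 3 * r) (y' ^ 2)" unfolding eq
    proof (intro veq_add veq_power D vgt_add)
      show "vgt (of_nat 3 * r) ((3 * x + a) * D ^ 2)"
        by (rule vgt_mono[OF vgt_vge_mult[OF F2 veq_vge[OF veq_power[OF D] order_refl]]])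
           (use r in simp)
      show "vgt (of_nat 3 * r) (f1 * D)"
        by (rule vgt_mono[OF vgt_vge_mult[OF f1 veq_vge[OF D order_refl]]]) (use r in simp)
      show "vgt (of_nat 3 * r) (y ^ 2)" using F r by (intro veq_vgt) auto
    qed
    thus ?thesis using y' r by (intro disjI2 exI[of _ "x + D"] exI[of _ y'] exI[of _ "of_nat 3 * r"]) auto
  qed (use td(1) in auto)
qed

text \<open>The complementary situation: \<open>T\<close> is close to a point of order two,
  \<open>y ^ 2\<close> being small against the derivative, so doubling throws it far out. The
  displacement is governed by the squared derivative over \<open>4 y ^ 2\<close>.\<close>

lemma double_step:
  assumes T: "Affine x y \<in> carrier \<E>" and F: "veq q (y ^ 2)"
    and F1: "veq p (3 * x ^ 2 + 2 * a * x + b)" and F2: "vgt (p / 2) (3 * x + a)"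
    and pq: "q > 3 / 2 * p"
  shows "\<exists>x' y' r. Affine x y \<boxplus> Affine x y = Affine x' y' \<and> veq r (y' ^ 2) \<and> r < 3 / 2 * p"
proof -
  define f1 where "f1 = 3 * x ^ 2 + 2 * a * x + b"
  define d where "d = f1 ^ 2 / (4 * y ^ 2) - (3 * x + a)"
  have y: "y \<noteq> 0" using veq_nonzero[OF F] by simp
  have on: "on (Affine x y)" using T by (rule carrier_on)
  have f1: "veq p f1" using F1 by (simp add: f1_def)
  define r where "r = 2 * p - q"
  have r: "r < p / 2" using pq by (simp add: r_def)
  have v4: "veq 0 4" using veq_of_int[of 4] by auto
  have "veq (of_nat 2 * p - (0 + q)) (f1 ^ 2 / (4 * y ^ 2))"
    by (intro veq_divide veq_mult v4 F veq_power f1)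
  hence D: "veq r d" unfolding d_def using F2 r by (intro veq_minus) (auto simp: r_def intro: vgt_mono)
  obtain y' where y': "Affine x y \<boxplus> Affine x y = Affine (x + d) y'"
    using double_diff[OF on y] by (auto simp: d_def f1_def)
  have "on (Affine (x + d) y')" using y' add_on on by metis
  hence eq: "y' ^ 2 = d ^ 3 + ((3 * x + a) * d ^ 2 + (f1 * d + y ^ 2))"
    using taylor[OF on, of d y'] by (simp add: f1_def add.assoc)
  have "veq (of_nat 3 * r) (y' ^ 2)" unfolding eq
  proof (intro veq_add veq_power D vgt_add)
    show "vgt (of_nat 3 * r) ((3 * x + a) * d ^ 2)"
      by (rule vgt_mono[OF vgt_vge_mult[OF F2 veq_vge[OF veq_power[OF D] order_refl]]])
         (use r in simp)
    have "veq (p + r) (f1 * d)" by (rule veq_mult[OF f1 D])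
    thus "vgt (of_nat 3 * r) (f1 * d)" by (rule veq_vgt) (use r in simp)
    show "vgt (of_nat 3 * r) (y ^ 2)" using F r pq by (intro veq_vgt) auto
  qed
  thus ?thesis using y' r by (intro exI[of _ "x + d"] exI[of _ y'] exI[of _ "of_nat 3 * r"]) auto
qed

text \<open>Where tripling strictly decreases the valuation of \<open>y\<^sup>2\<close>, the multiples \<open>3\<^sup>k T\<close> of a point of
  finite order cannot all be affine.\<close>

lemma torsion_three_power:
  assumes region: "\<And>x y q. Affine x y \<in> carrier \<E> \<Longrightarrow> veq q (y ^ 2) \<Longrightarrow> q < C \<Longrightarrow>
      vgt (2 * q / 3) (3 * x ^ 2 + 2 * a * x + b) \<and> vgt (q / 3) (3 * x + a)"
    and T: "T \<in> carrier \<E>" "T = Origin \<or> (\<exists>x y q. T = Affine x y \<and> veq q (y ^ 2) \<and> q < C)"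
    and tors: "n > 0" "T [^]\<^bsub>\<E>\<^esub> (n::nat) = Origin"
  shows "\<exists>k::nat. T [^]\<^bsub>\<E>\<^esub> (3 ^ k :: nat) = Origin"
proof (rule ccontr)
  assume no: "\<not> ?thesis"
  define g where "g k = T [^]\<^bsub>\<E>\<^esub> (3 ^ k :: nat)" for k :: nat
  \<comment> \<open>The value at \<open>Origin\<close> is arbitrary: by assumption no
    \<open>g k\<close> is the origin.\<close>
  define w where "w P = (case P of Origin \<Rightarrow> 0 | Affine x y \<Rightarrow> v3 (y ^ 2))" for P
  have gS: "g (Suc k) = g k \<boxplus> (g k \<boxplus> g k)" and gc: "g k \<in> carrier \<E>" for k
  proof -
    show gc: "g k \<in> carrier \<E>" unfolding g_def using T by simp
    have "g (Suc k) = g k [^]\<^bsub>\<E>\<^esub> (3::nat)"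
      unfolding g_def using T by (simp add: points.nat_pow_pow mult.commute)
    also have "\<dots> = g k \<boxplus> (g k \<boxplus> g k)"
      using gc points.m_assoc[of "g k" "g k" "g k"] by (simp add: numeral_3_eq_3 mult_points one_points)
    finally show "g (Suc k) = g k \<boxplus> (g k \<boxplus> g k)" .
  qed
  have g_affine: "g k \<noteq> Origin" for k unfolding g_def using no by blast
  have reg: "\<exists>x y q. g k = Affine x y \<and> veq q (y ^ 2) \<and> q < C" for k
  proof (induction k)
    case 0
    have "T \<noteq> Origin" using no T by (metis points.nat_pow_one one_points)
    thus ?case using T by (simp add: g_def)
  next
    case (Suc k)
    then obtain x y q where *: "g k = Affine x y" "veq q (y ^ 2)" "q < C" by blast
    have "g (Suc k) \<noteq> Origin" by (rule g_affine)
    thus ?case using triple_step[OF _ *(2)] region[OF _ *(2,3)] gc[of k] *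
      unfolding gS by fastforce
  qed
  have dec: "w (g (Suc k)) < w (g k)" for k
  proof -
    obtain x y q where *: "g k = Affine x y" "veq q (y ^ 2)" "q < C" using reg by blast
    have "g (Suc k) \<noteq> Origin" by (rule g_affine)
    then obtain x' y' r where **: "g (Suc k) = Affine x' y'" "veq r (y' ^ 2)" "r < q"
      using triple_step[OF _ *(2)] region[OF _ *(2,3)] gc[of k] * unfolding gS by metis
    thus ?thesis using * by (simp add: w_def veq_def)
  qed
  have "strict_mono (\<lambda>k. - w (g k))" unfolding strict_mono_Suc_iff using dec by simp
  hence "inj g" unfolding inj_on_def by (metis strict_mono_eq)
  moreover have "range g \<subseteq> (\<lambda>j. T [^]\<^bsub>\<E>\<^esub> j) ` {..<n}"
  proof
    fix P assume "P \<in> range g"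
    then obtain k where k: "P = T [^]\<^bsub>\<E>\<^esub> (3 ^ k :: nat)" by (auto simp: g_def)
    have "T [^]\<^bsub>\<E>\<^esub> (3 ^ k mod n) = T [^]\<^bsub>\<E>\<^esub> (3 ^ k :: nat)"
      using T(1) tors(2) by (intro points.nat_pow_mod) (simp_all add: one_points)
    thus "P \<in> (\<lambda>j. T [^]\<^bsub>\<E>\<^esub> j) ` {..<n}" using k tors(1) by (metis imageI lessThan_iff mod_less_divisor)
  qed
  ultimately show False
    using finite_subset[of "range g"] range_inj_infinite[of g] by blast
qed

end

section \<open>Torsion subgroups and the cubic field\<close>

lemma discriminant_cubic_model:
  "discriminant (cubic_model a b c) = 16 * (a^2 * b^2 - 4 * b^3 - 4 * a^3 * c - 27 * c^2 + 18 * a * b * c)"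
  by (simp add: discriminant_def b2_def b4_def b6_def b8_def power2_eq_square power3_eq_cube algebra_simps)

lemma nonsingularI:
  fixes a b c :: "'a::field_char_0"
  assumes "discriminant (cubic_model a b c) \<noteq> 0" shows "nonsingular_cubic a b c"
proof
  fix x assume f: "x ^ 3 + a * x ^ 2 + b * x + c = 0"
  show "3 * x ^ 2 + 2 * a * x + b \<noteq> 0"
  proof
    assume f': "3 * x ^ 2 + 2 * a * x + b = 0"
    have b: "b = - 3 * x ^ 2 - 2 * a * x" using f' by (simp add: eq_neg_iff_add_eq_0 algebra_simps)
    have c: "c = 2 * x ^ 3 + a * x ^ 2"
      using f unfolding b by (simp add: power2_eq_square power3_eq_cube algebra_simps eq_neg_iff_add_eq_0)
    have "discriminant (cubic_model a b c) = 0"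
      unfolding discriminant_cubic_model b c by (simp add: power2_eq_square power3_eq_cube algebra_simps)
    thus False using assms by simp
  qed
qed

lemma (in comm_group) torsion_subgroup_cyclic:
  assumes P: "P \<in> carrier G" "P [^] n = \<one>" "n > 0" and ord: "\<And>k::nat. 0 < k \<Longrightarrow> k < n \<Longrightarrow> P [^] k \<noteq> \<one>"
    and gen: "\<And>x m::nat. x \<in> carrier G \<Longrightarrow> m > 0 \<Longrightarrow> x [^] m = \<one> \<Longrightarrow> \<exists>k::nat. x = P [^] k"
  shows "torsion_subgroup G \<cong> integer_mod_group n"
proof -
  define \<phi> where "\<phi> k = P [^] nat k" for k :: int
  have md: "P [^] (k mod n) = P [^] k" for k :: nat by (rule nat_pow_mod[OF P(1,2)])
  have "\<phi> \<in> iso (integer_mod_group n) (torsion_subgroup G)"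
  proof (rule isoI)
    show "\<phi> \<in> hom (integer_mod_group n) (torsion_subgroup G)"
    proof (rule homI)
      fix x assume "x \<in> carrier (integer_mod_group n)"
      have "(P [^] nat x) [^] n = \<one>" using P by (simp add: nat_pow_pow mult.commute flip: nat_pow_pow[of P n])
      thus "\<phi> x \<in> carrier (torsion_subgroup G)"
        using P by (auto simp: torsion_subgroup_def \<phi>_def)
    next
      fix x y assume "x \<in> carrier (integer_mod_group n)" "y \<in> carrier (integer_mod_group n)"
      hence xy: "x \<ge> 0" "y \<ge> 0" using P by (auto simp: integer_mod_group_def)
      have "\<phi> ((x + y) mod int n) = P [^] ((nat x + nat y) mod n)"
        using xy by (simp add: \<phi>_def nat_mod_distrib nat_add_distrib)
      thus "\<phi> (x \<otimes>\<^bsub>integer_mod_group n\<^esub> y) = \<phi> x \<otimes>\<^bsub>torsion_subgroup G\<^esub> \<phi> y"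
        using P by (simp add: integer_mod_group_def torsion_subgroup_def md \<phi>_def nat_pow_mult)
    qed
    show "bij_betw \<phi> (carrier (integer_mod_group n)) (carrier (torsion_subgroup G))"
      unfolding bij_betw_def
    proof
      have inj: "k = l" if "P [^] k = P [^] l" "k < n" "l < n" "k \<le> l" for k l :: nat
      proof (rule ccontr)
        assume "k \<noteq> l"
        have "P [^] k \<otimes> P [^] (l - k) = P [^] k" using P that nat_pow_mult[of P k "l - k"] by simp
        hence "P [^] (l - k) = \<one>" using P l_cancel_one by simp
        thus False using ord[of "l - k"] that \<open>k \<noteq> l\<close> by simp
      qed
      show "inj_on \<phi> (carrier (integer_mod_group n))"
      proof (rule inj_onI)
        fix x y assume *: "x \<in> carrier (integer_mod_group n)" "y \<in> carrier (integer_mod_group n)" "\<phi> x = \<phi> y"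
        hence "nat x < n" "nat y < n" "x \<ge> 0" "y \<ge> 0" using P by (auto simp: integer_mod_group_def)
        hence "nat x = nat y" using inj[of "nat x" "nat y"] inj[of "nat y" "nat x"] *(3)
          by (metis \<phi>_def nat_le_linear)
        thus "x = y" using \<open>x \<ge> 0\<close> \<open>y \<ge> 0\<close> by simp
      qed
      show "\<phi> ` carrier (integer_mod_group n) = carrier (torsion_subgroup G)"
      proof
        show "\<phi> ` carrier (integer_mod_group n) \<subseteq> carrier (torsion_subgroup G)"
          using \<open>\<phi> \<in> hom _ _\<close> by (auto simp: hom_def)
        show "carrier (torsion_subgroup G) \<subseteq> \<phi> ` carrier (integer_mod_group n)"
        proof
          fix x assume "x \<in> carrier (torsion_subgroup G)"
          then obtain k :: nat where "x = P [^] k" using gen by (auto simp: torsion_subgroup_def)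
          hence "x = \<phi> (int (k mod n))" by (simp add: \<phi>_def md)
          moreover have "int (k mod n) \<in> carrier (integer_mod_group n)"
            using P by (simp add: integer_mod_group_def)
          ultimately show "x \<in> \<phi> ` carrier (integer_mod_group n)" by blast
        qed
      qed
    qed
  qed
  thus ?thesis using group.iso_sym[OF group_integer_mod_group] by (auto simp: is_iso_def)
qed

text \<open>The elements of trace zero in the cubic subfield of \<open>\<rat>(\<zeta>\<^sub>9)\<close> are the rational
  combinations of the three conjugates of \<open>2 cos (2\<pi>/9)\<close>.\<close>

definition cub1 :: complex where "cub1 = zeta 2 + zeta 2 ^ 8"
definition cub2 :: complex where "cub2 = zeta 2 ^ 2 + zeta 2 ^ 7"
definition cub3 :: complex where "cub3 = zeta 2 ^ 4 + zeta 2 ^ 5"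

lemma zeta_2: "zeta 2 ^ 9 = 1" "zeta 2 ^ 6 = - (zeta 2 ^ 3) - 1"
proof -
  show "zeta 2 ^ 9 = 1" using zeta_power[of 2] by simp
  have "zeta 2 ^ 3 = zeta 1" using zeta_Suc[of 1] by (simp add: numeral_2_eq_2)
  hence "zeta 2 ^ 6 = zeta 1 ^ 2" using power_mult[of "zeta 2" 3 2] by simp
  thus "zeta 2 ^ 6 = - (zeta 2 ^ 3) - 1"
    using zeta_1 \<open>zeta 2 ^ 3 = zeta 1\<close> by (simp add: eq_neg_iff_add_eq_0 algebra_simps)
qed

lemma cub_relations:
  "cub1 + cub2 + cub3 = 0" "cub1 ^ 2 = cub2 + 2" "cub2 ^ 2 = cub3 + 2" "cub3 ^ 2 = cub1 + 2"
  "cub1 * cub2 = cub1 - 1"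
proof -
  define z where "z = zeta 2"
  have 9: "z ^ 9 = 1" and 6: "z ^ 6 = - (z ^ 3) - 1" using zeta_2 by (simp_all add: z_def)
  have c: "cub1 = z + z ^ 8" "cub2 = z ^ 2 + z ^ 7" "cub3 = z ^ 4 + z ^ 5"
    by (simp_all add: cub1_def cub2_def cub3_def z_def)
  show "cub1 + cub2 + cub3 = 0"
  proof -
    have "z ^ 7 = z * z ^ 6" by (simp add: eval_nat_numeral)
    also have "\<dots> = - (z ^ 4) - z" unfolding 6 by (simp add: eval_nat_numeral algebra_simps)
    finally have 7: "z ^ 7 = - (z ^ 4) - z" .
    have "z ^ 8 = z * z ^ 7" by (simp add: eval_nat_numeral)
    also have "\<dots> = - (z ^ 5) - z ^ 2" unfolding 7 by (simp add: eval_nat_numeral algebra_simps)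
    finally have 8: "z ^ 8 = - (z ^ 5) - z ^ 2" .
    show ?thesis unfolding c 7 8 by simp
  qed
  have "(z + z ^ 8) ^ 2 = z ^ 2 + 2 * z ^ 9 + z ^ 9 * z ^ 7"
    by (simp add: eval_nat_numeral algebra_simps)
  thus "cub1 ^ 2 = cub2 + 2" unfolding c 9 by simp
  have "(z ^ 2 + z ^ 7) ^ 2 = z ^ 4 + 2 * z ^ 9 + z ^ 9 * z ^ 5"
    by (simp add: eval_nat_numeral algebra_simps)
  thus "cub2 ^ 2 = cub3 + 2" unfolding c 9 by simp
  have "(z ^ 4 + z ^ 5) ^ 2 = z ^ 8 + 2 * z ^ 9 + z ^ 9 * z"
    by (simp add: eval_nat_numeral algebra_simps)
  thus "cub3 ^ 2 = cub1 + 2" unfolding c 9 by simp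
  have "(z + z ^ 8) * (z ^ 2 + z ^ 7) = z ^ 3 + z ^ 8 + z ^ 9 * z + z ^ 9 * z ^ 6"
    by (simp add: eval_nat_numeral algebra_simps)
  thus "cub1 * cub2 = cub1 - 1" unfolding c 9 6 by simp
qed

lemma cub_cyc: "cub1 \<in> cyc 2" "cub2 \<in> cyc 2" "cub3 \<in> cyc 2"
  unfolding cub1_def cub2_def cub3_def by (intro cyc.plus cyc_power zeta_mem)+

lemma cub_Reals: "cub1 \<in> \<real>" "cub2 \<in> \<real>" "cub3 \<in> \<real>"
proof -
  have cnj: "cnj (zeta 2) = zeta 2 ^ 8"
  proof -
    have "cnj (zeta 2) * zeta 2 = 1" by (simp add: zeta_def cis_mult cis_cnj)
    moreover have "zeta 2 ^ 8 * zeta 2 = 1" using zeta_2(1) by (simp flip: power_Suc2)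
    ultimately show ?thesis by (metis mult_cancel_right mult_zero_right zero_neq_one)
  qed
  have p: "zeta 2 ^ (9 * k + r) = zeta 2 ^ r" for k r using zeta_2(1) by (simp add: power_add power_mult)
  show "cub1 \<in> \<real>" "cub2 \<in> \<real>" "cub3 \<in> \<real>"
    unfolding cub1_def cub2_def cub3_def Reals_cnj_iff complex_cnj_add complex_cnj_power cnj
    using p[of 7 1] p[of 1 7] p[of 6 2] p[of 3 5] p[of 4 4]
    by (simp_all flip: power_mult)
qed

lemma cub3_eq: "cub3 = - cub1 - cub2"
  using cub_relations(1) by (simp add: algebra_simps eq_neg_iff_add_eq_0)

text \<open>Oriented as rewrite rules to the basis \<open>1, cub1, cub2\<close>; the variants with
  \<open>x\<close> catch right-nested products.\<close>

lemma cub_reduce: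
  "cub1 * cub1 = cub2 + 2" "cub1 * cub2 = cub1 - 1" "cub2 * cub2 = 2 - cub1 - cub2"
  "cub1 * (cub1 * x) = (cub2 + 2) * x" "cub1 * (cub2 * x) = (cub1 - 1) * x"
  "cub2 * (cub2 * x) = (2 - cub1 - cub2) * x"
proof -
  show *: "cub1 * cub1 = cub2 + 2" "cub1 * cub2 = cub1 - 1" "cub2 * cub2 = 2 - cub1 - cub2"
    using cub_relations(2,3,5) by (simp_all add: power2_eq_square cub3_eq)
  show "cub1 * (cub1 * x) = (cub2 + 2) * x" "cub1 * (cub2 * x) = (cub1 - 1) * x"
    "cub2 * (cub2 * x) = (2 - cub1 - cub2) * x"
    by (simp_all only: * flip: mult.assoc)
qed

text \<open>The modulus is \<open>3 \<cdot> 7\<^sup>2 \<cdot> 37\<^sup>2\<close>.  The class of \<open>n\<close> modulo \<open>3\<close> makes \<open>e\<close> a \<open>3\<close>-adic unit and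
  \<open>u - v\<close> of valuation \<open>2/3\<close>; modulo \<open>7\<^sup>2\<close> it gives the order-seven curve additive reduction at
  \<open>7\<close>; modulo \<open>37\<^sup>2\<close> it makes \<open>37\<close> divide \<open>e\<close> exactly once, so that \<open>e\<close> is not a cube.\<close>

locale trace_zero_family =
  fixes n :: int
  assumes n: "n mod 201243 = 3"
begin

definition u where "u = cub1 + of_int n * cub2"
definition v where "v = cub2 + of_int n * cub3"
definition w where "w = cub3 + of_int n * cub1"
text \<open>With trace zero, \<open>e\<close> and \<open>e2\<close> are the remaining elementary
  symmetric functions of \<open>u\<close>, \<open>v\<close>, \<open>w\<close>, \<open>dl\<close> is
  a square root of the discriminant, and \<open>t\<close> is the cyclic sum of
  \<open>u ^ 2 * v\<close>, so that \<open>2 t = - 3 e - dl\<close>.\<close>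

definition e :: int where "e = 6 * n - 3 * n ^ 2 - n ^ 3 - 1"
definition e2 :: int where "e2 = 3 * n - 3 * n ^ 2 - 3"
definition dl :: int where "dl = 27 * n ^ 2 - 9 * n ^ 3 - 9"
definition t :: int where "t = 6 * n ^ 3 - 9 * n ^ 2 - 9 * n + 6"

lemma sum0: "u + v + w = 0"
proof -
  have "u + v + w = (1 + of_int n) * (cub1 + cub2 + cub3)" by (simp add: u_def v_def w_def algebra_simps)
  thus ?thesis using cub_relations(1) by simp
qed

lemma w_eq: "w = - u - v" using sum0 by (simp add: algebra_simps eq_neg_iff_add_eq_0)

lemma prod: "u * v * w = of_int e"
  unfolding u_def v_def w_def e_def of_int_diff of_int_mult of_int_power of_int_numeral of_int_1 cub3_eq
  by (simp add: power2_eq_square power3_eq_cube algebra_simps cub_reduce)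

lemma sym2: "u * v + v * w + w * u = of_int e2"
  unfolding u_def v_def w_def e2_def of_int_diff of_int_mult of_int_power of_int_numeral of_int_1 cub3_eq
  by (simp add: power2_eq_square power3_eq_cube algebra_simps cub_reduce)

lemma diffs: "(u - v) * (v - w) * (w - u) = of_int dl"
  unfolding u_def v_def w_def dl_def of_int_diff of_int_mult of_int_power of_int_numeral of_int_1 cub3_eq
  by (simp add: power2_eq_square power3_eq_cube algebra_simps cub_reduce)

lemma cyclic: "u ^ 2 * v + v ^ 2 * w + w ^ 2 * u = of_int t"
  unfolding u_def v_def w_def t_def of_int_diff of_int_add of_int_mult of_int_power of_int_numeral of_int_1 cub3_eq
  by (simp add: power2_eq_square power3_eq_cube algebra_simps cub_reduce)

end

section \<open>Curves with a point of order nine\<close>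

lemma (in monoid) nat_pow_swap: "x \<in> carrier G \<Longrightarrow> (x [^] (m::nat)) [^] (n::nat) = (x [^] n) [^] m"
  by (simp add: nat_pow_pow mult.commute)

text \<open>By induction \<open>3 T = j P\<close>. If 3 divides \<open>j\<close>, subtracting a
  multiple of \<open>P\<close> leaves a point killed by 3; otherwise inverting \<open>j\<close>
  modulo 9 would divide \<open>P\<close> itself by 3.\<close>

lemma (in comm_group) three_power_generated:
  assumes P: "P \<in> carrier G" "P [^] (9::nat) = \<one>"
    and not_div: "\<And>Q. Q \<in> carrier G \<Longrightarrow> Q [^] (3::nat) \<noteq> P"
    and three: "\<And>S. S \<in> carrier G \<Longrightarrow> S [^] (3::nat) = \<one> \<Longrightarrow> \<exists>l::nat. S = P [^] l"
    and T: "T \<in> carrier G" "T [^] (3 ^ k :: nat) = \<one>"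
  shows "\<exists>j::nat. T = P [^] j"
  using T
proof (induction k arbitrary: T)
  case 0
  thus ?case by (intro exI[of _ 0]) simp
next
  case (Suc k)
  have "(T [^] (3::nat)) [^] (3 ^ k :: nat) = \<one>"
    using Suc by (simp add: nat_pow_pow)
  then obtain j :: nat where j: "T [^] (3::nat) = P [^] j" using Suc by blast
  show ?case
  proof (cases "3 dvd j")
    case True
    then obtain i where i: "j = i * 3" by (metis dvdE mult.commute)
    define S where "S = T \<otimes> inv (P [^] i)"
    have S: "S \<in> carrier G" using Suc P by (simp add: S_def)
    have "S [^] (3::nat) = T [^] (3::nat) \<otimes> inv ((P [^] i) [^] (3::nat))"
      unfolding S_def using Suc P by (simp add: nat_pow_distrib nat_pow_inv)
    also have "\<dots> = \<one>" unfolding j i using P by (simp add: nat_pow_pow)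
    finally obtain l :: nat where l: "S = P [^] l" using three[OF S] by blast
    have "T = S \<otimes> P [^] i" unfolding S_def using Suc P by (simp add: m_assoc)
    thus ?thesis unfolding l using P by (auto simp: nat_pow_mult)
  next
    case False
    hence "coprime 3 j" by (intro prime_imp_coprime_nat) simp_all
    hence "coprime j (3 ^ 2)" by (metis coprime_commute coprime_power_right_iff)
    then obtain i where i: "[j * i = 1] (mod 9)" using cong_solve_coprime_nat[of j 9] by auto
    have "(T [^] i) [^] (3::nat) = (T [^] (3::nat)) [^] i" by (rule nat_pow_swap[OF Suc(2)])
    also have "\<dots> = P [^] (j * i)" unfolding j using P by (simp add: nat_pow_pow)
    also have "\<dots> = P [^] (j * i mod 9)" by (rule nat_pow_mod[OF P, symmetric])
    also have "\<dots> = P" using i P by (simp add: cong_def)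
    finally show ?thesis using not_div[of "T [^] i"] Suc by simp
  qed
qed

lemma Q_infinity_3_Kcyc: "x \<in> Q_infinity_3 \<Longrightarrow> x \<in> Kcyc" and Q_infinity_3_Reals: "x \<in> Q_infinity_3 \<Longrightarrow> x \<in> \<real>"
  by (simp_all add: Q_infinity_3_eq)

context cubic_over_subfield
begin

lemma three_power_Origin:
  assumes T: "T \<in> carrier \<E>" "T [^]\<^bsub>\<E>\<^esub> (3 ^ k :: nat) = Origin"
    and no3: "\<And>T. T \<in> carrier \<E> \<Longrightarrow> T \<boxplus> (T \<boxplus> T) = Origin \<Longrightarrow> T = Origin"
  shows "T = Origin"
  using T(2)
proof (induction k)
  case 0 thus ?case using T by simp
next
  case (Suc k)
  have S: "T [^]\<^bsub>\<E>\<^esub> (3 ^ k :: nat) \<in> carrier \<E>" using T by simp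
  have "T [^]\<^bsub>\<E>\<^esub> (3 ^ Suc k :: nat) = (T [^]\<^bsub>\<E>\<^esub> (3 ^ k :: nat)) [^]\<^bsub>\<E>\<^esub> (3::nat)"
    using T by (simp add: points.nat_pow_pow mult.commute)
  also have "\<dots> = T [^]\<^bsub>\<E>\<^esub> (3 ^ k :: nat) \<boxplus> (T [^]\<^bsub>\<E>\<^esub> (3 ^ k :: nat) \<boxplus> T [^]\<^bsub>\<E>\<^esub> (3 ^ k :: nat))"
    using S points.m_assoc[OF S S S] by (simp add: numeral_3_eq_3 mult_points one_points)
  finally show ?case using Suc no3[OF S] by simp
qed

lemma pow_2: "T [^]\<^bsub>\<E>\<^esub> (2::nat) = T \<boxplus> T"
  by (simp add: numeral_2_eq_2 mult_points one_points)

lemma pow_3: "T \<in> carrier \<E> \<Longrightarrow> T [^]\<^bsub>\<E>\<^esub> (3::nat) = T \<boxplus> (T \<boxplus> T)"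
  using points.m_assoc[of T T T] by (simp add: numeral_3_eq_3 mult_points one_points)

text \<open>The condition for \<open>2T = -T\<close>: vanishing of the third division polynomial.\<close>

lemma three_torsion:
  assumes T: "Affine x y \<in> carrier \<E>" "Affine x y \<boxplus> (Affine x y \<boxplus> Affine x y) = Origin"
  shows "y \<noteq> 0 \<and> (3 * x ^ 2 + 2 * a * x + b) ^ 2 = 4 * y ^ 2 * (3 * x + a)"
proof -
  have on: "on (Affine x y)" using T carrier_on by blast
  have y: "y \<noteq> 0" using T(2) by auto
  have "(3 * x ^ 2 + 2 * a * x + b) ^ 2 / (4 * y ^ 2) - (3 * x + a) = 0"
  proof (rule ccontr)
    assume "\<not> ?thesis"
    from triple_diff(2)[OF on y this] T(2) show False by auto
  qed
  thus ?thesis using y by (simp add: divide_eq_eq)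
qed

end

text \<open>With \<open>x = 4 X\<close> and \<open>y = 8 Y + 4 t X + 4 e\<^sup>3\<close> this is the curve \<open>Y\<^sup>2 + t X Y + e\<^sup>3 Y = X\<^sup>3\<close>.\<close>

locale nine_torsion_curve =
  cubic_over_Kcyc "of_int t ^ 2" "8 * of_int t * of_int e ^ 3" "16 * of_int e ^ 6" Q_infinity_3
  for t e :: int +
  fixes u v w :: complex and s :: int and ell :: nat
  assumes sum0: "w = - u - v"
    and prod: "u * v * w = of_int e"
    and cyclic: "u ^ 2 * v + v ^ 2 * w + w ^ 2 * u = of_int t"
    and uv_mem: "u \<in> Q_infinity_3" "v \<in> Q_infinity_3"
    and val_v: "veq 0 v" and val_diff: "veq (2 / 3) (u - v)"
    and t3: "3 dvd t" and e3: "\<not> 3 dvd e" and s: "t - 3 * e = 9 * s" "\<not> 3 dvd s"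
    and t2: "even t" and e2: "odd e"
    and ell: "Factorial_Ring.prime ell" "ell \<noteq> 3" "int ell dvd e" "\<not> int ell ^ 2 dvd e"
begin

notation points ("\<E>")
notation add (infixl "\<boxplus>" 65)

abbreviation "te \<equiv> complex_of_int t"
abbreviation "ee \<equiv> complex_of_int e"

lemma on_iff: "on (Affine x y) \<longleftrightarrow> y ^ 2 = x ^ 3 + (te * x + 4 * ee ^ 3) ^ 2"
  unfolding on.simps by (simp add: eval_nat_numeral algebra_simps)

lemma carrier_iff: "Affine x y \<in> carrier \<E> \<longleftrightarrow>
    x \<in> Q_infinity_3 \<and> y \<in> Q_infinity_3 \<and> y ^ 2 = x ^ 3 + (te * x + 4 * ee ^ 3) ^ 2"
  unfolding carrier_Affine on_iff by (rule refl)

lemma e_nonzero: "ee \<noteq> 0" using e3 by auto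

text \<open>In the coordinates \<open>(X, Y)\<close> these are \<open>(- e u v^2, e^2 v^3)\<close>,
  its double \<open>(- e u^2 w, e u^3 w^3)\<close> and its triple \<open>(0, 0)\<close>, which is
  rational.\<close>

definition P where "P = Affine (- 4 * ee * u * v ^ 2) (8 * ee ^ 2 * v ^ 3 + te * (- 4 * ee * u * v ^ 2) + 4 * ee ^ 3)"
definition P2 where "P2 = Affine (- 4 * ee * u ^ 2 * w) (8 * ee * u ^ 3 * w ^ 3 + te * (- 4 * ee * u ^ 2 * w) + 4 * ee ^ 3)"
definition P3 where "P3 = Affine 0 (4 * ee ^ 3)"

lemma uvw_nonzero: "u \<noteq> 0" "v \<noteq> 0" "w \<noteq> 0" using prod e_nonzero by auto

lemma te_eq: "te = u ^ 3 + 3 * u ^ 2 * v - v ^ 3"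
  unfolding cyclic[symmetric] sum0 by (simp add: power2_eq_square power3_eq_cube algebra_simps)

lemma ee_eq: "ee = - (u ^ 2 * v + u * v ^ 2)"
  unfolding prod[symmetric] sum0 by (simp add: power2_eq_square algebra_simps)

lemma w_mem: "w \<in> Q_infinity_3" unfolding sum0 by (intro mem_intros uv_mem)

lemma te_mem: "te \<in> Q_infinity_3" unfolding te_eq by (intro mem_intros uv_mem)
lemma ee_mem: "ee \<in> Q_infinity_3" unfolding prod[symmetric] by (intro mem_intros uv_mem w_mem)

lemma P_carrier: "P \<in> carrier \<E>"
proof -
  have "(8 * ee ^ 2 * v ^ 3 + te * (- 4 * ee * u * v ^ 2) + 4 * ee ^ 3) ^ 2
     - ((- 4 * ee * u * v ^ 2) ^ 3 + (te * (- 4 * ee * u * v ^ 2) + 4 * ee ^ 3) ^ 2)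
     = 64 * ee ^ 3 * v ^ 3 * (ee * v ^ 3 - te * u * v ^ 2 + ee ^ 2 + u ^ 3 * v ^ 3)"
    by (simp add: power2_eq_square power3_eq_cube algebra_simps)
  also have "ee * v ^ 3 - te * u * v ^ 2 + ee ^ 2 + u ^ 3 * v ^ 3 = 0"
    unfolding te_eq ee_eq by (simp add: eval_nat_numeral algebra_simps)
  finally have "(8 * ee ^ 2 * v ^ 3 + te * (- 4 * ee * u * v ^ 2) + 4 * ee ^ 3) ^ 2
     = (- 4 * ee * u * v ^ 2) ^ 3 + (te * (- 4 * ee * u * v ^ 2) + 4 * ee ^ 3) ^ 2" by simp
  thus ?thesis unfolding P_def carrier_iff
    by (intro conjI mem_intros uv_mem te_mem ee_mem)
qed

text \<open>At \<open>2\<close> the curve has good supersingular reduction: the abscissa of a point of order two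
  would generate a ramified extension.\<close>

lemma no_two_torsion: "Affine x 0 \<notin> carrier \<E>"
proof
  assume T: "Affine x 0 \<in> carrier \<E>"
  obtain t' where t': "t = 2 * t'" using t2 by blast
  have two: "Factorial_Ring.prime (2::nat)" by simp
  note li = localized_intros[OF two]
  have x: "x \<in> Kcyc" using T Q_infinity_3_Kcyc by (simp only: carrier_iff)
  have eq: "x ^ 3 = - ((te * x + 4 * ee ^ 3) ^ 2)" using T by (simp add: carrier_iff eq_neg_iff_add_eq_0)
  define A where "A i = (if i = 0 then - 16 * ee ^ 6 else if i = 1 then - 8 * te * ee ^ 3 else - (te ^ 2))" for i :: nat
  have "x ^ 3 = (\<Sum>i<3. A i * x ^ i)"
    unfolding eq A_def by (simp add: eval_nat_numeral algebra_simps)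
  moreover have "A i \<in> localized 2" for i unfolding A_def by (auto intro!: li)
  ultimately have xl: "x \<in> localized 2"
    using localized_integrally_closed[OF two _ x, of 3 A] by simp
  have up: "\<exists>w\<in>localized 2. z = 2 * w" if "z \<in> localized 2" "z ^ k = 2 * y" "y \<in> localized 2" "k > 0" for z y and k :: nat
    using localized_unramified[OF two _ that(1,3,4)] that(2) by simp
  \<comment> \<open>Each pass extracts a factor 2, first from \<open>x\<close>, then from
    \<open>y\<close>, until \<open>te * z + ee ^ 3\<close> is divisible by 2; as \<open>t\<close> is
    even, so is \<open>e ^ 3\<close>.\<close>
  have "x ^ 3 = 2 * (- 2 * (of_int t' * x + 2 * ee ^ 3) ^ 2)"
    unfolding eq t' by (simp add: power2_eq_square algebra_simps)
  then obtain y where y: "y \<in> localized 2" "x = 2 * y"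
    using up[OF xl, of 3 "- 2 * (of_int t' * x + 2 * ee ^ 3) ^ 2"] xl by (auto intro!: li)
  have "8 * y ^ 3 = 8 * (2 * (- ((of_int t' * y + ee ^ 3) ^ 2)))"
    using eq unfolding t' y(2) by (simp add: power2_eq_square power3_eq_cube algebra_simps)
  hence "y ^ 3 = 2 * (- ((of_int t' * y + ee ^ 3) ^ 2))" by simp
  moreover from this obtain z where z: "z \<in> localized 2" "y = 2 * z"
    using up[OF y(1), of 3 "- ((of_int t' * y + ee ^ 3) ^ 2)"] y by (auto intro!: li)
  ultimately have "(of_int t' * y + ee ^ 3) ^ 2 = - (y ^ 3) / 2" by simp
  also have "of_int t' * y = te * z" by (simp add: t' z(2))
  also have "- (y ^ 3) / 2 = 2 * (- 2 * z ^ 3)" by (simp add: z(2) power3_eq_cube)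
  finally have "(te * z + ee ^ 3) ^ 2 = 2 * (- 2 * z ^ 3)" .
  then obtain r where r: "r \<in> localized 2" "te * z + ee ^ 3 = 2 * r"
    using up[of "te * z + ee ^ 3" 2 "- 2 * z ^ 3"] z by (auto intro!: li)
  have "of_int (e ^ 3) = of_nat 2 * (r - of_int t' * z)"
    using r(2) unfolding t' by (simp add: algebra_simps)
  hence "int 2 dvd e ^ 3" by (rule localized_int_dvd[OF two]) (intro li r z)
  thus False using e2 by simp
qed

lemma y_nonzero: "Affine x y \<in> carrier \<E> \<Longrightarrow> y \<noteq> 0"
  using no_two_torsion by blast

lemma double_nonzero: assumes "T \<in> carrier \<E>" "T \<boxplus> T = Origin" shows "T = Origin"
proof (cases T)
  case (Affine x y)
  have "y = - y" using assms(2) unfolding add_eq_Origin Affine by simp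
  hence "y = 0" by simp
  thus ?thesis using assms Affine no_two_torsion by simp
qed

lemma add_points:
  assumes "Affine x1 y1 \<in> carrier \<E>" "Affine x2 y2 \<in> carrier \<E>" "\<not> (x1 = x2 \<and> y1 + y2 = 0)"
    "slope x1 y1 x2 y2 l" "x3 = l ^ 2 - te ^ 2 - x1 - x2" "y3 = - (l * (x3 - x1) + y1)"
  shows "Affine x1 y1 \<boxplus> Affine x2 y2 = Affine x3 y3"
proof -
  have "y3 = - (l * (l ^ 2 - te ^ 2 - x1 - x2) + (y1 - l * x1))"
    unfolding assms(6) assms(5) by (simp add: algebra_simps)
  thus ?thesis using add_slope[OF carrier_on[OF assms(1)] carrier_on[OF assms(2)] assms(3,4)] assms(5) by simp
qed

lemma double_P: "P \<boxplus> P = P2"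
proof -
  \<comment> \<open>A slope \<open>k\<close> in the coordinates \<open>(X, Y)\<close> becomes
    \<open>2 k + t\<close> here; the tangent at \<open>P\<close> has
    \<open>k = v w (u - v)\<close>.\<close>
  define l where "l = 2 * v * w * (u - v) + te"
  define x y where "x = - 4 * ee * u * v ^ 2" and "y = 8 * ee ^ 2 * v ^ 3 + te * x + 4 * ee ^ 3"
  have c: "Affine x y \<in> carrier \<E>" using P_carrier by (simp only: P_def x_def y_def)
  have ne: "\<not> (x = x \<and> y + y = 0)" using y_nonzero[OF c] by (simp flip: mult_2)
  have "l * (y + y) = x ^ 2 + x * x + x ^ 2 + te ^ 2 * (x + x) + 8 * te * ee ^ 3"
    unfolding l_def y_def x_def te_eq ee_eq sum0 by (simp add: eval_nat_numeral algebra_simps)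
  hence sl: "slope x y x y l" by (simp add: slope_def)
  have x2: "- 4 * ee * u ^ 2 * w = l ^ 2 - te ^ 2 - x - x"
    unfolding l_def x_def te_eq ee_eq sum0 by (simp add: eval_nat_numeral algebra_simps)
  have y2: "8 * ee * u ^ 3 * w ^ 3 + te * (- 4 * ee * u ^ 2 * w) + 4 * ee ^ 3
      = - (l * (- 4 * ee * u ^ 2 * w - x) + y)"
    unfolding l_def y_def x_def te_eq ee_eq sum0 by (simp add: eval_nat_numeral algebra_simps)
  show ?thesis unfolding P_def P2_def x_def[symmetric] y_def[symmetric]
    by (rule add_points[OF c c ne sl x2 y2])
qed

lemma P2_carrier: "P2 \<in> carrier \<E>" using add_mem[OF P_carrier P_carrier] by (simp only: double_P)

lemma val_u: "veq 0 u"
proof -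
  have "veq 0 (v + (u - v))" by (rule veq_add[OF val_v veq_vgt[OF val_diff]]) simp
  thus ?thesis by simp
qed

lemma val_w: "veq 0 w"
proof -
  have "veq 0 (- (2 * v) - (u - v))"
    using veq_mult[OF veq_of_int[of 2] val_v] veq_vgt[OF val_diff, of 0]
    by (intro veq_minus) (simp_all add: veq_uminus)
  also have "- (2 * v) - (u - v) = w" by (simp add: sum0)
  finally show ?thesis .
qed

lemma triple_P: "P \<boxplus> P2 = P3"
proof -
  define l where "l = 2 * (v ^ 3 - 2 * u ^ 2 * v - u ^ 3) + te"
  define x y x2 y2 where "x = - 4 * ee * u * v ^ 2" and "y = 8 * ee ^ 2 * v ^ 3 + te * x + 4 * ee ^ 3"
    and "x2 = - 4 * ee * u ^ 2 * w" and "y2 = 8 * ee * u ^ 3 * w ^ 3 + te * x2 + 4 * ee ^ 3"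
  have c: "Affine x y \<in> carrier \<E>" "Affine x2 y2 \<in> carrier \<E>"
    using P_carrier P2_carrier by (simp_all only: P_def P2_def x_def y_def x2_def y2_def)
  have 1: "l * (x2 - x) = y2 - y"
    unfolding l_def y_def x_def y2_def x2_def te_eq ee_eq sum0 by (simp add: eval_nat_numeral algebra_simps)
  \<comment> \<open>\<open>P\<close> and \<open>2 P\<close> have distinct abscissae: otherwise
    \<open>(u - v) ^ 2 = - 3 u v\<close>, with valuation \<open>4 / 3\<close> on the left and 1 on
    the right.\<close>
  have "u * w \<noteq> v ^ 2"
  proof
    assume "u * w = v ^ 2"
    moreover have "u ^ 2 + u * v + v ^ 2 = v ^ 2 - u * w" unfolding sum0 by (simp add: power2_eq_square algebra_simps)
    ultimately have "u ^ 2 + u * v + v ^ 2 = 0" by simp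
    hence uv: "(u - v) ^ 2 + 3 * (u * v) = 0" by (simp add: power2_eq_square algebra_simps)
    have "veq (1 + (0 + 0)) (3 * (u * v))" by (intro veq_mult veq_3 val_u val_v)
    moreover have "vgt 1 ((u - v) ^ 2)" using veq_vgt[OF veq_power[OF val_diff, of 2], of 1] by simp
    ultimately have "veq 1 (3 * (u * v) + (u - v) ^ 2)" by (intro veq_add) auto
    thus False using uv veq_nonzero by (simp add: add.commute)
  qed
  hence xne: "x \<noteq> x2" using e_nonzero uvw_nonzero by (auto simp: x_def x2_def power2_eq_square mult_ac)
  then obtain l' where l': "slope x y x2 y2 l'"
    using slope_exists[OF carrier_on[OF c(1)] carrier_on[OF c(2)]] by auto
  hence "l' * (x2 - x) = l * (x2 - x)" using 1 by (simp add: slope_def)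
  hence sl: "slope x y x2 y2 l" using xne l' by simp
  have x3: "0 = l ^ 2 - te ^ 2 - x - x2"
    unfolding l_def x_def x2_def te_eq ee_eq sum0 by (simp add: eval_nat_numeral algebra_simps)
  have y3: "4 * ee ^ 3 = - (l * (0 - x) + y)"
    unfolding l_def y_def x_def te_eq ee_eq sum0 by (simp add: eval_nat_numeral algebra_simps)
  show ?thesis unfolding P_def P2_def P3_def x_def[symmetric] y_def[symmetric] x2_def[symmetric] y2_def[symmetric]
    by (rule add_points[OF c _ sl x3 y3]) (use xne in simp)
qed

lemma P3_carrier: "P3 \<in> carrier \<E>" using add_mem[OF P_carrier P2_carrier] by (simp only: triple_P)

text \<open>\<open>P3\<close> is a flex: its tangent is \<open>Y = 0\<close>, of slope
  \<open>t\<close> in these coordinates.\<close>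

lemma double_P3: "P3 \<boxplus> P3 = ec_neg P3"
proof -
  have c: "Affine 0 (4 * ee ^ 3) \<in> carrier \<E>" using P3_carrier by (simp only: P3_def)
  show ?thesis unfolding P3_def ec_neg.simps
    by (rule add_points[OF c c, of te]) (use y_nonzero[OF c] in \<open>simp_all add: slope_def\<close>)
qed

lemma x_zero: assumes "Affine 0 y \<in> carrier \<E>" shows "Affine 0 y = P3 \<or> Affine 0 y = ec_neg P3"
proof -
  have "y ^ 2 = (4 * ee ^ 3) ^ 2" using assms by (simp add: carrier_iff)
  hence "y = 4 * ee ^ 3 \<or> y = - (4 * ee ^ 3)" by (simp only: power2_eq_iff)
  thus ?thesis unfolding P3_def by auto
qed

lemma pow3_P: "P [^]\<^bsub>\<E>\<^esub> (3::nat) = P3"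
  using P_carrier by (simp add: pow_3 double_P triple_P)

lemma pow9_P: "P [^]\<^bsub>\<E>\<^esub> (9::nat) = Origin"
proof -
  have "P [^]\<^bsub>\<E>\<^esub> (9::nat) = (P [^]\<^bsub>\<E>\<^esub> (3::nat)) [^]\<^bsub>\<E>\<^esub> (3::nat)"
    using P_carrier by (simp add: points.nat_pow_pow)
  thus ?thesis using P3_carrier by (simp add: pow3_P pow_3 double_P3)
qed

lemma order_P: assumes "0 < k" "k < 9" shows "P [^]\<^bsub>\<E>\<^esub> (k::nat) \<noteq> Origin"
proof
  assume "P [^]\<^bsub>\<E>\<^esub> k = Origin"
  hence "points.ord P dvd k" using P_carrier points.pow_eq_id one_points by metis
  moreover have "points.ord P dvd 3 ^ 2" using P_carrier pow9_P points.pow_eq_id[of P 9] by (simp add: one_points)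
  then obtain i where i: "points.ord P = 3 ^ i" "i \<le> 2"
    using divides_primepow_nat[of 3 "points.ord P" 2] by auto
  moreover have "\<not> points.ord P dvd 3"
  proof
    assume "points.ord P dvd 3"
    hence "P [^]\<^bsub>\<E>\<^esub> (3::nat) = Origin" using P_carrier points.pow_eq_id[of P 3] one_points by simp
    thus False by (simp add: pow3_P P3_def)
  qed
  hence "i \<noteq> 0" "i \<noteq> 1" unfolding i(1) by (metis one_dvd power_0, metis dvd_refl power_one_right)
  hence "points.ord P = 9" using i by (cases "i = 2") auto
  ultimately show False using assms by (auto dest: dvd_imp_le)
qed

text \<open>Complex conjugation forces the three-torsion over a real field to be cyclic.\<close>

lemma three_torsion_real:
  assumes T: "T \<in> carrier \<E>" "T \<boxplus> (T \<boxplus> T) = Origin"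
  shows "T = Origin \<or> T = P3 \<or> T = ec_neg P3"
proof (cases T)
  case (Affine x y)
  note c = T(1)[unfolded Affine carrier_iff]
  have y: "y \<noteq> 0" and psi: "(3 * x ^ 2 + 2 * te ^ 2 * x + 8 * te * ee ^ 3) ^ 2 = 4 * y ^ 2 * (3 * x + te ^ 2)"
    using three_torsion[of x y] T Affine by auto
  have "x = 0"
  proof (rule ccontr)
    assume x: "x \<noteq> 0"
    have "x * (3 * x ^ 3 + 4 * te ^ 2 * x ^ 2 + 48 * te * ee ^ 3 * x + 192 * ee ^ 6) = 0"
    proof -
      have "x * (3 * x ^ 3 + 4 * te ^ 2 * x ^ 2 + 48 * te * ee ^ 3 * x + 192 * ee ^ 6)
        = 4 * (x ^ 3 + (te * x + 4 * ee ^ 3) ^ 2) * (3 * x + te ^ 2)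
          - (3 * x ^ 2 + 2 * te ^ 2 * x + 8 * te * ee ^ 3) ^ 2"
        by (simp add: eval_nat_numeral algebra_simps)
      also have "\<dots> = 0" unfolding psi using c by simp
      finally show ?thesis .
    qed
    hence "3 * x ^ 3 + 4 * te ^ 2 * x ^ 2 + 48 * te * ee ^ 3 * x + 192 * ee ^ 6 = 0" using x by simp
    \<comment> \<open>On the curve the remaining cubic factor of the division polynomial is
      \<open>3 y ^ 2\<close> plus a square, so over a real field it forces
      \<open>y = 0\<close>.\<close>
    hence eq: "3 * y ^ 2 + (te * x + 12 * ee ^ 3) ^ 2 = 0"
      using c by (simp add: eval_nat_numeral algebra_simps)
    obtain r q where rq: "x = of_real r" "y = of_real q" using c Q_infinity_3_Reals by (metis Reals_cases)
    have "of_real (3 * q ^ 2 + (of_int t * r + 12 * of_int e ^ 3) ^ 2) = (of_real 0 :: complex)"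
      using eq unfolding rq by simp
    hence "3 * q ^ 2 + (of_int t * r + 12 * of_int e ^ 3) ^ 2 = 0" by (simp only: of_real_eq_iff)
    hence "q ^ 2 \<le> 0" using zero_le_power2[of "of_int t * r + 12 * of_int e ^ 3"] by linarith
    thus False using y rq by simp
  qed
  thus ?thesis using T Affine x_zero by simp
qed simp

subsection \<open>Points of order 27\<close>

text \<open>Eight times the coordinate \<open>Y\<close>, that is, the flex tangent at
  \<open>P3\<close>.\<close>

definition kappa :: "complex \<Rightarrow> complex \<Rightarrow> complex" where
  "kappa x y = y - (te * x + 4 * ee ^ 3)"

text \<open>\<open>kappa\<close> has divisor \<open>3 (P3) - 3 (O)\<close>, so that it is a homomorphism to \<open>K\<^sup>*\<close> modulo cubes.\<close>

lemma kappa_line: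
  assumes c: "Affine x1 y1 \<in> carrier \<E>" "Affine x2 y2 \<in> carrier \<E>"
    and S: "Affine x1 y1 \<boxplus> Affine x2 y2 = Affine x3 y3"
  shows "\<exists>g\<in>Q_infinity_3. kappa x1 y1 * kappa x2 y2 * kappa x3 (- y3) = g ^ 3"
proof -
  note on = carrier_on[OF c(1)] carrier_on[OF c(2)]
  have ne: "\<not> (x1 = x2 \<and> y1 + y2 = 0)" using S by auto
  then obtain l where l: "slope x1 y1 x2 y2 l" using slope_exists[OF on] by blast
  define n where "n = y1 - l * x1"
  have x3: "l ^ 2 - te ^ 2 - x1 - x2 = x3" and y3: "- y3 = l * x3 + n"
    using S unfolding add_slope[OF on ne l] n_def by auto
  note lc = line_coeffs[OF on(1) l, folded n_def, unfolded x3]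
  define m where "m = n - 4 * ee ^ 3"
  have k: "kappa x1 y1 = (l - te) * x1 + m" "kappa x2 y2 = (l - te) * x2 + m" "kappa x3 (- y3) = (l - te) * x3 + m"
    unfolding kappa_def y3 lc(2,3) m_def by (simp_all add: algebra_simps)
  have s1: "x1 + x2 + x3 = l ^ 2 - te ^ 2" using lc(1) by (simp add: algebra_simps)
  have s2: "x1 * x2 + x1 * x3 + x2 * x3 = 8 * te * ee ^ 3 - 2 * l * n" using lc(4) by (simp add: algebra_simps)
  have s3: "x1 * x2 * x3 = n ^ 2 - 16 * ee ^ 6" using lc(5) by (simp add: algebra_simps)
  have "kappa x1 y1 * kappa x2 y2 * kappa x3 (- y3)
      = (l - te) ^ 3 * (x1 * x2 * x3) + (l - te) ^ 2 * m * (x1 * x2 + x1 * x3 + x2 * x3)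
        + (l - te) * m ^ 2 * (x1 + x2 + x3) + m ^ 3"
    unfolding k by (simp add: power2_eq_square power3_eq_cube algebra_simps)
  also have "\<dots> = m ^ 3" unfolding s1 s2 s3 m_def by (simp add: eval_nat_numeral algebra_simps)
  finally have eq: "kappa x1 y1 * kappa x2 y2 * kappa x3 (- y3) = m ^ 3" .
  have "l \<in> Q_infinity_3"
  proof (cases "x1 = x2")
    case True
    hence "y1 = y2" using eq_or_opposite[of x1 y1 y2] on ne by auto
    moreover have "l * (y1 + y2) = x1 ^ 2 + x1 * x2 + x2 ^ 2 + te ^ 2 * (x1 + x2) + 8 * te * ee ^ 3"
      using l unfolding slope_def by blast
    ultimately have "l * (2 * y1) = 3 * x1 ^ 2 + 2 * te ^ 2 * x1 + 8 * te * ee ^ 3"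
      using True by (simp add: power2_eq_square algebra_simps)
    hence "l = (3 * x1 ^ 2 + 2 * te ^ 2 * x1 + 8 * te * ee ^ 3) / (2 * y1)"
      using y_nonzero[OF c(1)] by (simp add: eq_divide_eq)
    thus ?thesis using c unfolding carrier_iff by (auto intro!: mem_intros te_mem ee_mem)
  next
    case False
    moreover have "l * (x2 - x1) = y2 - y1" using l unfolding slope_def by blast
    ultimately have "l = (y2 - y1) / (x2 - x1)" by (simp add: eq_divide_eq)
    thus ?thesis using c unfolding carrier_iff by (auto intro!: mem_intros)
  qed
  hence "m \<in> Q_infinity_3" using c unfolding m_def n_def carrier_iff by (auto intro!: mem_intros ee_mem)
  thus ?thesis using eq by blast
qed

lemma kappa_opposite: "Affine x y \<in> carrier \<E> \<Longrightarrow> kappa x y * kappa x (- y) = - (x ^ 3)"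
  unfolding carrier_iff kappa_def by (simp add: power2_eq_square algebra_simps)

text \<open>As \<open>ell\<close> is unramified, a cube root of \<open>e ^ 2\<close> would be
  divisible by \<open>ell\<close>, and then \<open>ell ^ 3\<close> would divide
  \<open>e ^ 2\<close>, although \<open>ell\<close> divides \<open>e\<close> only once.\<close>

lemma e_sq_not_cube: "z \<in> Kcyc \<Longrightarrow> ee ^ 2 \<noteq> z ^ 3"
proof
  assume z: "z \<in> Kcyc" and eq: "ee ^ 2 = z ^ 3"
  obtain e' where e': "e = int ell * e'" using ell by blast
  have ne: "\<not> int ell dvd e'" using ell e' by (auto simp: power2_eq_square)
  define A where "A i = (if i = 0 then ee ^ 2 else 0)" for i :: nat
  have "z ^ 3 = (\<Sum>i<3. A i * z ^ i)" unfolding eq[symmetric] A_def by (simp add: eval_nat_numeral)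
  moreover have "A i \<in> localized ell" for i
    unfolding A_def using localized_of_int[OF ell(1), of 0]
    by (auto intro!: localized_power[OF ell(1)] localized_of_int[OF ell(1)])
  ultimately have zl: "z \<in> localized ell"
    using localized_integrally_closed[OF ell(1,2) z, of 3 A] by simp
  have "z ^ 3 = of_nat ell * (of_int (e' * e))" unfolding eq[symmetric] e' by (simp add: power2_eq_square)
  then obtain r where r: "r \<in> localized ell" "z = of_nat ell * r"
    using localized_unramified[OF ell(1,2) zl localized_of_int[OF ell(1)], of 3 "e' * e"] by auto
  have p0: "of_nat ell \<noteq> (0::complex)" using ell(1) by auto
  have "of_nat ell ^ 2 * of_int (e' ^ 2) = of_nat ell ^ 2 * (of_nat ell * r ^ 3)"
    using eq unfolding r(2) e' by (simp add: power_mult_distrib eval_nat_numeral mult_ac)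
  hence "of_int (e' ^ 2) = of_nat ell * r ^ 3" using p0 by simp
  hence "int ell dvd e' ^ 2" by (rule localized_int_dvd[OF ell(1)]) (intro localized_power[OF ell(1)] r)
  thus False using ne ell(1) by (metis prime_dvd_power prime_nat_int_transfer)
qed

text \<open>If \<open>3 Q = P\<close>, apply \<open>kappa_line\<close> to \<open>Q + Q\<close> and
  to \<open>Q + 2 Q\<close>. By \<open>kappa_opposite\<close> the contributions of
  \<open>2 Q\<close> cancel modulo cubes, so the value \<open>8 e^2 v^3\<close> of
  \<open>kappa\<close> at \<open>P\<close> would be a cube.\<close>

lemma not_divisible: assumes Q: "Q \<in> carrier \<E>" shows "Q \<boxplus> (Q \<boxplus> Q) \<noteq> P"
proof
  assume QP: "Q \<boxplus> (Q \<boxplus> Q) = P"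
  have P3O: "P3 \<boxplus> (P3 \<boxplus> P3) = Origin" "ec_neg P3 \<boxplus> (ec_neg P3 \<boxplus> ec_neg P3) = Origin"
  proof -
    show 1: "P3 \<boxplus> (P3 \<boxplus> P3) = Origin" by (simp add: double_P3)
    have "ec_neg P3 \<boxplus> ec_neg P3 = P3" using neg_add[of P3 P3] carrier_on[OF P3_carrier] by (simp add: double_P3)
    thus "ec_neg P3 \<boxplus> (ec_neg P3 \<boxplus> ec_neg P3) = Origin" using add_neg[of "ec_neg P3"] by simp
  qed
  have PO: "P \<noteq> Origin" by (simp add: P_def)
  have "Q \<noteq> Origin" using QP PO by auto
  then obtain x y where Qxy: "Q = Affine x y" by (cases Q) auto
  have "Q \<boxplus> Q \<noteq> Origin" using double_nonzero[OF Q] \<open>Q \<noteq> Origin\<close> by blast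
  then obtain x2 y2 where Q2: "Q \<boxplus> Q = Affine x2 y2" by (cases "Q \<boxplus> Q") auto
  have c: "Affine x y \<in> carrier \<E>" "Affine x2 y2 \<in> carrier \<E>" using Q Qxy Q2 add_mem[OF Q Q] by auto
  obtain xp yp where Pxy: "P = Affine xp yp" "xp = - 4 * ee * u * v ^ 2" "kappa xp yp = 8 * ee ^ 2 * v ^ 3"
    by (simp add: P_def kappa_def)
  have xp: "xp \<noteq> 0" using Pxy(2) e_nonzero uvw_nonzero by simp
  \<comment> \<open>At abscissa 0 lie the points of order three, where \<open>kappa\<close> of the
    point or of its negative vanishes; they are excluded so that the identities modulo cubes can be
    divided.\<close>
  have x0: "x \<noteq> 0"
  proof
    assume "x = 0"
    hence "Q = P3 \<or> Q = ec_neg P3" using x_zero c(1) Qxy by simp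
    thus False using QP P3O PO by auto
  qed
  have x20: "x2 \<noteq> 0"
  proof
    assume "x2 = 0"
    hence "Q \<boxplus> Q = P3 \<or> Q \<boxplus> Q = ec_neg P3" using x_zero c(2) Q2 by simp
    hence "(Q [^]\<^bsub>\<E>\<^esub> (2::nat)) [^]\<^bsub>\<E>\<^esub> (3::nat) = Origin"
      using P3O P3_carrier neg_mem[OF P3_carrier] by (auto simp: pow_2 pow_3)
    hence "(Q [^]\<^bsub>\<E>\<^esub> (3::nat)) [^]\<^bsub>\<E>\<^esub> (2::nat) = Origin"
      using Q by (simp add: points.nat_pow_pow)
    hence "P \<boxplus> P = Origin" using Q QP by (simp add: pow_2 pow_3)
    thus False using double_nonzero[OF P_carrier] PO by blast
  qed
  obtain g where g: "g \<in> Q_infinity_3" "kappa x y * kappa x y * kappa x2 (- y2) = g ^ 3"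
    using kappa_line[OF c(1) c(1)] Q2 Qxy by blast
  obtain h where h: "h \<in> Q_infinity_3" "kappa x y * kappa x2 y2 * kappa xp (- yp) = h ^ 3"
    using kappa_line[OF c] QP Q2 Qxy Pxy by metis
  have P_opp: "kappa xp yp * kappa xp (- yp) = - (xp ^ 3)" using kappa_opposite P_carrier Pxy(1) by simp
  have kx: "kappa x y \<noteq> 0" using kappa_opposite[OF c(1)] x0 by auto
  have "(g * h) ^ 3 * kappa xp yp
      = kappa x y ^ 3 * (kappa x2 y2 * kappa x2 (- y2)) * (kappa xp yp * kappa xp (- yp))"
    unfolding power_mult_distrib g(2)[symmetric] h(2)[symmetric] by (simp add: power3_eq_cube mult_ac)
  also have "\<dots> = (kappa x y * x2 * xp) ^ 3"
    unfolding kappa_opposite[OF c(2)] P_opp by (simp add: power_mult_distrib)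
  finally have eq: "(2 * g * h * v) ^ 3 * ee ^ 2 = (kappa x y * x2 * xp) ^ 3"
    unfolding Pxy(3) by (simp add: power_mult_distrib mult_ac)
  hence nz: "2 * g * h * v \<noteq> 0" using kx x20 xp by auto
  have "ee ^ 2 = (kappa x y * x2 * xp / (2 * g * h * v)) ^ 3"
    unfolding power_divide eq[symmetric] using nz by simp
  moreover have "kappa x y * x2 * xp / (2 * g * h * v) \<in> Q_infinity_3"
    using c g h unfolding carrier_iff kappa_def Pxy(2)
    by (auto intro!: mem_intros ee_mem te_mem uv_mem)
  ultimately show False using e_sq_not_cube Q_infinity_3_Kcyc by blast
qed

subsection \<open>Torsion of order prime to three\<close>

text \<open>Over \<open>\<rat>\<^sub>3\<close> the curve has additive, potentially supersingular reduction; the coordinate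
  \<open>x + 4 e\<^sup>2\<close> is centred at the cusp.\<close>

lemma val_coeffs:
  "veq 1 (te ^ 2 - 12 * ee ^ 2)" "veq 2 (8 * ee ^ 2 * (3 * ee - te) * (2 * ee + te))"
  "veq 2 (16 * ee ^ 4 * (te + ee) * (te - 3 * ee))"
proof -
  obtain r where r: "t = 3 * r" using t3 by blast
  have e: "veq 0 ee" using veq_of_int[OF e3] .
  have n: "\<not> 3 dvd 3 * r ^ 2 - 4 * e ^ 2"
  proof
    assume "3 dvd 3 * r ^ 2 - 4 * e ^ 2"
    hence "3 dvd 4 * e ^ 2" by (metis dvd_diff_right_iff dvd_triv_left dvd_minus_iff minus_diff_eq)
    hence "3 dvd e ^ 2" by presburger
    thus False using e3 prime_dvd_power[of 3 e 2] by simp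
  qed
  show "veq 1 (te ^ 2 - 12 * ee ^ 2)"
    using veq_3_power[OF n, of 1] by (simp add: r power2_eq_square algebra_simps)
  have "3 ^ 2 * s = t - 3 * e" using s by simp
  hence "complex_of_int (3 ^ 2 * s) = of_int (t - 3 * e)" by (simp only:)
  hence d: "veq 2 (te - 3 * ee)" using veq_3_power[OF s(2), of 2] by simp
  hence d': "veq 2 (3 * ee - te)" using veq_uminus[of 2 "3 * ee - te"] by simp
  have "\<not> 3 dvd 2 * e + t" "\<not> 3 dvd t + e" using e3 r by presburger+
  hence f: "veq 0 (2 * ee + te)" "veq 0 (te + ee)" using veq_of_int[of "2 * e + t"] veq_of_int[of "t + e"] by simp_all
  have 8: "veq 0 8" "veq 0 16" using veq_of_int[of 8] veq_of_int[of 16] by simp_all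
  have "veq (0 + of_nat 2 * 0 + 2 + 0) (8 * ee ^ 2 * (3 * ee - te) * (2 * ee + te))"
    by (intro veq_mult veq_power e d' f 8)
  thus "veq 2 (8 * ee ^ 2 * (3 * ee - te) * (2 * ee + te))" by simp
  have "veq (0 + of_nat 4 * 0 + 0 + 2) (16 * ee ^ 4 * (te + ee) * (te - 3 * ee))"
    by (intro veq_mult veq_power e d f 8)
  thus "veq 2 (16 * ee ^ 4 * (te + ee) * (te - 3 * ee))" by simp
qed

lemma centred:
  assumes T: "Affine x y \<in> carrier \<E>" and z: "z = x + 4 * ee ^ 2"
  shows "y ^ 2 = z ^ 3 + ((te ^ 2 - 12 * ee ^ 2) * z ^ 2 + (8 * ee ^ 2 * (3 * ee - te) * (2 * ee + te) * z
      + 16 * ee ^ 4 * (te + ee) * (te - 3 * ee)))"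
    "3 * x + te ^ 2 = 3 * z + (te ^ 2 - 12 * ee ^ 2)"
    "3 * x ^ 2 + 2 * te ^ 2 * x + 8 * te * ee ^ 3
      = 3 * z ^ 2 + (2 * (te ^ 2 - 12 * ee ^ 2) * z + 8 * ee ^ 2 * (3 * ee - te) * (2 * ee + te))"
    "z \<in> Kcyc"
proof -
  have x: "x = z - 4 * ee ^ 2" using z by simp
  have "y ^ 2 = x ^ 3 + (te * x + 4 * ee ^ 3) ^ 2" using T by (simp add: carrier_iff)
  thus "y ^ 2 = z ^ 3 + ((te ^ 2 - 12 * ee ^ 2) * z ^ 2 + (8 * ee ^ 2 * (3 * ee - te) * (2 * ee + te) * z
      + 16 * ee ^ 4 * (te + ee) * (te - 3 * ee)))"
    unfolding x by (simp add: eval_nat_numeral algebra_simps)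
  show "3 * x + te ^ 2 = 3 * z + (te ^ 2 - 12 * ee ^ 2)"
    "3 * x ^ 2 + 2 * te ^ 2 * x + 8 * te * ee ^ 3
      = 3 * z ^ 2 + (2 * (te ^ 2 - 12 * ee ^ 2) * z + 8 * ee ^ 2 * (3 * ee - te) * (2 * ee + te))"
    unfolding x by (simp_all add: eval_nat_numeral algebra_simps)
  have "z \<in> Q_infinity_3" using T unfolding z carrier_iff by (auto intro!: mem_intros ee_mem)
  thus "z \<in> Kcyc" by (rule Q_infinity_3_Kcyc)
qed

text \<open>The centred cubic has coefficients of valuations 0, 1, 2, 2. Below \<open>2 / 3\<close>
  the cube dominates; at \<open>2 / 3\<close> it balances the constant term, and only their
  cancellation lets \<open>y ^ 2\<close> exceed valuation 2.\<close>

lemma region_cases: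
  assumes T: "Affine x y \<in> carrier \<E>" and z: "z = x + 4 * ee ^ 2" and q: "veq q (y ^ 2)"
  obtains p where "veq p z" "p < 2 / 3" "q = 3 * p" | "vge (2 / 3) z" "q \<ge> 2" "q > 2 \<Longrightarrow> veq (2 / 3) z"
proof -
  define g2 g1 g0 where g: "g2 = te ^ 2 - 12 * ee ^ 2" "g1 = 8 * ee ^ 2 * (3 * ee - te) * (2 * ee + te)"
    "g0 = 16 * ee ^ 4 * (te + ee) * (te - 3 * ee)"
  note ct = centred[OF T z, folded g] and vc = val_coeffs[folded g]
  show ?thesis
  proof (cases "vge (2 / 3) z")
    case False
    then obtain p where p: "veq p z" "p < 2 / 3" using not_vge[OF ct(4)] by blast
    have "veq (of_nat 3 * p) (z ^ 3 + (g2 * z ^ 2 + (g1 * z + g0)))"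
    proof (intro veq_add veq_power vgt_add p)
      show "vgt (of_nat 3 * p) (g2 * z ^ 2)"
        by (rule veq_vgt[OF veq_mult[OF vc(1) veq_power[OF p(1)]]]) (use p in simp)
      show "vgt (of_nat 3 * p) (g1 * z)"
        by (rule veq_vgt[OF veq_mult[OF vc(2) p(1)]]) (use p in simp)
      show "vgt (of_nat 3 * p) g0" by (rule veq_vgt[OF vc(3)]) (use p in simp)
    qed
    thus ?thesis using that(1)[OF p] q ct(1) veq_unique by fastforce
  next
    case True
    have s: "vgt 2 (g2 * z ^ 2)" "vgt 2 (g1 * z)"
      by (rule vge_vgt[OF vge_mult[OF veq_vge[OF vc(1) order_refl] vge_power[OF True]]], simp)
         (rule vge_vgt[OF vge_mult[OF veq_vge[OF vc(2) order_refl] True]], simp)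
    have "vge 2 (z ^ 3)" using vge_power[OF True, of 3] by simp
    hence "vge 2 (y ^ 2)" unfolding ct(1)
      by (intro vge_add vgt_vge[OF s(1) order_refl] vgt_vge[OF s(2) order_refl] veq_vge[OF vc(3) order_refl])
    hence q2: "q \<ge> 2" using vge_veqD q by blast
    have "veq (2 / 3) z" if "q > 2"
    proof (rule ccontr)
      assume "\<not> ?thesis"
      hence "vgt (2 / 3) z" using True by (auto simp: vge_def vgt_def veq_def)
      hence "z = 0 \<or> (\<exists>p>2/3. veq p z)" by (auto simp: vgt_def veq_def)
      hence "vgt 2 (z ^ 3)"
      proof
        assume "\<exists>p>2/3. veq p z"
        then obtain p where "p > 2 / 3" "veq p z" by blast
        thus ?thesis using veq_vgt[OF veq_power[of p z 3], of 2] by simp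
      qed (simp add: vgt_zero)
      hence "veq 2 (g0 + (z ^ 3 + (g2 * z ^ 2 + g1 * z)))"
        by (intro veq_add vc vgt_add s)
      also have "g0 + (z ^ 3 + (g2 * z ^ 2 + g1 * z)) = y ^ 2" unfolding ct(1) by simp
      finally show False using q veq_unique that by fastforce
    qed
    thus ?thesis using that(2)[OF True q2] by blast
  qed
qed

text \<open>The bound \<open>5 / 2\<close> is where \<open>2 q / 3\<close> reaches
  \<open>5 / 3\<close>, the least valuation that \<open>2 * g2 * z\<close> can have when
  \<open>z\<close> has valuation at least \<open>2 / 3\<close>; the other terms leave more
  room.\<close>

lemma region:
  assumes T: "Affine x y \<in> carrier \<E>" and q: "veq q (y ^ 2)" "q < 5 / 2"
  shows "vgt (2 * q / 3) (3 * x ^ 2 + 2 * te ^ 2 * x + 8 * te * ee ^ 3) \<and> vgt (q / 3) (3 * x + te ^ 2)"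
proof -
  define g2 g1 where g: "g2 = te ^ 2 - 12 * ee ^ 2" "g1 = 8 * ee ^ 2 * (3 * ee - te) * (2 * ee + te)"
  define z where "z = x + 4 * ee ^ 2"
  note ct = centred[OF T z_def, folded g] and vc = val_coeffs[folded g]
  have v2: "veq 0 2" using veq_of_int[of 2] by simp
  from T z_def q(1) have "vgt (2 * q / 3) (3 * z ^ 2 + (2 * g2 * z + g1)) \<and> vgt (q / 3) (3 * z + g2)"
  proof (cases rule: region_cases)
    case (1 p)
    have "vgt (q / 3) (3 * z)" by (rule veq_vgt[OF veq_mult[OF veq_3 1(1)]]) (use 1 in simp)
    moreover have "vgt (q / 3) g2" by (rule veq_vgt[OF vc(1)]) (use 1 in simp)
    moreover have "vgt (2 * q / 3) (3 * z ^ 2)"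
      by (rule veq_vgt[OF veq_mult[OF veq_3 veq_power[OF 1(1)]]]) (use 1 in simp)
    moreover have "vgt (2 * q / 3) (2 * g2 * z)"
      by (rule veq_vgt[OF veq_mult[OF veq_mult[OF v2 vc(1)] 1(1)]]) (use 1 in simp)
    moreover have "vgt (2 * q / 3) g1" by (rule veq_vgt[OF vc(2)]) (use 1 in simp)
    ultimately show ?thesis by (intro conjI vgt_add)
  next
    case 2
    have "vgt (q / 3) (3 * z)"
      by (rule vge_vgt[OF vge_mult[OF veq_vge[OF veq_3 order_refl] 2(1)]]) (use q in simp)
    moreover have "vgt (q / 3) g2" by (rule veq_vgt[OF vc(1)]) (use q in simp)
    moreover have "vgt (2 * q / 3) (3 * z ^ 2)"
      by (rule vge_vgt[OF vge_mult[OF veq_vge[OF veq_3 order_refl] vge_power[OF 2(1)]]]) (use q in simp)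
    moreover have "vgt (2 * q / 3) (2 * g2 * z)"
      by (rule vge_vgt[OF vge_mult[OF veq_vge[OF veq_mult[OF v2 vc(1)] order_refl] 2(1)]]) (use q in simp)
    moreover have "vgt (2 * q / 3) g1" by (rule veq_vgt[OF vc(2)]) (use q in simp)
    ultimately show ?thesis by (intro conjI vgt_add)
  qed
  thus ?thesis unfolding ct .
qed

text \<open>Now \<open>2 * g2 * z\<close> dominates the derivative. These are hypotheses of
  \<open>double_step\<close> with \<open>p = 5 / 3\<close>, whose output bound
  \<open>3 / 2 * p\<close> is the bound \<open>5 / 2\<close> of \<open>region\<close>.\<close>

lemma outside_region:
  assumes T: "Affine x y \<in> carrier \<E>" and q: "veq q (y ^ 2)" "q > 5 / 2"
  shows "veq (5 / 3) (3 * x ^ 2 + 2 * te ^ 2 * x + 8 * te * ee ^ 3) \<and> vgt (5 / 3 / 2) (3 * x + te ^ 2)"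
proof -
  define g2 g1 where g: "g2 = te ^ 2 - 12 * ee ^ 2" "g1 = 8 * ee ^ 2 * (3 * ee - te) * (2 * ee + te)"
  define z where "z = x + 4 * ee ^ 2"
  note ct = centred[OF T z_def, folded g] and vc = val_coeffs[folded g]
  have v2: "veq 0 2" using veq_of_int[of 2] by simp
  have z: "veq (2 / 3) z"
    using T z_def q(1) by (cases rule: region_cases) (use q in auto)
  have "vgt (5 / 3 / 2) (3 * z)" by (rule veq_vgt[OF veq_mult[OF veq_3 z]]) simp
  moreover have "vgt (5 / 3 / 2) g2" by (rule veq_vgt[OF vc(1)]) simp
  ultimately have 1: "vgt (5 / 3 / 2) (3 * z + g2)" by (rule vgt_add)
  have "veq (0 + 1 + 2 / 3) (2 * g2 * z)" by (intro veq_mult v2 vc z)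
  hence "veq (5 / 3) (2 * g2 * z)" by simp
  moreover have "vgt (5 / 3) (3 * z ^ 2)"
    by (rule veq_vgt[OF veq_mult[OF veq_3 veq_power[OF z]]]) simp
  moreover have "vgt (5 / 3) g1" by (rule veq_vgt[OF vc(2)]) simp
  ultimately have "veq (5 / 3) (2 * g2 * z + (3 * z ^ 2 + g1))" by (intro veq_add vgt_add)
  also have "2 * g2 * z + (3 * z ^ 2 + g1) = 3 * z ^ 2 + (2 * g2 * z + g1)" by simp
  finally show ?thesis using 1 unfolding ct by blast
qed

lemma torsion_is_three_power:
  assumes T: "T \<in> carrier \<E>" "n > 0" "T [^]\<^bsub>\<E>\<^esub> (n::nat) = Origin"
  shows "\<exists>k::nat. T [^]\<^bsub>\<E>\<^esub> (3 ^ k :: nat) = Origin"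
proof -
  have main: "\<exists>k::nat. S [^]\<^bsub>\<E>\<^esub> (3 ^ k :: nat) = Origin"
    if "S \<in> carrier \<E>" "S [^]\<^bsub>\<E>\<^esub> n = Origin" "S = Origin \<or> (\<exists>x y q. S = Affine x y \<and> veq q (y ^ 2) \<and> q < 5 / 2)" for S
    using that by (intro torsion_three_power[of "5 / 2" S n] region T(2))
  show ?thesis
  proof (cases "T = Origin \<or> (\<exists>x y q. T = Affine x y \<and> veq q (y ^ 2) \<and> q < 5 / 2)")
    case False
    then obtain x y where xy: "T = Affine x y" by (cases T) auto
    have c: "Affine x y \<in> carrier \<E>" using T xy by simp
    have yK: "y \<in> Kcyc" using c Q_infinity_3_Kcyc by (simp add: carrier_iff)
    then obtain r where r: "veq r y" using veq_cases y_nonzero[OF c] by blast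
    hence r2: "veq (2 * r) (y ^ 2)" using veq_power[of r y 2] by simp
    \<comment> \<open>The border value \<open>q = 5 / 2\<close> lies in neither region; it would
      need \<open>y\<close> of valuation \<open>5 / 4\<close>, which is outside the value
      group.\<close>
    have "r \<noteq> 5 / 4" using veq_quarter[of 5 y] r by (metis odd_numeral of_int_numeral)
    moreover have "\<not> 2 * r < 5 / 2" using False r2 xy by blast
    ultimately have "2 * r > 5 / 2" by simp
    with outside_region[OF c r2] double_step[OF c r2, of "5 / 3"]
    obtain x' y' q where "T \<boxplus> T = Affine x' y'" "veq q (y' ^ 2)" "q < 5 / 2" using xy by auto
    moreover have TT: "T \<boxplus> T \<in> carrier \<E>" using T add_mem by blast
    moreover have "(T \<boxplus> T) [^]\<^bsub>\<E>\<^esub> n = Origin"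
    proof -
      have "(T [^]\<^bsub>\<E>\<^esub> (2::nat)) [^]\<^bsub>\<E>\<^esub> n = \<one>\<^bsub>\<E>\<^esub> [^]\<^bsub>\<E>\<^esub> (2::nat)"
        unfolding points.nat_pow_swap[OF T(1), of 2] T(3) one_points by (rule refl)
      thus ?thesis by (simp only: pow_2 points.nat_pow_one one_points ec_add.simps)
    qed
    ultimately obtain k :: nat where "(T \<boxplus> T) [^]\<^bsub>\<E>\<^esub> (3 ^ k :: nat) = Origin" using main by blast
    hence "(T [^]\<^bsub>\<E>\<^esub> (2::nat)) [^]\<^bsub>\<E>\<^esub> (3 ^ k :: nat) = Origin" unfolding pow_2 .
    hence "(T [^]\<^bsub>\<E>\<^esub> (3 ^ k :: nat)) [^]\<^bsub>\<E>\<^esub> (2::nat) = Origin"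
      unfolding points.nat_pow_swap[OF T(1), of 2] .
    hence "T [^]\<^bsub>\<E>\<^esub> (3 ^ k :: nat) = Origin"
      unfolding pow_2 by (rule double_nonzero[OF points.nat_pow_closed[OF T(1)]])
    thus ?thesis by blast
  qed (use main T in blast)
qed

lemma torsion_generated:
  assumes T: "T \<in> carrier \<E>" "n > 0" "T [^]\<^bsub>\<E>\<^esub> (n::nat) = Origin"
  shows "\<exists>j::nat. T = P [^]\<^bsub>\<E>\<^esub> j"
proof -
  obtain k :: nat where k: "T [^]\<^bsub>\<E>\<^esub> (3 ^ k :: nat) = Origin" using torsion_is_three_power[OF T] by blast
  show ?thesis
  proof (rule points.three_power_generated[OF P_carrier _ _ _ T(1)])
    show "P [^]\<^bsub>\<E>\<^esub> (9::nat) = \<one>\<^bsub>\<E>\<^esub>" "T [^]\<^bsub>\<E>\<^esub> (3 ^ k :: nat) = \<one>\<^bsub>\<E>\<^esub>"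
      using pow9_P k by (simp_all only: one_points)
    show "Q [^]\<^bsub>\<E>\<^esub> (3::nat) \<noteq> P" if "Q \<in> carrier \<E>" for Q
      unfolding pow_3[OF that] by (rule not_divisible[OF that])
    show "\<exists>l::nat. S = P [^]\<^bsub>\<E>\<^esub> l" if S: "S \<in> carrier \<E>" "S [^]\<^bsub>\<E>\<^esub> (3::nat) = \<one>\<^bsub>\<E>\<^esub>" for S
    proof -
      have "ec_neg P3 = (P [^]\<^bsub>\<E>\<^esub> (3::nat)) [^]\<^bsub>\<E>\<^esub> (2::nat)" by (simp only: pow3_P pow_2 double_P3)
      hence "ec_neg P3 = P [^]\<^bsub>\<E>\<^esub> (3 * 2 :: nat)" by (simp only: points.nat_pow_pow[OF P_carrier])
      moreover have "Origin = P [^]\<^bsub>\<E>\<^esub> (0 :: nat)" using points.nat_pow_0[of P] one_points by metis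
      moreover have "S = Origin \<or> S = P3 \<or> S = ec_neg P3"
        using three_torsion_real[OF S(1)] S(2) unfolding pow_3[OF S(1)] one_points by blast
      ultimately show ?thesis using pow3_P by metis
    qed
  qed
qed

lemma torsion_iso: "torsion_subgroup \<E> \<cong> integer_mod_group 9"
proof (rule points.torsion_subgroup_cyclic[OF P_carrier])
  show "P [^]\<^bsub>\<E>\<^esub> (9::nat) = \<one>\<^bsub>\<E>\<^esub>" unfolding one_points by (rule pow9_P)
  show "P [^]\<^bsub>\<E>\<^esub> k \<noteq> \<one>\<^bsub>\<E>\<^esub>" if "0 < k" "k < 9" for k :: nat
    unfolding one_points by (rule order_P[OF that])
  show "\<exists>k::nat. T = P [^]\<^bsub>\<E>\<^esub> k" if "T \<in> carrier \<E>" "m > 0" "T [^]\<^bsub>\<E>\<^esub> m = \<one>\<^bsub>\<E>\<^esub>" for T and m :: nat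
    using torsion_generated[OF that(1,2)] that(3) unfolding one_points by blast
qed simp

text \<open>Rational coordinates would make \<open>u v^2\<close> and \<open>v^3\<close> rational,
  hence also \<open>(u - v) / v\<close>, which has valuation \<open>2 / 3\<close>.\<close>

lemma P_not_rational: assumes "Affine x y = P" "x \<in> \<rat>" "y \<in> \<rat>" shows False
proof -
  have x: "x = - 4 * ee * (u * v ^ 2)" and y: "y = 8 * ee ^ 2 * v ^ 3 + te * x + 4 * ee ^ 3"
    using assms(1) by (auto simp: P_def)
  have "u * v ^ 2 = x / (- 4 * ee)" "v ^ 3 = (y - te * x - 4 * ee ^ 3) / (8 * ee ^ 2)"
    using e_nonzero unfolding y by (simp_all add: x)
  hence "u * v ^ 2 \<in> \<rat>" "v ^ 3 \<in> \<rat>" using assms(2,3) by auto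
  hence "(u * v ^ 2 - v ^ 3) / v ^ 3 \<in> \<rat>" by (intro Rats_divide Rats_diff)
  also have "(u * v ^ 2 - v ^ 3) / v ^ 3 = (u - v) / v"
    using uvw_nonzero by (simp add: power2_eq_square power3_eq_cube field_simps)
  finally have "(u - v) / v \<in> \<rat>" .
  moreover have d: "veq (2 / 3 - 0) ((u - v) / v)" by (intro veq_divide val_diff val_v)
  ultimately obtain k :: int where "veq (of_int k) ((u - v) / v)" using veq_Rats veq_nonzero by blast
  hence "of_int k = (2 / 3 :: real)" using d veq_unique by fastforce
  hence "real_of_int (3 * k) = of_int 2" by simp
  hence "3 * k = 2" by (simp only: of_int_eq_iff)
  thus False by presburger
qed

end

section \<open>Curves with a point of order seven\<close>

definition cgr :: "complex \<Rightarrow> complex \<Rightarrow> bool" where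
  "cgr x y \<longleftrightarrow> vge 0 x \<and> vge 0 y \<and> vgt 0 (x - y)"

lemma cgr_refl: "vge 0 x \<Longrightarrow> cgr x x" by (simp add: cgr_def vgt_zero)

lemma cgr_sym: "cgr x y \<Longrightarrow> cgr y x"
  unfolding cgr_def using vgt_uminus[of 0 "x - y"] by simp

lemma cgr_trans: "cgr x y \<Longrightarrow> cgr y z \<Longrightarrow> cgr x z"
  unfolding cgr_def using vgt_add[of 0 "x - y" "y - z"] by simp

lemma cgr_add: "cgr x y \<Longrightarrow> cgr z t \<Longrightarrow> cgr (x + z) (y + t)"
  unfolding cgr_def using vgt_add[of 0 "x - y" "z - t"] by (auto simp: algebra_simps intro: vge_add)

lemma cgr_uminus: "cgr x y \<Longrightarrow> cgr (- x) (- y)"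
  unfolding cgr_def using vgt_uminus[of 0 "x - y"] by (auto intro: vge_uminus)

lemma cgr_minus: "cgr x y \<Longrightarrow> cgr z t \<Longrightarrow> cgr (x - z) (y - t)"
  using cgr_add[of x y "- z" "- t"] cgr_uminus by simp

lemma cgr_mult: assumes "cgr x y" "cgr z t" shows "cgr (x * z) (y * t)"
proof -
  have "vgt 0 (x * (z - t) + (x - y) * t)"
    using assms vge_vgt_mult[of 0 x 0 "z - t"] vgt_vge_mult[of 0 "x - y" 0 t]
    by (intro vgt_add) (simp_all add: cgr_def)
  moreover have "x * (z - t) + (x - y) * t = x * z - y * t" by (simp add: algebra_simps)
  moreover have "vge 0 (x * z)" "vge 0 (y * t)"
    using assms vge_mult[of 0 x 0 z] vge_mult[of 0 y 0 t] by (simp_all add: cgr_def)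
  ultimately show ?thesis by (simp add: cgr_def)
qed

lemma cgr_power: "cgr x y \<Longrightarrow> cgr (x ^ k) (y ^ k)"
  by (induction k) (use vge_of_int[of 1] in \<open>auto intro: cgr_refl cgr_mult\<close>)

lemma cgr_of_int: "3 dvd k - l \<Longrightarrow> cgr (of_int k) (of_int l)"
proof -
  assume "3 dvd k - l"
  then obtain m where "k - l = 3 * m" by blast
  hence "of_int k - of_int l = (of_int (3 ^ 1 * m) :: complex)" by (simp flip: of_int_diff)
  thus ?thesis using vge_vgt[OF vge_3_power[of 1 m], of 0] vge_of_int by (simp add: cgr_def)
qed

lemma cgr_numeral: "cgr (numeral k) (numeral k)"
  using cgr_refl[OF vge_of_int[of "numeral k"]] by simp

lemma cgr_unit: assumes "cgr x (of_int k)" "\<not> 3 dvd k" shows "veq 0 x"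
proof -
  have "veq 0 (of_int k + (x - of_int k))"
    using assms by (intro veq_add veq_of_int) (simp_all add: cgr_def)
  thus ?thesis by simp
qed

lemma cgr_residue: "vge 0 x \<Longrightarrow> \<exists>k\<in>{0,1,-1}. cgr x (of_int k)"
  using vge_residue[of x] vge_of_int by (auto simp: cgr_def)

lemma cgr_sqrt:
  assumes "vge 0 y" "cgr (y ^ 2) 1" shows "cgr y 1 \<or> cgr y (- 1)"
proof -
  obtain k where k: "k \<in> {0,1,-1}" "cgr y (of_int k)" using cgr_residue assms by blast
  have "k \<noteq> 0"
  proof
    assume "k = 0"
    hence "cgr 1 0" using cgr_trans[OF cgr_sym[OF assms(2)] cgr_power[OF k(2), of 2]] by simp
    hence "vgt 0 1" by (simp add: cgr_def)
    thus False using vgt_veqD veq_1 by blast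
  qed
  thus ?thesis using k by auto
qed

text \<open>The Tate form \<open>Y^2 + a1 X Y + a3 Y = X^3 + a2 X^2\<close> with parameter
  \<open>d = - u / v\<close>, scaled to be homogeneous, so \<open>a2 = - u^2 v w\<close>. Here
  \<open>x = 4 X + b2 / 3\<close> and \<open>y = 4 (2 Y + a1 X + a3)\<close>, while
  \<open>C4\<close> and \<open>C6\<close> are the usual invariants \<open>c4\<close> and
  \<open>c6\<close>. They are integers although \<open>a1\<close>, \<open>a3\<close>,
  \<open>b2\<close> need not be rational.\<close>

locale seven_torsion_curve =
  cubic_over_Kcyc 0 A B Q_infinity_3 for A B :: complex +
  fixes u v w :: complex and a1 a3 b2 :: complex and C4 C6 :: int
  assumes sum0: "w = - u - v"
    and uv_mem: "u \<in> Q_infinity_3" "v \<in> Q_infinity_3"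
    and val_u: "veq 0 u" and val_v: "veq 0 v" and val_w: "veq 0 w" and val_diff: "veq (2 / 3) (u - v)"
    and a1: "a1 = v ^ 2 - u * v - u ^ 2" and a3: "a3 = - (u ^ 2 * v ^ 3 * w)"
    and b2: "b2 = a1 ^ 2 - 4 * u ^ 2 * v * w"
    and A: "A = 8 * (a1 * a3) - b2 ^ 2 / 3" and B: "B = 16 * a3 ^ 2 - 8 * (a1 * a3) * b2 / 3 + 2 * b2 ^ 3 / 27"
    and A7: "A = - of_int C4 / 3" "7 dvd C4" and B7: "B = - 2 * of_int C6 / 27" "7 dvd C6" "\<not> 49 dvd C6"
begin

notation points ("\<E>")
notation add (infixl "\<boxplus>" 65)

lemma carrier_iff: "Affine x y \<in> carrier \<E> \<longleftrightarrow>
    x \<in> Q_infinity_3 \<and> y \<in> Q_infinity_3 \<and> y ^ 2 = x ^ 3 + A * x + B"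
  unfolding carrier_Affine on.simps by simp

lemma mem: "w \<in> Q_infinity_3" "a1 \<in> Q_infinity_3" "a3 \<in> Q_infinity_3" "b2 \<in> Q_infinity_3"
  unfolding b2 a3 a1 sum0 by (intro mem_intros uv_mem)+

text \<open>In the coordinate \<open>z = x - b2 / 3\<close> the curve has good reduction over the cubic field.\<close>

lemma centred:
  assumes T: "Affine x y \<in> carrier \<E>" and z: "z = x - b2 / 3"
  shows "y ^ 2 = z ^ 3 + b2 * z ^ 2 + 8 * (a1 * a3) * z + 16 * a3 ^ 2" "3 * x = 3 * z + b2"
    "3 * x ^ 2 + A = 3 * z ^ 2 + (2 * b2 * z + 8 * (a1 * a3))" "z \<in> Kcyc"
proof -
  define h where "h = b2 / 3"
  have h: "b2 = 3 * h" by (simp add: h_def)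
  have x: "x = z + h" using z by (simp add: h_def)
  have A': "A = 8 * (a1 * a3) - 3 * h ^ 2" and B': "B = 16 * a3 ^ 2 - 8 * (a1 * a3) * h + 2 * h ^ 3"
    unfolding A B unfolding h by (simp_all add: power_mult_distrib)
  have "y ^ 2 = x ^ 3 + A * x + B" using T by (simp add: carrier_iff)
  thus "y ^ 2 = z ^ 3 + b2 * z ^ 2 + 8 * (a1 * a3) * z + 16 * a3 ^ 2"
    unfolding x A' B' h by (simp add: power2_eq_square power3_eq_cube algebra_simps)
  show "3 * x = 3 * z + b2" "3 * x ^ 2 + A = 3 * z ^ 2 + (2 * b2 * z + 8 * (a1 * a3))"
    unfolding x A' h by (simp_all add: power2_eq_square algebra_simps)
  have "z \<in> Q_infinity_3" using T unfolding z carrier_iff by (auto intro!: mem_intros mem)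
  thus "z \<in> Kcyc" by (rule Q_infinity_3_Kcyc)
qed

text \<open>The point \<open>(0, 0)\<close> of the Tate form with its double and triple, of
  abscissae \<open>X = 0\<close>, \<open>u^2 v w\<close> and \<open>- u v^2 w\<close>.\<close>

definition P where "P = Affine (b2 / 3) (4 * a3)"
definition P2 where "P2 = Affine (4 * u ^ 2 * v * w + b2 / 3) (- 4 * a1 * u ^ 2 * v * w - 4 * a3)"
definition P3 where "P3 = Affine (- 4 * u * v ^ 2 * w + b2 / 3) (4 * a1 * u * v ^ 2 * w - 8 * u ^ 2 * v ^ 2 * w ^ 2 - 4 * a3)"

lemma uvw_nonzero: "u \<noteq> 0" "v \<noteq> 0" "w \<noteq> 0" "a3 \<noteq> 0"
  using veq_nonzero val_u val_v val_w by (auto simp: a3)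

lemma P_carrier: "P \<in> carrier \<E>"
proof -
  have "(4 * a3) ^ 2 = (b2 / 3) ^ 3 + A * (b2 / 3) + B"
    unfolding A B by (simp add: power2_eq_square power3_eq_cube field_simps)
  thus ?thesis unfolding P_def carrier_iff by (auto intro!: mem_intros mem)
qed

lemma add_points:
  assumes "Affine x1 y1 \<in> carrier \<E>" "Affine x2 y2 \<in> carrier \<E>" "\<not> (x1 = x2 \<and> y1 + y2 = 0)"
    "slope x1 y1 x2 y2 l" "x3 = l ^ 2 - x1 - x2" "y3 = - (l * (x3 - x1) + y1)"
  shows "Affine x1 y1 \<boxplus> Affine x2 y2 = Affine x3 y3"
proof -
  have "y3 = - (l * (l ^ 2 - 0 - x1 - x2) + (y1 - l * x1))"
    unfolding assms(6) assms(5) by (simp add: algebra_simps)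
  thus ?thesis using add_slope[OF carrier_on[OF assms(1)] carrier_on[OF assms(2)] assms(3,4)] assms(5) by simp
qed

lemma P_P: "P \<boxplus> P = P2"
proof -
  define x y where "x = b2 / 3" and "y = 4 * a3"
  have c: "Affine x y \<in> carrier \<E>" using P_carrier by (simp add: P_def x_def y_def)
  have ne: "\<not> (x = x \<and> y + y = 0)" using uvw_nonzero by (simp add: y_def)
  have "a1 * (y + y) = x ^ 2 + x * x + x ^ 2 + 0 * (x + x) + A"
    unfolding A x_def y_def by (simp add: power2_eq_square field_simps)
  hence sl: "slope x y x y a1" unfolding slope_def by simp
  have 1: "4 * u ^ 2 * v * w + b2 / 3 = a1 ^ 2 - x - x"
    unfolding x_def b2 by (simp add: field_simps)
  have 2: "- 4 * a1 * u ^ 2 * v * w - 4 * a3 = - (a1 * (4 * u ^ 2 * v * w + b2 / 3 - x) + y)"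
    unfolding x_def y_def by (simp add: field_simps)
  show ?thesis using add_points[OF c c ne sl 1 2] by (simp only: P_def P2_def x_def y_def)
qed

lemma P2_carrier: "P2 \<in> carrier \<E>" using add_mem[OF P_carrier P_carrier] by (simp only: P_P)

lemma P_P2: "P \<boxplus> P2 = P3"
proof -
  define x y x2 y2 where "x = b2 / 3" and "y = 4 * a3"
    and "x2 = 4 * u ^ 2 * v * w + b2 / 3" and "y2 = - 4 * a1 * u ^ 2 * v * w - 4 * a3"
  have c: "Affine x y \<in> carrier \<E>" "Affine x2 y2 \<in> carrier \<E>"
    using P_carrier P2_carrier by (simp_all add: P_def P2_def x_def y_def x2_def y2_def)
  define l where "l = a1 - 2 * u * w"
  have xne: "x \<noteq> x2" using uvw_nonzero by (simp add: x_def x2_def)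
  then obtain l' where l': "slope x y x2 y2 l'"
    using slope_exists[OF carrier_on[OF c(1)] carrier_on[OF c(2)]] by auto
  have "l * (x2 - x) = y2 - y"
    unfolding l_def y_def x_def y2_def x2_def a3 a1 sum0 by (simp add: eval_nat_numeral algebra_simps)
  hence "l' * (x2 - x) = l * (x2 - x)" using l' unfolding slope_def by simp
  hence sl: "slope x y x2 y2 l" using xne l' by simp
  have 1: "- 4 * u * v ^ 2 * w + b2 / 3 = l ^ 2 - x - x2"
    unfolding x_def x2_def b2 l_def a1 sum0 by (simp add: eval_nat_numeral field_simps)
  have 2: "4 * a1 * u * v ^ 2 * w - 8 * u ^ 2 * v ^ 2 * w ^ 2 - 4 * a3 = - (l * (- 4 * u * v ^ 2 * w + b2 / 3 - x) + y)"
    unfolding x_def y_def l_def by (simp add: power2_eq_square field_simps)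
  have ne: "\<not> (x = x2 \<and> y + y2 = 0)" using xne by simp
  show ?thesis using add_points[OF c ne sl 1 2]
    by (simp only: P_def P2_def P3_def x_def y_def x2_def y2_def)
qed

lemma P3_carrier: "P3 \<in> carrier \<E>" using add_mem[OF P_carrier P2_carrier] by (simp only: P_P2)

subsection \<open>Reduction at three\<close>

text \<open>All of \<open>u\<close>, \<open>v\<close>, \<open>w\<close> reduce to the same sign
  \<open>c\<close>, since \<open>- 2 c = c\<close> modulo 3. The curve reduces to
  \<open>y^2 = z^3 - z + 1\<close>, which has seven points over the field of three elements, and
  \<open>P\<close>, \<open>2 P\<close>, \<open>3 P\<close> realize the residues 0, 1, -1 of
  \<open>z\<close>.\<close>

lemma residues:
  "cgr a1 (- 1)" "cgr a3 (- 1)" "cgr b2 0" "cgr (8 * (a1 * a3)) (- 1)" "cgr (16 * a3 ^ 2) 1"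
  "cgr (4 * u ^ 2 * v * w) 1" "cgr (- 4 * u * v ^ 2 * w) (- 1)"
proof -
  obtain k where k: "k \<in> {0,1,-1}" "cgr u (of_int k)"
    using cgr_residue veq_vge[OF val_u order_refl] by blast
  have "k \<noteq> 0"
  proof
    assume "k = 0"
    hence "vgt 0 u" using k by (simp add: cgr_def)
    thus False using val_u vgt_veqD by blast
  qed
  define c :: complex where "c = of_int k"
  have c2: "c * c = 1" "c * (c * x) = x" for x using k \<open>k \<noteq> 0\<close> by (auto simp: c_def)
  have u: "cgr u c" using k c_def by simp
  have "cgr v u" unfolding cgr_def using veq_vge[OF val_v] veq_vge[OF val_u] veq_vgt[OF val_diff, of 0]
      vgt_uminus[of 0 "u - v"] by simp
  hence v: "cgr v c" using u cgr_trans by blast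
  have "cgr w (- c - c)" unfolding sum0 by (intro cgr_minus cgr_uminus u v)
  also have "cgr (- c - c) c"
    using cgr_mult[OF cgr_of_int[of "-2" 1] cgr_refl[of c]] u by (simp add: cgr_def)
  finally (cgr_trans) have w: "cgr w c" .
  note ci = cgr_add cgr_minus cgr_mult cgr_uminus cgr_power cgr_numeral u v w
  have "cgr a1 (c ^ 2 - c * c - c ^ 2)" unfolding a1 by (intro ci)
  thus a1': "cgr a1 (- 1)" by (simp add: power2_eq_square c2)
  have "cgr a3 (- (c ^ 2 * c ^ 3 * c))" unfolding a3 by (intro ci)
  thus a3': "cgr a3 (- 1)" by (simp add: eval_nat_numeral c2)
  have "cgr (4 * u ^ 2 * v * w) (4 * c ^ 2 * c * c)" by (intro ci)
  hence 4: "cgr (4 * u ^ 2 * v * w) 4" by (simp add: eval_nat_numeral c2 mult.assoc)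
  have "cgr (- 4 * u * v ^ 2 * w) (- 4 * c * c ^ 2 * c)"
    by (intro ci)
  hence f4: "cgr (- 4 * u * v ^ 2 * w) (- 4)" by (simp add: eval_nat_numeral c2 mult.assoc)
  have n: "cgr 4 1" "cgr (- 4) (- 1)" "cgr (- 3) 0" "cgr 8 (- 1)" "cgr 16 1"
    using cgr_of_int[of 4 1] cgr_of_int[of "-4" "-1"] cgr_of_int[of "-3" 0] cgr_of_int[of 8 "-1"] cgr_of_int[of 16 1]
    by simp_all
  show "cgr (4 * u ^ 2 * v * w) 1" "cgr (- 4 * u * v ^ 2 * w) (- 1)"
    using cgr_trans 4 f4 n by blast+
  have "cgr b2 ((- 1) ^ 2 - 4)" unfolding b2 by (intro cgr_minus cgr_power a1' 4)
  thus "cgr b2 0" using cgr_trans n(3) by simp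
  have "cgr (8 * (a1 * a3)) (- 1 * (- 1 * - 1))" by (intro cgr_mult n a1' a3')
  thus "cgr (8 * (a1 * a3)) (- 1)" by simp
  have "cgr (16 * a3 ^ 2) (1 * (- 1) ^ 2)" by (intro cgr_mult cgr_power n a3')
  thus "cgr (16 * a3 ^ 2) 1" by simp
qed

text \<open>Every residue satisfies \<open>k^3 = k\<close>, so the right-hand side always reduces to
  1.\<close>

lemma reduction:
  assumes T: "Affine x y \<in> carrier \<E>" and z: "vge 0 (x - b2 / 3)"
  shows "cgr y 1 \<or> cgr y (- 1)"
proof -
  define z where "z = x - b2 / 3"
  obtain k where k: "k \<in> {0,1,-1}" "cgr z (of_int k)" using cgr_residue z z_def by blast
  have "cgr (y ^ 2) (of_int k ^ 3 + 0 * of_int k ^ 2 + (- 1) * of_int k + 1)"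
    unfolding centred(1)[OF T z_def] by (intro cgr_add cgr_mult cgr_power residues k)
  hence y2: "cgr (y ^ 2) 1" using k by auto
  have "vge 0 y"
  proof (rule ccontr)
    assume "\<not> vge 0 y"
    moreover have "y \<in> Kcyc" using T Q_infinity_3_Kcyc by (simp add: carrier_iff)
    ultimately obtain q where q: "q < 0" "veq q y" using not_vge by blast
    from veq_power[OF q(2), of 2] have "veq (2 * q) (y ^ 2)" by simp
    thus False using y2 q vge_veqD by (force simp: cgr_def)
  qed
  thus ?thesis using y2 cgr_sqrt by blast
qed

lemma pole:
  assumes T: "Affine x y \<in> carrier \<E>" and z: "veq p (x - b2 / 3)" "p < 0"
  shows "veq (3 * p) (y ^ 2)"
proof -
  define z where "z = x - b2 / 3"
  have p: "veq p z" using z by (simp add: z_def)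
  have r: "vge 0 b2" "vge 0 (8 * (a1 * a3))" "vge 0 (16 * a3 ^ 2)" using residues by (auto simp: cgr_def)
  have "veq (of_nat 3 * p) (z ^ 3 + (b2 * z ^ 2 + (8 * (a1 * a3) * z + 16 * a3 ^ 2)))"
  proof (intro veq_add veq_power vgt_add p)
    show "vgt (of_nat 3 * p) (b2 * z ^ 2)"
      by (rule vge_vgt[OF vge_mult[OF r(1) veq_vge[OF veq_power[OF p] order_refl]]]) (use z in simp)
    show "vgt (of_nat 3 * p) (8 * (a1 * a3) * z)"
      by (rule vge_vgt[OF vge_mult[OF r(2) veq_vge[OF p order_refl]]]) (use z in simp)
    show "vgt (of_nat 3 * p) (16 * a3 ^ 2)" by (rule vge_vgt[OF r(3)]) (use z in simp)
  qed
  thus ?thesis unfolding centred(1)[OF T z_def] by (simp add: add.assoc)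
qed

lemma region:
  assumes T: "Affine x y \<in> carrier \<E>" and q: "veq q (y ^ 2)" "q < 0"
  shows "vgt (2 * q / 3) (3 * x ^ 2 + 2 * 0 * x + A) \<and> vgt (q / 3) (3 * x + 0)"
proof -
  define z where "z = x - b2 / 3"
  note ct = centred[OF T z_def]
  have "\<not> vge 0 z"
  proof
    assume "vge 0 z"
    hence "cgr y 1 \<or> cgr y (- 1)" using reduction T z_def by simp
    hence "vge 0 y" by (auto simp: cgr_def)
    hence "vge 0 (y ^ 2)" using vge_power[of 0 y 2] by simp
    thus False using q vge_veqD by fastforce
  qed
  then obtain p where p: "p < 0" "veq p z" using not_vge ct(4) by blast
  hence qp: "q = 3 * p" using pole[OF T _ p(1)] z_def q(1) veq_unique by blast
  have r: "vge 0 b2" "vge 0 (8 * (a1 * a3))" using residues by (auto simp: cgr_def)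
  have v2: "vge 0 2" using vge_of_int[of 2] by simp
  have "vgt (q / 3) (3 * z)" by (rule veq_vgt[OF veq_mult[OF veq_3 p(2)]]) (use qp in simp)
  moreover have "vgt (q / 3) b2" by (rule vge_vgt[OF r(1)]) (use qp p in simp)
  moreover have "vgt (2 * q / 3) (3 * z ^ 2)"
    by (rule veq_vgt[OF veq_mult[OF veq_3 veq_power[OF p(2)]]]) (use qp p in simp)
  moreover have "vgt (2 * q / 3) (2 * b2 * z)"
    by (rule vge_vgt[OF vge_mult[OF vge_mult[OF v2 r(1)] veq_vge[OF p(2) order_refl]]]) (use qp p in simp)
  moreover have "vgt (2 * q / 3) (8 * (a1 * a3))" by (rule vge_vgt[OF r(2)]) (use qp p in simp)
  ultimately have "vgt (2 * q / 3) (3 * z ^ 2 + (2 * b2 * z + 8 * (a1 * a3))) \<and> vgt (q / 3) (3 * z + b2)"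
    by (intro conjI vgt_add)
  thus ?thesis using ct by simp
qed

text \<open>Points with the same reduction differ by a point of the kernel of reduction.\<close>

lemma same_reduction:
  assumes T: "Affine x y \<in> carrier \<E>" and S: "Affine x' y' \<in> carrier \<E>"
    and z: "cgr (x - b2 / 3) (x' - b2 / 3)" and yy: "cgr y y'"
  shows "Affine x y \<boxplus> Affine x' (- y') = Origin \<or>
    (\<exists>x3 y3 q. Affine x y \<boxplus> Affine x' (- y') = Affine x3 y3 \<and> veq q (y3 ^ 2) \<and> q < 0)"
proof (cases "x = x' \<and> y + - y' = 0")
  case False
  have S': "Affine x' (- y') \<in> carrier \<E>" using neg_mem[OF S] by simp
  have v2: "veq 0 2" using veq_of_int[of 2] by simp
  \<comment> \<open>Congruent units \<open>y\<close>, \<open>y'\<close> have a unit sum, while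
    \<open>x' - x\<close> is not a unit; the slope therefore has a pole, which puts the sum into the
    kernel of reduction.\<close>
  have "cgr y 1 \<or> cgr y (- 1)" using reduction[OF T] z by (simp add: cgr_def)
  hence y0: "veq 0 y" using cgr_unit[of y 1] cgr_unit[of y "-1"] by auto
  have "vgt 0 (y - y')" using yy by (simp add: cgr_def)
  hence "veq 0 (y * 2 - (y - y'))" using veq_mult[OF y0 v2] by (intro veq_minus) simp_all
  also have "y * 2 - (y - y') = y' + y" by simp
  finally have num: "veq 0 (y' + y)" .
  have xne: "x' \<noteq> x"
  proof
    assume "x' = x"
    hence "(y - y') * (y' + y) = 0" using T S by (simp add: carrier_iff power2_eq_square algebra_simps)
    thus False using False \<open>x' = x\<close> veq_nonzero[OF num] by auto
  qed
  have "vgt 0 (x' - x)" using cgr_sym[OF z] by (simp add: cgr_def)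
  then obtain p where p: "veq p (x' - x)" "p > 0" using xne by (auto simp: vgt_def veq_def)
  obtain l where l: "slope x y x' (- y') l"
    using slope_exists[OF carrier_on[OF T] carrier_on[OF S'] False] by blast
  hence "l * (x' - x) = - (y' + y)" unfolding slope_def by simp
  hence leq: "l = - (y' + y) / (x' - x)" using xne by (simp add: eq_divide_eq)
  have "veq (0 - p) (- (y' + y) / (x' - x))"
    by (rule veq_divide[OF _ p(1)]) (use num veq_uminus in blast)
  hence lp: "veq (- p) l" unfolding leq by simp
  define x3 y3 where "x3 = l ^ 2 - x - x'" and "y3 = - (l * (x3 - x) + y)"
  have R: "Affine x y \<boxplus> Affine x' (- y') = Affine x3 y3"
    by (rule add_points[OF T S' False l x3_def y3_def])
  have eq: "x3 - b2 / 3 = l ^ 2 - ((x - b2 / 3) + (x' - b2 / 3) + b2)" by (simp add: x3_def)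
  have "veq (of_nat 2 * (- p)) (x3 - b2 / 3)" unfolding eq
  proof (intro veq_minus veq_power lp)
    have "vge 0 ((x - b2 / 3) + (x' - b2 / 3) + b2)"
      using z residues(3) by (intro vge_add) (simp_all add: cgr_def)
    thus "vgt (of_nat 2 * (- p)) ((x - b2 / 3) + (x' - b2 / 3) + b2)"
      by (rule vge_vgt) (use p in simp)
  qed
  hence "veq (3 * (of_nat 2 * (- p))) (y3 ^ 2)"
    using add_mem[OF T S'] R p by (intro pole) simp_all
  thus ?thesis using R p by (intro disjI2 exI[of _ x3] exI[of _ y3] exI[of _ "3 * (of_nat 2 * (- p))"]) simp
qed simp

text \<open>The relation \<open>4 P = - 3 P\<close>, which closes the cycle of order seven.\<close>

lemma P2_P2: "P2 \<boxplus> P2 = ec_neg P3"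
proof -
  define x y where "x = 4 * u ^ 2 * v * w + b2 / 3" and "y = - 4 * a1 * u ^ 2 * v * w - 4 * a3"
  have c: "Affine x y \<in> carrier \<E>" using P2_carrier by (simp add: P2_def x_def y_def)
  have "vge 0 (x - b2 / 3)" using residues(6) by (simp add: x_def cgr_def)
  hence "cgr y 1 \<or> cgr y (- 1)" by (rule reduction[OF c])
  hence "veq 0 y" using cgr_unit[of y 1] cgr_unit[of y "-1"] by auto
  hence ne: "\<not> (x = x \<and> y + y = 0)" using veq_nonzero by (simp flip: mult_2)
  define l where "l = 2 * u ^ 2 - 2 * v ^ 2 + a1"
  have "x ^ 2 + x * x + x ^ 2 + 0 * (x + x) + A
      = 3 * (4 * u ^ 2 * v * w) ^ 2 + 2 * (4 * u ^ 2 * v * w) * b2 + 8 * (a1 * a3)"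
    unfolding A x_def by (simp add: power2_eq_square field_simps)
  also have "\<dots> = l * (y + y)"
    unfolding y_def l_def b2 a3 a1 sum0 by (simp add: eval_nat_numeral algebra_simps)
  finally have sl: "slope x y x y l" unfolding slope_def by simp
  have "b2 = l ^ 2 - 8 * u ^ 2 * v * w + 4 * u * v ^ 2 * w"
    unfolding l_def b2 a1 sum0 by (simp add: eval_nat_numeral algebra_simps)
  hence l2: "l ^ 2 = b2 + 8 * u ^ 2 * v * w - 4 * u * v ^ 2 * w" by simp
  have 1: "- 4 * u * v ^ 2 * w + b2 / 3 = l ^ 2 - x - x"
    unfolding x_def l2 by (simp add: algebra_simps)
  have 2: "- (4 * a1 * u * v ^ 2 * w - 8 * u ^ 2 * v ^ 2 * w ^ 2 - 4 * a3)
      = - (l * (- 4 * u * v ^ 2 * w + b2 / 3 - x) + y)"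
    unfolding x_def y_def l_def a3 a1 sum0 by (simp add: eval_nat_numeral algebra_simps)
  show ?thesis using add_points[OF c c ne sl 1 2] by (simp only: P2_def P3_def x_def y_def ec_neg.simps)
qed

lemma powers: "P [^]\<^bsub>\<E>\<^esub> (1::nat) = P" "P [^]\<^bsub>\<E>\<^esub> (2::nat) = P2" "P [^]\<^bsub>\<E>\<^esub> (3::nat) = P3"
  "P [^]\<^bsub>\<E>\<^esub> (4::nat) = ec_neg P3" "P [^]\<^bsub>\<E>\<^esub> (7::nat) = Origin"
proof -
  show "P [^]\<^bsub>\<E>\<^esub> (1::nat) = P" using P_carrier by (rule points.nat_pow_eone)
  show 2: "P [^]\<^bsub>\<E>\<^esub> (2::nat) = P2" unfolding pow_2 by (rule P_P)
  show 3: "P [^]\<^bsub>\<E>\<^esub> (3::nat) = P3" unfolding pow_3[OF P_carrier] P_P by (rule P_P2)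
  have "P [^]\<^bsub>\<E>\<^esub> (2 * 2 :: nat) = (P [^]\<^bsub>\<E>\<^esub> (2::nat)) [^]\<^bsub>\<E>\<^esub> (2::nat)"
    by (rule points.nat_pow_pow[OF P_carrier, symmetric])
  also have "\<dots> = ec_neg P3" unfolding pow_2 P_P by (rule P2_P2)
  finally have "P [^]\<^bsub>\<E>\<^esub> (2 * 2 :: nat) = ec_neg P3" .
  thus 4: "P [^]\<^bsub>\<E>\<^esub> (4::nat) = ec_neg P3" by simp
  have "P [^]\<^bsub>\<E>\<^esub> (3 + 4 :: nat) = Origin"
    unfolding points.nat_pow_mult[OF P_carrier, symmetric] unfolding 3 4 mult_points by (rule add_neg)
  thus "P [^]\<^bsub>\<E>\<^esub> (7::nat) = Origin" by simp
qed

lemma neg_power: assumes "S = P [^]\<^bsub>\<E>\<^esub> (k::nat)" shows "ec_neg S = P [^]\<^bsub>\<E>\<^esub> (6 * k)"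
proof -
  have S: "S \<in> carrier \<E>" unfolding assms by (rule points.nat_pow_closed[OF P_carrier])
  have "S [^]\<^bsub>\<E>\<^esub> (7::nat) = \<one>\<^bsub>\<E>\<^esub>"
    unfolding assms points.nat_pow_swap[OF P_carrier, of k] powers(5)
    unfolding one_points[symmetric] by (rule points.nat_pow_one)
  hence "S [^]\<^bsub>\<E>\<^esub> (1 + 6 :: nat) = \<one>\<^bsub>\<E>\<^esub>" by simp
  hence "S \<boxplus> S [^]\<^bsub>\<E>\<^esub> (6::nat) = Origin"
    unfolding points.nat_pow_mult[OF S, symmetric] points.nat_pow_eone[OF S] mult_points one_points .
  hence "ec_neg S = S [^]\<^bsub>\<E>\<^esub> (6::nat)" unfolding add_eq_Origin by simp
  also have "\<dots> = P [^]\<^bsub>\<E>\<^esub> (6 * k)" unfolding assms points.nat_pow_pow[OF P_carrier] by (simp add: mult.commute)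
  finally show ?thesis .
qed

lemma order_P: assumes "0 < k" "k < 7" shows "P [^]\<^bsub>\<E>\<^esub> (k::nat) \<noteq> Origin"
proof
  assume k: "P [^]\<^bsub>\<E>\<^esub> k = Origin"
  have "points.ord P dvd k" "points.ord P dvd 7"
    using k powers(5) points.pow_eq_id[OF P_carrier] unfolding one_points by auto
  hence "points.ord P dvd gcd k 7" by simp
  moreover have "coprime 7 k" using assms by (intro prime_imp_coprime_nat) (auto dest: dvd_imp_le)
  ultimately have "points.ord P dvd 1" by (metis coprime_iff_gcd_eq_1 gcd.commute)
  hence "points.ord P = 1" by simp
  hence "P [^]\<^bsub>\<E>\<^esub> (1::nat) = \<one>\<^bsub>\<E>\<^esub>" using points.pow_eq_id[OF P_carrier, of 1] by simp
  thus False unfolding powers(1) one_points by (simp add: P_def)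
qed

text \<open>At \<open>7\<close> the curve has additive reduction with \<open>B\<close> of valuation one: a point of order three
  would reduce to the cusp.\<close>

lemma no_three_torsion:
  assumes T: "T \<in> carrier \<E>" "T \<boxplus> (T \<boxplus> T) = Origin" shows "T = Origin"
proof (cases T)
  case (Affine x y)
  note c = T(1)[unfolded Affine carrier_iff]
  have psi: "(3 * x ^ 2 + 2 * 0 * x + A) ^ 2 = 4 * y ^ 2 * (3 * x + 0)"
    using three_torsion[of x y] T Affine by auto
  have xK: "x \<in> Kcyc" and yK: "y \<in> Kcyc" using c Q_infinity_3_Kcyc by auto
  have seven: "Factorial_Ring.prime (7::nat)" by simp
  note li = localized_intros[OF seven]
  obtain d4 d6 where d: "C4 = 7 * d4" "C6 = 7 * d6" using A7 B7 by blast
  have d6: "\<not> 7 dvd d6" using B7(3) d by auto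
  define A' B' :: complex where "A' = of_int (- d4) * (1 / of_int 3)" and "B' = of_int (- 2 * d6) * (1 / of_int 27)"
  have A'l: "A' \<in> localized 7" and B'l: "B' \<in> localized 7"
    unfolding A'_def B'_def by (intro li localized_inverse_int[OF seven]; simp)+
  have A': "A = 7 * A'" and B': "B = 7 * B'" unfolding A7 B7 d A'_def B'_def by simp_all
  have thl: "1 / 3 \<in> localized 7" using localized_inverse_int[OF seven, of 3] by simp
  \<comment> \<open>The third division polynomial \<open>3 x^4 + 6 A x^2 + 12 B x - A^2\<close>,
    made monic; 3 is invertible at 7.\<close>
  define f where "f i = (if i = 0 then A ^ 2 * (1 / 3) else if i = 1 then - 4 * B else if i = 2 then - 2 * A else 0)" for i :: nat
  have "3 * x ^ 4 = 3 * (A ^ 2 * (1 / 3) - 4 * B * x - 2 * A * x ^ 2)"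
  proof -
    have "3 * x ^ 4 - 3 * (A ^ 2 * (1 / 3) - 4 * B * x - 2 * A * x ^ 2)
       = 4 * (x ^ 3 + A * x + B) * (3 * x + 0) - (3 * x ^ 2 + 2 * 0 * x + A) ^ 2"
      by (simp add: eval_nat_numeral algebra_simps)
    also have "\<dots> = 0" unfolding psi using c by simp
    finally show ?thesis by simp
  qed
  hence x4: "x ^ 4 = A ^ 2 * (1 / 3) - 4 * B * x - 2 * A * x ^ 2"
    by (simp only: mult_cancel_left) simp
  have "x ^ 4 = (\<Sum>i<4. f i * x ^ i)" unfolding x4 f_def by (simp add: eval_nat_numeral)
  moreover have "f i \<in> localized 7" for i
  proof -
    have AB: "A \<in> localized 7" "B \<in> localized 7" unfolding A' B' by (intro li A'l B'l)+
    have "A ^ 2 * (1 / 3) \<in> localized 7" "- 4 * B \<in> localized 7" "- 2 * A \<in> localized 7"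
      by (intro li AB thl)+
    thus ?thesis unfolding f_def using localized_of_int[OF seven, of 0] by auto
  qed
  ultimately have xl: "x \<in> localized 7"
    using localized_integrally_closed[OF seven _ xK, of 4 f] by simp
  have up: "\<exists>w\<in>localized 7. z = 7 * w" if "z \<in> localized 7" "z ^ k = 7 * y" "y \<in> localized 7" "k > 0" for z y and k :: nat
    using localized_unramified[OF seven _ that(1,3,4)] that(2) by simp
  have "x ^ 4 = 7 * (7 * A' ^ 2 * (1 / 3) - 4 * B' * x - 2 * A' * x ^ 2)"
    unfolding x4 A' B' by (simp add: power2_eq_square algebra_simps)
  moreover have "7 * A' ^ 2 * (1 / 3) - 4 * B' * x - 2 * A' * x ^ 2 \<in> localized 7"
    using A'l B'l thl xl by (intro li)
  ultimately obtain x' where x': "x' \<in> localized 7" "x = 7 * x'" using up[OF xl _ _ zero_less_numeral] by blast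
  have y2: "y ^ 2 = 7 * (49 * x' ^ 3 + 7 * A' * x' + B')"
    using c unfolding A' B' x' by (simp add: power2_eq_square power3_eq_cube algebra_simps)
  have y2l: "49 * x' ^ 3 + 7 * A' * x' + B' \<in> localized 7" using A'l B'l x' by (intro li)
  define g where "g i = (if i = 0 then 7 * (49 * x' ^ 3 + 7 * A' * x' + B') else 0)" for i :: nat
  have "y ^ 2 = (\<Sum>i<2. g i * y ^ i)" unfolding y2 g_def by (simp add: eval_nat_numeral)
  moreover have "g i \<in> localized 7" for i
    unfolding g_def using localized_mult[OF seven localized_numeral[OF seven, of "Num.Bit1 (Num.Bit1 Num.One)"] y2l]
      localized_of_int[OF seven, of 0] by (auto simp only: of_int_0 split: if_split)
  ultimately have yl: "y \<in> localized 7"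
    using localized_integrally_closed[OF seven _ yK, of 2 g] by simp
  obtain y' where y': "y' \<in> localized 7" "y = 7 * y'" using up[OF yl y2 y2l] by auto
  have "7 * (7 * y' ^ 2) = 7 * (49 * x' ^ 3 + 7 * A' * x' + B')"
    using y2 unfolding y' by (simp only: power_mult_distrib) simp
  hence "7 * y' ^ 2 = 49 * x' ^ 3 + 7 * A' * x' + B'" by (metis mult_cancel_left zero_neq_numeral)
  \<comment> \<open>Both coordinates are divisible by 7, so \<open>B\<close> would be divisible by
    49.\<close>
  hence "B' = 7 * (y' ^ 2 - 7 * x' ^ 3 - A' * x')" by (simp add: algebra_simps)
  hence "of_int (- 2 * d6) = of_nat 7 * (27 * (y' ^ 2 - 7 * x' ^ 3 - A' * x'))"
    unfolding B'_def by (simp add: field_simps)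
  hence "int 7 dvd - 2 * d6"
    by (rule localized_int_dvd[OF seven]) (use A'l x' y' in \<open>intro li\<close>)
  hence "7 dvd d6" by presburger
  thus ?thesis using d6 by blast
qed simp

text \<open>Up to sign one of \<open>P\<close>, \<open>2 P\<close>, \<open>3 P\<close> has the same
  reduction as an integral \<open>T\<close>. Their difference is torsion in the kernel of reduction,
  hence of 3-power order by the contraction, hence trivial by
  \<open>no_three_torsion\<close>.\<close>

lemma torsion_generated:
  assumes T: "T \<in> carrier \<E>" "n > 0" "T [^]\<^bsub>\<E>\<^esub> (n::nat) = Origin"
  shows "\<exists>j::nat. T = P [^]\<^bsub>\<E>\<^esub> j"
proof -
  have kernel: "S = Origin"
    if S: "S \<in> carrier \<E>" "S = Origin \<or> (\<exists>x y q. S = Affine x y \<and> veq q (y ^ 2) \<and> q < 0)"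
      and m: "m > 0" "S [^]\<^bsub>\<E>\<^esub> (m::nat) = Origin" for S m
  proof -
    obtain k :: nat where "S [^]\<^bsub>\<E>\<^esub> (3 ^ k :: nat) = Origin"
      using torsion_three_power[of 0 S m] region S m by blast
    thus ?thesis using three_power_Origin[OF S(1)] no_three_torsion by blast
  qed
  have diff: "\<exists>j::nat. T = P [^]\<^bsub>\<E>\<^esub> j"
    if T: "T = Affine x y" and S: "Affine x' y' = P [^]\<^bsub>\<E>\<^esub> (k::nat)"
      and z: "cgr (x - b2 / 3) (x' - b2 / 3)" and yy: "cgr y y'" for x y x' y' k
  proof -
    define S where "S = Affine x' y'"
    have Sc: "S \<in> carrier \<E>" unfolding S_def S by (rule points.nat_pow_closed[OF P_carrier])
    have nS: "ec_neg S = P [^]\<^bsub>\<E>\<^esub> (6 * k)" by (rule neg_power) (simp only: S S_def)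
    define D where "D = T \<boxplus> ec_neg S"
    have Dc: "D \<in> carrier \<E>" unfolding D_def by (rule add_mem[OF assms(1) neg_mem[OF Sc]])
    have nS7: "(ec_neg S) [^]\<^bsub>\<E>\<^esub> (7 * n) = \<one>\<^bsub>\<E>\<^esub>"
    proof -
      have "(ec_neg S) [^]\<^bsub>\<E>\<^esub> (7 * n) = (P [^]\<^bsub>\<E>\<^esub> (7::nat)) [^]\<^bsub>\<E>\<^esub> (6 * k * n)"
        unfolding nS points.nat_pow_pow[OF P_carrier] by (simp add: mult_ac)
      thus ?thesis unfolding powers(5) unfolding one_points[symmetric] by simp
    qed
    have "T [^]\<^bsub>\<E>\<^esub> (n * 7) = \<one>\<^bsub>\<E>\<^esub>"
      unfolding points.nat_pow_pow[OF assms(1), symmetric] assms(3) unfolding one_points[symmetric] by simp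
    hence T7: "T [^]\<^bsub>\<E>\<^esub> (7 * n) = \<one>\<^bsub>\<E>\<^esub>" by (simp only: mult.commute)
    have "D [^]\<^bsub>\<E>\<^esub> (7 * n) = Origin"
      unfolding D_def mult_points[symmetric] points.nat_pow_distrib[OF assms(1) neg_mem[OF Sc]] T7 nS7
      by (simp only: points.l_one points.one_closed one_points[symmetric])
    moreover have "D = Origin \<or> (\<exists>x y q. D = Affine x y \<and> veq q (y ^ 2) \<and> q < 0)"
      using same_reduction[of x y x' y'] assms(1) Sc z yy unfolding D_def S_def T by simp
    ultimately have "D = Origin" using kernel[OF Dc, of "7 * n"] assms(2) by simp
    hence "T = S" unfolding D_def add_eq_Origin by (metis neg_neg)
    thus ?thesis unfolding S_def S by blast
  qed
  show ?thesis
  proof (cases T)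
    case Origin
    thus ?thesis using points.nat_pow_0[of P] one_points by metis
  next
    case (Affine x y)
    have c: "Affine x y \<in> carrier \<E>" using T Affine by simp
    show ?thesis
    proof (cases "vge 0 (x - b2 / 3)")
      case False
      moreover have "x - b2 / 3 \<in> Kcyc" using centred(4)[OF c refl] .
      ultimately obtain p where p: "p < 0" "veq p (x - b2 / 3)" using not_vge by blast
      have "T = Origin" using kernel[OF T(1) _ T(2,3)] pole[OF c p(2,1)] p Affine
        by (metis mult_less_0_iff not_numeral_less_zero zero_less_numeral)
      thus ?thesis using points.nat_pow_0[of P] one_points by metis
    next
      case True
      obtain d where d: "d \<in> {0,1,-1}" "cgr (x - b2 / 3) (of_int d)" using cgr_residue[OF True] by blast
      have y: "cgr y 1 \<or> cgr y (- 1)" by (rule reduction[OF c True])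
      have main: ?thesis if S: "Affine x' y' = P [^]\<^bsub>\<E>\<^esub> (k::nat)" and x': "cgr (x' - b2 / 3) (of_int d)" for x' y' k
      proof -
        have Sc: "Affine x' y' \<in> carrier \<E>" unfolding S by (rule points.nat_pow_closed[OF P_carrier])
        have y': "cgr y' 1 \<or> cgr y' (- 1)" using reduction[OF Sc] x' by (simp add: cgr_def)
        have z: "cgr (x - b2 / 3) (x' - b2 / 3)" using d(2) x' cgr_sym cgr_trans by blast
        have "cgr y y' \<or> cgr y (- y')"
          using y y' cgr_uminus[of y' 1] cgr_uminus[of y' "-1"] cgr_sym cgr_trans
          by (metis minus_minus)
        thus ?thesis
        proof
          assume "cgr y y'" thus ?thesis by (rule diff[OF Affine S z])
        next
          assume yy: "cgr y (- y')"
          have "Affine x' (- y') = P [^]\<^bsub>\<E>\<^esub> (6 * k)" using neg_power[OF S] by simp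
          thus ?thesis by (rule diff[OF Affine _ z yy])
        qed
      qed
      have zero: "cgr 0 0" using cgr_of_int[of 0 0] by simp
      from d(1) consider "d = 0" | "d = 1" | "d = -1" by auto
      thus ?thesis
      proof cases
        case 1
        show ?thesis by (rule main[OF trans[OF P_def[symmetric] powers(1)[symmetric]]]) (use 1 zero in simp)
      next
        case 2
        show ?thesis by (rule main[OF trans[OF P2_def[symmetric] powers(2)[symmetric]]]) (use 2 residues in simp)
      next
        case 3
        show ?thesis by (rule main[OF trans[OF P3_def[symmetric] powers(3)[symmetric]]]) (use 3 residues in simp)
      qed
    qed
  qed
qed

lemma torsion_iso: "torsion_subgroup \<E> \<cong> integer_mod_group 7"
proof (rule points.torsion_subgroup_cyclic[OF P_carrier])
  show "P [^]\<^bsub>\<E>\<^esub> (7::nat) = \<one>\<^bsub>\<E>\<^esub>" unfolding one_points by (rule powers)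
  show "P [^]\<^bsub>\<E>\<^esub> k \<noteq> \<one>\<^bsub>\<E>\<^esub>" if "0 < k" "k < 7" for k :: nat
    unfolding one_points by (rule order_P[OF that])
  show "\<exists>k::nat. T = P [^]\<^bsub>\<E>\<^esub> k" if "T \<in> carrier \<E>" "m > 0" "T [^]\<^bsub>\<E>\<^esub> m = \<one>\<^bsub>\<E>\<^esub>" for T and m :: nat
    using torsion_generated[OF that(1,2)] that(3) unfolding one_points by blast
qed simp

text \<open>Expanded in \<open>d = u - v\<close>, the leading term of \<open>b2\<close> is
  \<open>26 v^3 d\<close> of valuation \<open>2 / 3\<close>; each remaining term carries a factor 3
  or \<open>d^2\<close>.\<close>

lemma P_not_rational: assumes "Affine x y = P" "x \<in> \<rat>" shows False
proof -
  define d where "d = u - v"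
  have u: "u = v + d" by (simp add: d_def)
  have vd: "veq (2 / 3) d" using val_diff by (simp add: d_def)
  have i: "veq 0 26" "veq 1 3" using veq_of_int[of 26] veq_3 by simp_all
  have "b2 = 26 * v ^ 3 * d + (3 * (3 * v ^ 4) + (3 * (9 * v ^ 2 * d ^ 2) + d * d * (10 * v * d + d * d)))"
    unfolding b2 a1 sum0 u by (simp add: eval_nat_numeral algebra_simps)
  moreover have "veq (2 / 3) (26 * v ^ 3 * d + (3 * (3 * v ^ 4) + (3 * (9 * v ^ 2 * d ^ 2) + d * d * (10 * v * d + d * d))))"
  proof (intro veq_add vgt_add)
    have "veq (0 + of_nat 3 * 0 + 2 / 3) (26 * v ^ 3 * d)" by (intro veq_mult veq_power i val_v vd)
    thus "veq (2 / 3) (26 * v ^ 3 * d)" by simp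
    have d0: "vge 0 d" and v0: "vge 0 v" using vd val_v by (auto intro: veq_vge)
    have m: "vge 0 (x * y)" if "vge 0 x" "vge 0 y" for x y using vge_mult[OF that] by simp
    have p: "vge 0 (x ^ k)" if "vge 0 x" for x k using vge_power[OF that] by simp
    have n: "vge 0 (numeral k)" for k using vge_of_int[of "numeral k"] by simp
    have three: "vgt (2 / 3) (3 * x)" if "vge 0 x" for x
      by (rule vge_vgt[OF vge_mult[OF veq_vge[OF veq_3 order_refl] that]]) simp
    show "vgt (2 / 3) (3 * (3 * v ^ 4))" "vgt (2 / 3) (3 * (9 * v ^ 2 * d ^ 2))"
      by (intro three m p n v0 d0)+
    have "vge 0 (10 * v * d + d * d)" by (intro vge_add m n v0 d0)
    thus "vgt (2 / 3) (d * d * (10 * v * d + d * d))"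
      by (rule vge_vgt[OF vge_mult[OF veq_vge[OF veq_mult[OF vd vd] order_refl]]]) simp
  qed
  ultimately have b: "veq (2 / 3) b2" by simp
  have "x = b2 / 3" using assms(1) unfolding P_def by blast
  hence "b2 = 3 * x" by (metis nonzero_mult_div_cancel_left times_divide_eq_right zero_neq_numeral)
  hence "b2 \<in> \<rat>" using assms(2) by simp
  then obtain k :: int where "veq (of_int k) b2" using veq_Rats veq_nonzero[OF b] by blast
  hence "of_int k = (2 / 3 :: real)" using b veq_unique by blast
  hence "real_of_int (3 * k) = of_int 2" by simp
  hence "3 * k = 2" by (simp only: of_int_eq_iff)
  thus False by presburger
qed

end

section \<open>Infinitely many j-invariants\<close>

text \<open>The condition at \<open>z\<close> excludes that \<open>N - j D\<close> vanishes identically for some \<open>j\<close>.\<close>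

lemma infinite_quotients:
  fixes S :: "rat set" and N D :: "complex poly" and g :: "nat \<Rightarrow> complex"
  assumes g: "inj g" and ex: "\<And>k. \<exists>j\<in>S. of_rat j * poly D (g k) = poly N (g k)"
    and z: "poly D z = 0" "poly N z \<noteq> 0"
  shows "infinite S"
proof
  assume S: "finite S"
  have "finite (g -` {y. poly (N - smult (of_rat j) D) y = 0})" for j
  proof -
    have "poly (N - smult (of_rat j) D) z \<noteq> 0" using z by simp
    hence "N - smult (of_rat j) D \<noteq> 0" by auto
    thus ?thesis using g by (intro finite_vimageI poly_roots_finite)
  qed
  hence "finite (\<Union>j\<in>S. g -` {y. poly (N - smult (of_rat j) D) y = 0})" using S by blast
  moreover have "(UNIV :: nat set) \<subseteq> (\<Union>j\<in>S. g -` {y. poly (N - smult (of_rat j) D) y = 0})"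
  proof
    fix k :: nat
    obtain j where "j \<in> S" "of_rat j * poly D (g k) = poly N (g k)" using ex by blast
    thus "k \<in> (\<Union>j\<in>S. g -` {y. poly (N - smult (of_rat j) D) y = 0})"
      by (intro UN_I[of j]) simp_all
  qed
  ultimately show False using finite_subset infinite_UNIV_nat by blast
qed

section \<open>Base fields and descent of the torsion to the rationals\<close>

lemma Q_infinity_3_closed:
  "1 \<in> Q_infinity_3" "x \<in> Q_infinity_3 \<Longrightarrow> - x \<in> Q_infinity_3"
  "x \<in> Q_infinity_3 \<Longrightarrow> y \<in> Q_infinity_3 \<Longrightarrow> x + y \<in> Q_infinity_3"
  "x \<in> Q_infinity_3 \<Longrightarrow> y \<in> Q_infinity_3 \<Longrightarrow> x * y \<in> Q_infinity_3"
  "x \<in> Q_infinity_3 \<Longrightarrow> x \<noteq> 0 \<Longrightarrow> inverse x \<in> Q_infinity_3"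
  by (auto simp: Q_infinity_3_eq intro: K3_closed)

lemma Rats_Q_infinity_3: "x \<in> \<rat> \<Longrightarrow> x \<in> Q_infinity_3"
  unfolding Q_infinity_3_eq by (auto simp: Reals_cnj_iff intro: K3_rat cnj_rat)

lemma cubic_over_KcycI:
  assumes "a \<in> Q_infinity_3" "b \<in> Q_infinity_3" "c \<in> Q_infinity_3" "nonsingular_cubic a b c"
  shows "cubic_over_Kcyc a b c Q_infinity_3"
proof -
  interpret nonsingular_cubic a b c by fact
  show ?thesis
    by unfold_locales (use assms Q_infinity_3_closed Q_infinity_3_Kcyc in auto)
qed

lemma cubic_over_Rats:
  assumes "a \<in> \<rat>" "b \<in> \<rat>" "c \<in> \<rat>" "nonsingular_cubic a b c"
  shows "cubic_over_subfield a b c (\<rat> :: 'a::field_char_0 set)"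
proof -
  interpret nonsingular_cubic a b c by fact
  show ?thesis by unfold_locales (use assms in auto)
qed

lemma rational_points_mono:
  "K \<subseteq> L \<Longrightarrow> carrier (rational_points E K) \<subseteq> carrier (rational_points E L)"
  by (auto simp: rational_points_def)

lemma power_one_rational: "\<one>\<^bsub>rational_points E K\<^esub> = Origin"
  by (simp add: rational_points_def)

text \<open>If a multiple of a point is rational and prime to its order, so is the point.\<close>

lemma (in cubic_over_subfield) recover_generator:
  assumes P: "P \<in> carrier \<E>" "P [^]\<^bsub>\<E>\<^esub> (n::nat) = Origin" and k: "coprime k n" and n: "n > 1"
    and L: "cubic_over_subfield a b c L" and T: "P [^]\<^bsub>\<E>\<^esub> (k::nat) \<in> carrier (rational_points (cubic_model a b c) L)"
  shows "P \<in> carrier (rational_points (cubic_model a b c) L)"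
proof -
  interpret L: cubic_over_subfield a b c L by fact
  let ?L = "rational_points (cubic_model a b c) L"
  obtain i where i: "[k * i = 1] (mod n)" using cong_solve_coprime_nat[OF k] by auto
  have "(P [^]\<^bsub>\<E>\<^esub> k) [^]\<^bsub>\<E>\<^esub> i = P [^]\<^bsub>\<E>\<^esub> (k * i mod n)"
    unfolding points.nat_pow_pow[OF P(1)]
    by (rule points.nat_pow_mod[symmetric]) (use P one_points in auto)
  also have "k * i mod n = 1" using i n by (simp add: cong_def)
  also have "P [^]\<^bsub>\<E>\<^esub> (1::nat) = P" using P(1) by (rule points.nat_pow_eone)
  finally have "(P [^]\<^bsub>\<E>\<^esub> k) [^]\<^bsub>\<E>\<^esub> i = P" .
  moreover have "(P [^]\<^bsub>\<E>\<^esub> k) [^]\<^bsub>?L\<^esub> i = (P [^]\<^bsub>\<E>\<^esub> k) [^]\<^bsub>\<E>\<^esub> i" by (rule ec_pow_cong)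
  ultimately have "(P [^]\<^bsub>\<E>\<^esub> k) [^]\<^bsub>?L\<^esub> i = P" by simp
  thus ?thesis using L.points.nat_pow_closed[OF T, of i] by simp
qed

context seven_torsion_curve
begin

lemma rational_torsion: "carrier (torsion_subgroup (rational_points (cubic_model 0 A B) \<rat>)) = {Origin}"
proof -
  let ?R = "rational_points (cubic_model 0 A B) \<rat>"
  have R: "cubic_over_subfield 0 A B \<rat>"
    by (rule cubic_over_Rats) (use A7 B7 nonsingular_cubic_axioms in auto)
  interpret R: cubic_over_subfield 0 A B \<rat> by (rule R)
  have "T = Origin" if T: "T \<in> carrier ?R" "m > 0" "T [^]\<^bsub>?R\<^esub> (m::nat) = Origin" for T m
  proof -
    have "T \<in> carrier \<E>" using T(1) rational_points_mono[of \<rat> Q_infinity_3] Rats_Q_infinity_3 by blast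
    moreover have "T [^]\<^bsub>\<E>\<^esub> m = T [^]\<^bsub>?R\<^esub> m" by (rule ec_pow_cong)
    hence "T [^]\<^bsub>\<E>\<^esub> m = Origin" using T(3) by simp
    ultimately obtain k :: nat where k: "T = P [^]\<^bsub>\<E>\<^esub> k" using torsion_generated T(2) by blast
    show ?thesis
    proof (cases "7 dvd k")
      case True
      then obtain i where i: "k = 7 * i" by blast
      show ?thesis unfolding k i points.nat_pow_pow[OF P_carrier, symmetric] powers(5)
        unfolding one_points[symmetric] by (rule points.nat_pow_one)
    next
      case False
      hence "coprime 7 k" by (intro prime_imp_coprime_nat) simp_all
      hence "coprime k 7" by (simp only: coprime_commute)
      hence "P \<in> carrier ?R"
        using recover_generator[OF P_carrier powers(5) _ _ R] T(1) k by simp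
      hence "b2 / 3 \<in> \<rat>" unfolding P_def R.carrier_Affine by blast
      thus ?thesis using P_not_rational[OF P_def[symmetric]] by blast
    qed
  qed
  moreover have "Origin [^]\<^bsub>?R\<^esub> (1::nat) = Origin" using R.points.nat_pow_eone[OF R.carrier_Origin] .
  ultimately show ?thesis
    unfolding torsion_subgroup_def using R.carrier_Origin
    by (auto simp: power_one_rational intro!: exI[of _ "1::nat"])
qed

end

context nine_torsion_curve
begin

lemma rational_torsion:
  "torsion_subgroup (rational_points (cubic_model (te ^ 2) (8 * te * ee ^ 3) (16 * ee ^ 6)) \<rat>)
    \<cong> integer_mod_group 3"
proof -
  let ?R = "rational_points (cubic_model (te ^ 2) (8 * te * ee ^ 3) (16 * ee ^ 6)) \<rat>"
  have R: "cubic_over_subfield (te ^ 2) (8 * te * ee ^ 3) (16 * ee ^ 6) \<rat>"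
    by (rule cubic_over_Rats) (use nonsingular_cubic_axioms in auto)
  interpret R: cubic_over_subfield "te ^ 2" "8 * te * ee ^ 3" "16 * ee ^ 6" \<rat> by (rule R)
  have P3: "P3 \<in> carrier ?R"
    unfolding P3_def R.carrier_Affine using carrier_on[OF P3_carrier] unfolding P3_def by simp
  have pow: "T [^]\<^bsub>?R\<^esub> (k::nat) = T [^]\<^bsub>\<E>\<^esub> k" for T k by (rule ec_pow_cong)
  show ?thesis
  proof (rule R.points.torsion_subgroup_cyclic[OF P3])
    have "(P [^]\<^bsub>\<E>\<^esub> (3::nat)) [^]\<^bsub>\<E>\<^esub> (3::nat) = P [^]\<^bsub>\<E>\<^esub> (3 * 3 :: nat)"
      by (rule points.nat_pow_pow[OF P_carrier])
    thus "P3 [^]\<^bsub>?R\<^esub> (3::nat) = \<one>\<^bsub>?R\<^esub>" unfolding pow pow3_P power_one_rational using pow9_P by simp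
    show "P3 [^]\<^bsub>?R\<^esub> k \<noteq> \<one>\<^bsub>?R\<^esub>" if "0 < k" "k < 3" for k :: nat
    proof -
      have "(P [^]\<^bsub>\<E>\<^esub> (3::nat)) [^]\<^bsub>\<E>\<^esub> k = P [^]\<^bsub>\<E>\<^esub> (3 * k)"
        by (rule points.nat_pow_pow[OF P_carrier])
      thus ?thesis unfolding pow power_one_rational pow3_P using order_P[of "3 * k"] that by simp
    qed
    show "\<exists>k::nat. T = P3 [^]\<^bsub>?R\<^esub> k" if T: "T \<in> carrier ?R" "m > 0" "T [^]\<^bsub>?R\<^esub> m = \<one>\<^bsub>?R\<^esub>" for T and m :: nat
    proof -
      have "T \<in> carrier \<E>" using T(1) rational_points_mono[of \<rat> Q_infinity_3] Rats_Q_infinity_3 by blast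
      then obtain k :: nat where k: "T = P [^]\<^bsub>\<E>\<^esub> k"
        using torsion_generated T(2,3) unfolding pow power_one_rational by blast
      show ?thesis
      proof (cases "3 dvd k")
        case True
        then obtain i where i: "k = 3 * i" by blast
        have "T = P3 [^]\<^bsub>\<E>\<^esub> i" unfolding k i points.nat_pow_pow[OF P_carrier, symmetric] pow3_P by (rule refl)
        thus ?thesis unfolding pow by blast
      next
        case False
        hence "coprime 3 k" by (intro prime_imp_coprime_nat) simp_all
        hence "coprime k (3 ^ 2)" by (metis coprime_commute coprime_power_right_iff)
        hence "P \<in> carrier ?R"
          using recover_generator[OF P_carrier pow9_P _ _ R] T(1) k by simp
        thus ?thesis using P_not_rational[OF P_def[symmetric]] unfolding P_def R.carrier_Affine by blast
      qed
    qed
  qed simp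
qed

end

section \<open>Arithmetic of the family and its two curves\<close>

context trace_zero_family
begin

definition s :: int where "s = n ^ 3 - 3 * n + 1"
text \<open>The covariants of the Tate curve with parameters \<open>u\<close>, \<open>v\<close>, \<open>w\<close>, written in their symmetric
  functions and the root \<open>dl\<close> of the discriminant.\<close>

definition C4 :: int where "C4 = e2 * (e2 ^ 3 - 4 * e ^ 2 - 4 * e * dl)"
definition C6 :: int where "C6 = e2 ^ 3 * (30 * e ^ 2 + 6 * e * dl - e2 ^ 3) + 4 * e ^ 3 * (27 * e + dl)"

lemma uvw_cyc: "u \<in> cyc 2" "v \<in> cyc 2" "w \<in> cyc 2"
  unfolding u_def v_def w_def by (intro cyc_intros cub_cyc)+

lemma uvw_mem: "u \<in> Q_infinity_3" "v \<in> Q_infinity_3" "w \<in> Q_infinity_3"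
  using uvw_cyc[THEN cyc_K3] cub_Reals by (auto simp: Q_infinity_3_eq u_def v_def w_def)

lemma n_cases: obtains k where "n = 3 + 201243 * k"
proof
  show "n = 3 + 201243 * (n div 201243)" using n mult_div_mod_eq[of 201243 n] by simp
qed

lemma mod_three: "\<not> 3 dvd e" "\<exists>d. dl = 9 * d \<and> \<not> 3 dvd d" "3 dvd t" "t - 3 * e = 9 * s" "\<not> 3 dvd s"
proof -
  obtain k where "n = 3 + 201243 * k" by (rule n_cases)
  define m where "m = 1 + 67081 * k"
  have m: "n = 3 * m" by (simp add: \<open>n = _\<close> m_def)
  have "e = 3 * (6 * m - 9 * m ^ 2 - 9 * m ^ 3) - 1"
    unfolding e_def unfolding m by (simp add: power2_eq_square power3_eq_cube algebra_simps)
  thus "\<not> 3 dvd e" by presburger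
  have "dl = 9 * (3 * (9 * m ^ 2 - 9 * m ^ 3) - 1)"
    unfolding dl_def unfolding m by (simp add: power2_eq_square power3_eq_cube algebra_simps)
  moreover have "\<not> 3 dvd 3 * (9 * m ^ 2 - 9 * m ^ 3) - 1" by presburger
  ultimately show "\<exists>d. dl = 9 * d \<and> \<not> 3 dvd d" by blast
  show "3 dvd t" unfolding t_def by presburger
  show "t - 3 * e = 9 * s" unfolding t_def e_def s_def by simp
  have "s = 3 * (9 * m ^ 3 - 3 * m) + 1" unfolding s_def unfolding m by (simp add: power3_eq_cube)
  thus "\<not> 3 dvd s" by presburger
qed

lemma mod_two: "even t" "odd e"
  unfolding t_def e_def by (cases "even n"; simp)+

text \<open>At \<open>n = 3\<close> the value of \<open>e\<close> is -37, and the congruence on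
  \<open>n\<close> modulo \<open>37 ^ 2\<close> keeps it modulo \<open>37 ^ 2\<close>.\<close>

lemma mod_37: "37 dvd e" "\<not> 37 ^ 2 dvd e"
proof -
  obtain k where "n = 3 + 201243 * k" by (rule n_cases)
  define m where "m = 147 * k"
  have m: "n = 3 + 1369 * m" by (simp add: \<open>n = _\<close> m_def)
  define x where "x = 6 * m - 3 * (6 * m + 1369 * m ^ 2) - (27 * m + 12321 * m ^ 2 + 1874161 * m ^ 3)"
  have x: "e = 37 * (37 * x - 1)"
    unfolding e_def unfolding m x_def by (simp add: power2_eq_square power3_eq_cube algebra_simps)
  thus "37 dvd e" by simp
  have "\<not> 37 dvd 37 * x - 1" by presburger
  thus "\<not> 37 ^ 2 dvd e" unfolding x power2_eq_square by (subst dvd_mult_cancel_left) simp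
qed

text \<open>Since 7 divides \<open>e2\<close>, the first summand of \<open>C6\<close> is divisible
  by 343. In the second, \<open>e\<close> is prime to 7 and \<open>27 e + dl\<close>, congruent to
  \<open>-7 * 144\<close> modulo 49, contains 7 exactly once.\<close>

lemma mod_seven: "7 dvd C4" "7 dvd C6" "\<not> 49 dvd C6"
proof -
  obtain k where k: "n = 3 + 201243 * k" by (rule n_cases)
  define m where "m = 4107 * k"
  have m: "n = 3 + 49 * m" by (simp add: k m_def)
  define r where "r = - 3 - 105 * m - 1029 * m ^ 2"
  have r: "e2 = 7 * r"
    unfolding e2_def unfolding m r_def by (simp add: power2_eq_square algebra_simps)
  define x where "x = 162 * m - 54 * (6 * m + 49 * m ^ 2) - 36 * (27 * m + 441 * m ^ 2 + 2401 * m ^ 3)"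
  have x: "27 * e + dl = 7 * (7 * x - 144)"
    unfolding e_def dl_def unfolding m x_def by (simp add: power2_eq_square power3_eq_cube algebra_simps)
  define z where "z = 7 * (6 * m - 3 * (6 * m + 49 * m ^ 2) - (27 * m + 441 * m ^ 2 + 2401 * m ^ 3)) - 6"
  have "e = 7 * z + 5"
    unfolding e_def unfolding m z_def by (simp add: power2_eq_square power3_eq_cube algebra_simps)
  hence e7: "\<not> 7 dvd e" by presburger
  have "C4 = 7 * (r * (e2 ^ 3 - 4 * e ^ 2 - 4 * e * dl))" unfolding C4_def by (simp only: r mult.assoc)
  thus "7 dvd C4" by (simp only: dvd_triv_left)
  define y where "y = r ^ 3 * (30 * e ^ 2 + 6 * e * dl - e2 ^ 3)"
  have C6: "C6 = 7 * (7 * (7 * y) + 4 * e ^ 3 * (7 * x - 144))"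
  proof -
    have "e2 ^ 3 * w = 7 * (7 * (7 * (r ^ 3 * w)))" for w unfolding r by (simp add: power_mult_distrib)
    thus ?thesis unfolding C6_def x y_def by (simp only: distrib_left)
  qed
  thus "7 dvd C6" by (simp only: dvd_triv_left)
  have p7: "Factorial_Ring.prime (7::int)" by simp
  have "\<not> 7 dvd 7 * x - 144" by presburger
  moreover have "\<not> 7 dvd e ^ 3" using e7 prime_dvd_power[OF p7] by blast
  moreover have "\<not> 7 dvd (4 :: int)" by presburger
  ultimately have "\<not> 7 dvd 4 * e ^ 3 * (7 * x - 144)" by (simp only: prime_dvd_mult_iff[OF p7] simp_thms)
  hence "\<not> 7 dvd 7 * (7 * y) + 4 * e ^ 3 * (7 * x - 144)" unfolding dvd_add_right_iff[OF dvd_triv_left] .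
  hence "\<not> 7 * 7 dvd C6" unfolding C6 by (subst dvd_mult_cancel_left) simp
  thus "\<not> 49 dvd C6" by simp
qed

lemma val_e: "veq 0 (of_int e)" and val_dl: "veq 2 (of_int dl)"
proof -
  show "veq 0 (of_int e)" using mod_three(1) by (rule veq_of_int)
  obtain d where "dl = 9 * d" "\<not> 3 dvd d" using mod_three(2) by blast
  thus "veq 2 (of_int dl)" using veq_3_power[of d 2] by simp
qed

lemma val_uvw: "veq 0 u" "veq 0 v" "veq 0 w"
proof -
  have nz: "u \<noteq> 0" "v \<noteq> 0" "w \<noteq> 0" using prod veq_nonzero[OF val_e] by auto
  obtain a b c where *: "veq a u" "veq b v" "veq c w"
    using veq_cases uvw_cyc[THEN cyc_K3] nz by metis
  have ge: "a \<ge> 0" "b \<ge> 0" "c \<ge> 0"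
    using vge_cycs[OF cycs_cyc] uvw_cyc vge_veqD * by metis+
  have "veq (a + b + c) (of_int e)" unfolding prod[symmetric] by (intro veq_mult *)
  hence "a + b + c = 0" using val_e veq_unique by blast
  hence "a = 0" "b = 0" "c = 0" using ge by auto
  thus "veq 0 u" "veq 0 v" "veq 0 w" using * by auto
qed

text \<open>Up to a unit factor, the other two differences differ from \<open>u - v\<close> by a
  multiple of 3, so all three have one common valuation if it is below 1; their product
  \<open>dl\<close> has valuation 2.\<close>

lemma val_diff: "veq (2 / 3) (u - v)"
proof -
  have eq: "v - w = (u - v) + 3 * v" "w - u = - (2 * (u - v)) - 3 * v" by (simp_all add: w_eq)
  have d: "(u - v) * (v - w) * (w - u) = of_int dl" by (rule diffs)
  have dK: "u - v \<in> Kcyc" using cyc_K3[OF cyc_minus[OF uvw_cyc(1,2)]] .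
  have v3: "veq 1 (3 * v)" using veq_mult[OF veq_3 val_uvw(2)] by simp
  have two: "veq 0 2" using veq_of_int[of 2] by simp
  show ?thesis
  proof (cases "vge 1 (u - v)")
    case True
    have "vge 1 (v - w)" unfolding eq by (intro vge_add True veq_vge[OF v3 order_refl])
    moreover have "vge 1 (w - u)" unfolding eq
      using vge_mult[OF veq_vge[OF two order_refl] True]
      by (intro vge_minus vge_uminus veq_vge[OF v3 order_refl]) simp
    ultimately have "vge (1 + 1 + 1) (of_int dl)" unfolding d[symmetric] by (intro vge_mult True)
    hence "(1 + 1 + 1 :: real) \<le> 2" using val_dl by (rule vge_veqD)
    thus ?thesis by simp
  next
    case False
    then obtain q where q: "q < 1" "veq q (u - v)" using not_vge dK by blast
    have "veq q (v - w)" unfolding eq by (intro veq_add q veq_vgt[OF v3])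
    moreover have "veq q (w - u)" unfolding eq
    proof (intro veq_minus veq_vgt[OF v3] q(1))
      have "veq (0 + q) (2 * (u - v))" by (rule veq_mult[OF two q(2)])
      thus "veq q (- (2 * (u - v)))" unfolding veq_uminus by simp
    qed
    ultimately have "veq (q + q + q) (of_int dl)" unfolding d[symmetric] by (intro veq_mult q)
    hence "q + q + q = 2" using val_dl veq_unique by blast
    hence "q = 2 / 3" by simp
    thus ?thesis using q(2) by (simp only:)
  qed
qed

lemma disc_nine: "discriminant (cubic_model (x ^ 2) (8 * x * y ^ 3) (16 * y ^ 6)) = 4096 * y ^ 9 * (x ^ 3 - 27 * y ^ 3)"
  for x y :: "'a::field"
  unfolding discriminant_cubic_model by (simp add: eval_nat_numeral algebra_simps)

lemma c4_cubic_model: "c4 (cubic_model a b c) = 16 * (a ^ 2 - 3 * b)" for a b c :: "'a::field"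
  by (simp add: c4_def b2_def b4_def power2_eq_square algebra_simps)

lemma e_nonzero: "e \<noteq> 0" using mod_three(1) by auto

text \<open>With \<open>t = 3 e + 9 s\<close> the difference is
  \<open>243 s (e^2 + 3 (...))\<close>, and neither \<open>s\<close> nor \<open>e\<close> is
  divisible by 3.\<close>

lemma te_nonzero: "t ^ 3 \<noteq> 27 * e ^ 3"
proof
  assume "t ^ 3 = 27 * e ^ 3"
  moreover have t: "t = 3 * e + 9 * s" using mod_three(4) by simp
  have "t ^ 3 = 27 * e ^ 3 + 243 * (s * (e ^ 2 + 3 * (e * s + s ^ 2)))"
    unfolding t by (simp add: power2_eq_square power3_eq_cube algebra_simps)
  ultimately have "s = 0 \<or> e ^ 2 + 3 * (e * s + s ^ 2) = 0" by simp
  moreover have "s \<noteq> 0" using mod_three(5) by auto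
  moreover have "\<not> 3 dvd e ^ 2" using mod_three(1) prime_dvd_power[of 3 e 2] by auto
  hence "e ^ 2 + 3 * (e * s + s ^ 2) \<noteq> 0" by presburger
  ultimately show False by blast
qed

lemma nine: "nine_torsion_curve t e u v w s 37"
proof -
  have "discriminant (cubic_model (of_int t ^ 2) (8 * of_int t * of_int e ^ 3) (16 * of_int e ^ 6) :: complex weierstrass)
      = of_int (4096 * e ^ 9 * (t ^ 3 - 27 * e ^ 3))"
    unfolding disc_nine by simp
  also have "\<dots> \<noteq> 0" using te_nonzero e_nonzero by (simp only: of_int_eq_0_iff) simp
  finally have "cubic_over_Kcyc (of_int t ^ 2) (8 * of_int t * of_int e ^ 3) (16 * of_int e ^ 6) Q_infinity_3"
    by (intro cubic_over_KcycI nonsingularI Rats_Q_infinity_3) auto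
  moreover have "nine_torsion_curve_axioms t e u v w s 37"
    using uvw_mem val_uvw val_diff mod_three mod_two mod_37 prod cyclic w_eq
    by (intro nine_torsion_curve_axioms.intro) auto
  ultimately show ?thesis by (rule nine_torsion_curve.intro)
qed

lemma nine_curve:
  "\<exists>E :: rat weierstrass. elliptic_curve E
     \<and> j_invariant E = of_int (t ^ 3 * (t ^ 3 - 24 * e ^ 3) ^ 3) / of_int (e ^ 9 * (t ^ 3 - 27 * e ^ 3))
     \<and> torsion_points E \<rat> \<cong> integer_mod_group 3 \<and> torsion_points E Q_infinity_3 \<cong> integer_mod_group 9"
proof (intro exI conjI)
  let ?E = "cubic_model (of_int t ^ 2) (8 * of_int t * of_int e ^ 3) (16 * of_int e ^ 6) :: rat weierstrass"
  interpret nine_torsion_curve t e u v w s 37 by (rule nine)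
  have disc: "discriminant ?E = 4096 * of_int (e ^ 9 * (t ^ 3 - 27 * e ^ 3))"
    unfolding disc_nine by simp
  have nz: "e ^ 9 * (t ^ 3 - 27 * e ^ 3) \<noteq> 0" using te_nonzero e3 by auto
  show "elliptic_curve ?E" unfolding elliptic_curve_def disc using nz by (simp only: of_int_eq_0_iff mult_eq_0_iff) simp
  have "c4 ?E = 16 * of_int (t * (t ^ 3 - 24 * e ^ 3))"
    unfolding c4_cubic_model by (simp add: eval_nat_numeral algebra_simps)
  hence "c4 ?E ^ 3 = 4096 * of_int (t ^ 3 * (t ^ 3 - 24 * e ^ 3) ^ 3)"
    by (simp add: power_mult_distrib)
  thus "j_invariant ?E = of_int (t ^ 3 * (t ^ 3 - 24 * e ^ 3) ^ 3) / of_int (e ^ 9 * (t ^ 3 - 27 * e ^ 3))"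
    unfolding j_invariant_def disc by (simp only: mult_divide_mult_cancel_left)
  have map: "map_weierstrass of_rat ?E = cubic_model (te ^ 2) (8 * te * ee ^ 3) (16 * ee ^ 6)"
    by (simp add: of_rat_mult of_rat_power)
  show "torsion_points ?E \<rat> \<cong> integer_mod_group 3"
    unfolding torsion_points_def map by (rule rational_torsion)
  show "torsion_points ?E Q_infinity_3 \<cong> integer_mod_group 9"
    unfolding torsion_points_def map by (rule torsion_iso)
qed

text \<open>The discriminant of \<open>X^3 + e2 X - e\<close>, whose roots are \<open>u\<close>,
  \<open>v\<close>, \<open>w\<close>.\<close>

lemma dl_square: "dl ^ 2 = - (27 * e ^ 2) - 4 * e2 ^ 3"
  unfolding dl_def e_def e2_def by (simp add: power2_eq_square power3_eq_cube algebra_simps)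

text \<open>The left-hand side is 1728 times the discriminant of the scaled Tate form, which is
  therefore \<open>- e^7 (13 e + dl) / 2\<close>.\<close>

lemma seven_discriminant: "C4 ^ 3 - C6 ^ 2 = - 864 * (e ^ 7 * (13 * e + dl))"
proof -
  \<comment> \<open>\<open>x\<close> stands for \<open>e2 ^ 3\<close>, eliminated through
    \<open>dl_square\<close>; solving for it divides by 4, hence the passage to rationals.\<close>
  have aux: "x * (x - 4 * y ^ 2 - 4 * y * z) ^ 3 - (x * (30 * y ^ 2 + 6 * y * z - x) + 4 * y ^ 3 * (27 * y + z)) ^ 2
      = - 864 * (y ^ 7 * (13 * y + z))" if "x = - (27 * y ^ 2 + z ^ 2) / 4" for x y z :: rat
    unfolding that by (simp add: eval_nat_numeral field_simps)
  have "(of_int (e2 ^ 3) :: rat) = - (27 * of_int e ^ 2 + of_int dl ^ 2) / 4"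
    using arg_cong[OF dl_square, of "of_int :: int \<Rightarrow> rat"] by (simp add: field_simps)
  note aux[OF this]
  hence "(of_int (C4 ^ 3 - C6 ^ 2) :: rat) = of_int (- 864 * (e ^ 7 * (13 * e + dl)))"
    unfolding C4_def C6_def by (simp add: power_mult_distrib)
  thus ?thesis by (simp only: of_int_eq_iff)
qed

lemma seven: "seven_torsion_curve (- of_int C4 / 3) (- 2 * of_int C6 / 27) u v w
   (v ^ 2 - u * v - u ^ 2) (- (u ^ 2 * v ^ 3 * w)) ((v ^ 2 - u * v - u ^ 2) ^ 2 - 4 * u ^ 2 * v * w) C4 C6"
  (is "seven_torsion_curve ?A ?B u v w ?a1 ?a3 ?b2 C4 C6")
proof -
  have nz: "e ^ 7 * (13 * e + dl) \<noteq> 0"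
  proof -
    obtain d where "dl = 9 * d" using mod_three(2) by blast
    hence "13 * e + dl \<noteq> 0" using mod_three(1) by presburger
    thus ?thesis using e_nonzero by simp
  qed
  have "discriminant (cubic_model 0 ?A ?B) = 64 / 27 * of_int (C4 ^ 3 - C6 ^ 2)"
    unfolding discriminant_cubic_model by (simp add: power2_eq_square power3_eq_cube field_simps)
  also have "\<dots> \<noteq> 0" unfolding seven_discriminant using nz
    by (simp only: of_int_eq_0_iff mult_eq_0_iff) simp
  finally have "cubic_over_Kcyc 0 ?A ?B Q_infinity_3"
    by (intro cubic_over_KcycI nonsingularI Rats_Q_infinity_3) auto
  moreover have "seven_torsion_curve_axioms ?A ?B u v w ?a1 ?a3 ?b2 C4 C6"
  proof (rule seven_torsion_curve_axioms.intro)
    have E: "of_int e = - (u ^ 2 * v + u * v ^ 2)"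
      unfolding prod[symmetric] w_eq by (simp add: power2_eq_square algebra_simps)
    have E2: "of_int e2 = - (u ^ 2 + u * v + v ^ 2)"
      unfolding sym2[symmetric] w_eq by (simp add: power2_eq_square algebra_simps)
    have DL: "of_int dl = 3 * u * v ^ 2 + 2 * v ^ 3 - 2 * u ^ 3 - 3 * u ^ 2 * v"
      unfolding diffs[symmetric] w_eq by (simp add: power2_eq_square power3_eq_cube algebra_simps)
    have c4: "of_int C4 = ?b2 ^ 2 - 24 * (?a1 * ?a3)"
      unfolding C4_def of_int_mult of_int_diff of_int_power of_int_numeral E E2 DL w_eq
      by (simp add: eval_nat_numeral algebra_simps)
    have c6: "of_int C6 = 36 * ?b2 * (?a1 * ?a3) - ?b2 ^ 3 - 216 * ?a3 ^ 2"
      unfolding C6_def of_int_mult of_int_diff of_int_add of_int_power of_int_numeral E E2 DL w_eq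
      by (simp add: eval_nat_numeral algebra_simps)
    show "?A = 8 * (?a1 * ?a3) - ?b2 ^ 2 / 3" unfolding c4 by (simp add: field_simps)
    show "?B = 16 * ?a3 ^ 2 - 8 * (?a1 * ?a3) * ?b2 / 3 + 2 * ?b2 ^ 3 / 27" unfolding c6 by (simp add: field_simps)
  qed (use uvw_mem val_uvw val_diff mod_seven w_eq in auto)
  ultimately show ?thesis by (rule seven_torsion_curve.intro)
qed

lemma seven_curve:
  "\<exists>E :: rat weierstrass. elliptic_curve E
     \<and> j_invariant E = of_int (- 2 * C4 ^ 3) / of_int (e ^ 7 * (13 * e + dl))
     \<and> carrier (torsion_points E \<rat>) = {Origin} \<and> torsion_points E Q_infinity_3 \<cong> integer_mod_group 7"
proof (intro exI conjI)
  let ?E = "cubic_model 0 (- of_int C4 / 3) (- 2 * of_int C6 / 27) :: rat weierstrass"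
  interpret seven_torsion_curve "- of_int C4 / 3" "- 2 * of_int C6 / 27" u v w
   "v ^ 2 - u * v - u ^ 2" "- (u ^ 2 * v ^ 3 * w)" "(v ^ 2 - u * v - u ^ 2) ^ 2 - 4 * u ^ 2 * v * w" C4 C6
    by (rule seven)
  have "discriminant ?E = 64 / 27 * of_int (C4 ^ 3 - C6 ^ 2)"
    unfolding discriminant_cubic_model by (simp add: power2_eq_square power3_eq_cube field_simps)
  hence disc: "discriminant ?E = 2048 * - of_int (e ^ 7 * (13 * e + dl))"
    unfolding seven_discriminant by simp
  obtain d where "dl = 9 * d" using mod_three(2) by blast
  hence "13 * e + dl \<noteq> 0" using mod_three(1) by presburger
  hence nz: "e ^ 7 * (13 * e + dl) \<noteq> 0" using e_nonzero by simp
  show "elliptic_curve ?E" unfolding elliptic_curve_def disc using nz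
    by (simp only: of_int_eq_0_iff mult_eq_0_iff neg_equal_0_iff_equal) simp
  have "c4 ?E ^ 3 = 2048 * - of_int (- 2 * C4 ^ 3)"
    unfolding c4_cubic_model by (simp add: power_mult_distrib)
  thus "j_invariant ?E = of_int (- 2 * C4 ^ 3) / of_int (e ^ 7 * (13 * e + dl))"
    unfolding j_invariant_def disc by (simp add: minus_divide_divide)
  have map: "map_weierstrass of_rat ?E = cubic_model 0 (- of_int C4 / 3) (- 2 * of_int C6 / 27)"
    by (simp add: of_rat_mult of_rat_divide of_rat_minus)
  show "carrier (torsion_points ?E \<rat>) = {Origin}"
    unfolding torsion_points_def map by (rule rational_torsion)
  show "torsion_points ?E Q_infinity_3 \<cong> integer_mod_group 7"
    unfolding torsion_points_def map by (rule torsion_iso)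
qed

end

section \<open>The j-invariants as rational functions of \<open>n\<close>\<close>

definition poly_e :: "complex poly" where "poly_e = [:- 1, 6, - 3, - 1:]"
definition poly_e2 :: "complex poly" where "poly_e2 = [:- 3, 3, - 3:]"
definition poly_dl :: "complex poly" where "poly_dl = [:- 9, 0, 27, - 9:]"
definition poly_t :: "complex poly" where "poly_t = [:6, - 9, - 9, 6:]"

lemma (in trace_zero_family) poly_values:
  "poly poly_e (of_int n) = of_int e" "poly poly_e2 (of_int n) = of_int e2"
  "poly poly_dl (of_int n) = of_int dl" "poly poly_t (of_int n) = of_int t"
  unfolding poly_e_def poly_e2_def poly_dl_def poly_t_def e_def e2_def dl_def t_def
  by (simp_all add: power2_eq_square power3_eq_cube algebra_simps)

text \<open>A common pole of both \<open>j\<close>-invariants: where \<open>e\<close> vanishes, the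
  numerators reduce to \<open>- 2 e2 ^ 12\<close> and \<open>t ^ 12\<close>.\<close>

lemma root_poly_e: obtains z where "poly poly_e z = 0" "poly poly_e2 z \<noteq> 0" "poly poly_t z \<noteq> 0"
proof -
  have "\<not> constant (poly poly_e)" unfolding constant_degree by (simp add: poly_e_def)
  then obtain z where z: "poly poly_e z = 0" using fundamental_theorem_of_algebra by blast
  hence e: "6 * z - 3 * z ^ 2 - z ^ 3 = 1"
    by (simp add: poly_e_def power2_eq_square power3_eq_cube algebra_simps)
  have "poly poly_e2 z \<noteq> 0"
  proof
    assume "poly poly_e2 z = 0"
    hence "3 * (z ^ 2) = 3 * (z - 1)" by (simp add: poly_e2_def power2_eq_square algebra_simps)
    hence z2: "z ^ 2 = z - 1" by (metis mult_cancel_left zero_neq_numeral)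
    have "z ^ 3 = z * z ^ 2" by (simp add: power3_eq_cube power2_eq_square)
    also have "\<dots> = z ^ 2 - z" unfolding z2 by (simp add: algebra_simps flip: power2_eq_square) (simp add: z2)
    also have "\<dots> = - 1" by (simp add: z2)
    finally have "z ^ 3 = - 1" .
    hence "3 * (z + 1) = 0" using e z2 by (simp add: algebra_simps)
    hence "z + 1 = 0" by (simp only: mult_eq_0_iff) simp
    hence "z = - 1" by (simp only: eq_neg_iff_add_eq_0)
    thus False using z2 by simp
  qed
  moreover have "poly poly_t z \<noteq> 0"
  proof
    assume "poly poly_t z = 0"
    hence t: "6 - 9 * z - 9 * z ^ 2 + 6 * z ^ 3 = 0"
      by (simp add: poly_t_def power2_eq_square power3_eq_cube algebra_simps)
    have "27 * (z * (1 - z)) = (6 - 9 * z - 9 * z ^ 2 + 6 * z ^ 3) + 6 * (6 * z - 3 * z ^ 2 - z ^ 3 - 1)"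
      by (simp add: power2_eq_square power3_eq_cube algebra_simps)
    also have "\<dots> = 0" unfolding t e by simp
    finally have "z = 0 \<or> z = 1" by simp
    thus False using e by auto
  qed
  ultimately show ?thesis using that z by blast
qed

lemma family_int: "trace_zero_family (3 + 201243 * int k)"
  by unfold_locales simp

lemma inj_family: "inj (\<lambda>k. complex_of_int (3 + 201243 * int k))"
  by (rule injI) simp

lemma infinitely_many_seven:
  "infinite {j :: rat. \<exists>E :: rat weierstrass. elliptic_curve E \<and> j_invariant E = j
     \<and> carrier (torsion_points E \<rat>) = {Origin} \<and> torsion_points E Q_infinity_3 \<cong> integer_mod_group 7}"
  (is "infinite ?S")
proof -
  have ex: "\<exists>j\<in>?S. of_rat j * poly (poly_e ^ 7 * (13 * poly_e + poly_dl)) (of_int m)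
      = poly (- 2 * (poly_e2 * (poly_e2 ^ 3 - 4 * poly_e ^ 2 - 4 * poly_e * poly_dl)) ^ 3) (of_int m)"
    if m: "trace_zero_family m" for m
  proof -
    interpret trace_zero_family m by (rule m)
    let ?d = "e ^ 7 * (13 * e + dl)"
    obtain E :: "rat weierstrass" where E: "elliptic_curve E" "j_invariant E = of_int (- 2 * C4 ^ 3) / of_int ?d"
      "carrier (torsion_points E \<rat>) = {Origin}" "torsion_points E Q_infinity_3 \<cong> integer_mod_group 7"
      using seven_curve by blast
    obtain d where "dl = 9 * d" using mod_three(2) by blast
    hence "13 * e + dl \<noteq> 0" using mod_three(1) by presburger
    hence "?d \<noteq> 0" using e_nonzero by simp
    hence "of_rat (j_invariant E) * complex_of_int ?d = of_int (- 2 * C4 ^ 3)"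
      unfolding E(2) of_rat_divide of_rat_of_int_eq
      by (simp only: times_divide_eq_left nonzero_mult_div_cancel_right of_int_eq_0_iff not_False_eq_True)
    thus ?thesis using E unfolding C4_def
      by (intro bexI[of _ "j_invariant E"]) (auto simp: poly_values)
  qed
  obtain z where z: "poly poly_e z = 0" "poly poly_e2 z \<noteq> 0" by (rule root_poly_e)
  show ?thesis
    by (rule infinite_quotients[OF inj_family ex[OF family_int], of z]) (use z in simp_all)
qed

lemma infinitely_many_nine:
  "infinite {j :: rat. \<exists>E :: rat weierstrass. elliptic_curve E \<and> j_invariant E = j
     \<and> torsion_points E \<rat> \<cong> integer_mod_group 3 \<and> torsion_points E Q_infinity_3 \<cong> integer_mod_group 9}"
  (is "infinite ?S")
proof -
  have ex: "\<exists>j\<in>?S. of_rat j * poly (poly_e ^ 9 * (poly_t ^ 3 - 27 * poly_e ^ 3)) (of_int m)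
      = poly (poly_t ^ 3 * (poly_t ^ 3 - 24 * poly_e ^ 3) ^ 3) (of_int m)"
    if m: "trace_zero_family m" for m
  proof -
    interpret trace_zero_family m by (rule m)
    let ?d = "e ^ 9 * (t ^ 3 - 27 * e ^ 3)"
    obtain E :: "rat weierstrass" where E: "elliptic_curve E"
      "j_invariant E = of_int (t ^ 3 * (t ^ 3 - 24 * e ^ 3) ^ 3) / of_int ?d"
      "torsion_points E \<rat> \<cong> integer_mod_group 3" "torsion_points E Q_infinity_3 \<cong> integer_mod_group 9"
      using nine_curve by blast
    have "?d \<noteq> 0" using e_nonzero te_nonzero by simp
    hence "of_rat (j_invariant E) * complex_of_int ?d = of_int (t ^ 3 * (t ^ 3 - 24 * e ^ 3) ^ 3)"
      unfolding E(2) of_rat_divide of_rat_of_int_eq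
      by (simp only: times_divide_eq_left nonzero_mult_div_cancel_right of_int_eq_0_iff not_False_eq_True)
    thus ?thesis using E
      by (intro bexI[of _ "j_invariant E"]) (auto simp: poly_values)
  qed
  obtain z where z: "poly poly_e z = 0" "poly poly_t z \<noteq> 0" by (rule root_poly_e)
  show ?thesis
    by (rule infinite_quotients[OF inj_family ex[OF family_int], of z]) (use z in simp_all)
qed

theorem corollary6p9:
  shows "infinite {j :: rat. \<exists>E :: rat weierstrass.
            elliptic_curve E \<and> j_invariant E = j
            \<and> carrier (torsion_points E \<rat>) = {Origin}
            \<and> torsion_points E Q_infinity_3 \<cong> integer_mod_group 7}
       \<and> infinite {j :: rat. \<exists>E :: rat weierstrass.
            elliptic_curve E \<and> j_invariant E = j
            \<and> torsion_points E \<rat> \<cong> integer_mod_group 3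
            \<and> torsion_points E Q_infinity_3 \<cong> integer_mod_group 9}"
  using infinitely_many_seven infinitely_many_nine by blast

end
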